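(* Let $1\le p\le 2$ and let $f\in H^p_{\mathrm{slice}}(\mathbb{R}^{n+1}_+)$. Then for every $J\in\mathbb{S}$ we have $\operatorname{supp}\mathscr{F}_J(f|_{J\mathbb{R}})\subset(-\infty,0]$ and $$f(u+Jv)=\frac{1}{\sqrt{2\pi}}\int_{-\infty}^{0}e^{(u+Jv)w}\,\mathscr{F}_J(f|_{J\mathbb{R}})(w)\,dw\qquad(u>0,\ v\in\mathbb{R}),$$ where $f|_{J\mathbb{R}}$ is the non-tangential boundary limit of $f$ on $J\mathbb{R}$.
   Context: $\mathbb{R}_n$ is the real Clifford algebra generated by $\mathbf{e}_1,\dots,\mathbf{e}_n$ with $\mathbf{e}_r\mathbf{e}_s+\mathbf{e}_s\mathbf{e}_r=-2\delta_{rs}$; its elements are $a=\sum_A a_A\mathbf{e}_A$ ($a_A\in\mathbb{R}$, $A\subseteq\{1,\dots,n\}$ ordered, $\mathbf{e}_A$ the corresponding ordered product, $\mathbf{e}_\varnothing=1$), with norm $|a|=(\sum_A a_A^2)^{1/2}$. $\mathbb{R}^{n+1}$ is identified with the set of paravectors $x_0+x_1\mathbf{e}_1+\dots+x_n\mathbf{e}_n$. $\mathbb{S}=\{x_1\mathbf{e}_1+\dots+x_n\mathbf{e}_n:\ x_1^2+\dots+x_n^2=1\}$, so $I^2=-1$ for $I\in\mathbb{S}$; $L_I=\mathbb{R}+I\mathbb{R}\cong\mathbb{C}$. For $U\subseteq\mathbb{R}^{n+1}$ open, a real differentiable $f:U\to\mathbb{R}_n$ is left slice monogenic, written $f\in\mathcal{SM}_l(U)$,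 if for every $I\in\mathbb{S}$, $\frac12\left(\frac{\partial}{\partial u}+I\frac{\partial}{\partial v}\right)f(u+Iv)=0$ on $U\cap L_I$. $\mathbb{R}^{n+1}_+=\{u+Iv:\ u>0,\ v\in\mathbb{R},\ I\in\mathbb{S}\}$ and $\Pi_{+,I}=\mathbb{R}^{n+1}_+\cap L_I$. For $1\le p\le2$, $H^p_{\mathrm{slice}}(\mathbb{R}^{n+1}_+)$ is the space of functions $f\in\mathcal{SM}_l(\mathbb{R}^{n+1}_+)$ such that $\sup_{I\in\mathbb{S}}\int_{\mathbb{R}}|f(Iv)|^p\,dv<\infty$, where $f(Iv)$ denotes the non-tangential boundary limit (taken within $\Pi_{+,I}$) of $f$ at $Iv$, for almost every $v\in\mathbb{R}$. $f|_{I\mathbb{R}}$ denotes the function $v\mapsto f(Iv)$. One-dimensional left-sided Clifford Fourier transform: for $I\in\mathbb{S}$ and $g\in L^1(\mathbb{R})$ with values in $\mathbb{R}_n$, $\mathscr{F}_I(g)(w)=\frac{1}{\sqrt{2\pi}}\int_{\mathbb{R}}e^{-Ivw}g(v)\,dv$, extended to $\mathbb{R}_n$-valued $g\in L^p(\mathbb{R})$, $1\le p\le2$, by continuity (Hausdorff–Young).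
   Formalization: Membership in H^p_slice also requires, for each I in S, that the integral of |f(u+Iv)|^p dv over R be bounded uniformly in u>0; without this the claim fails, e.g. for f(x)=e^x(1+x)^{-2}. *)

theory Defs
  imports "HOL-Analysis.Analysis"
begin

section \<open>The real Clifford algebra with negative definite signature\<close>

text \<open>
  The generators are indexed by a finite linearly ordered type \<open>'n\<close> with \<open>n = CARD('n)\<close> elements;
  an element is the family of its coefficients \<open>a\<^sub>A\<close>, \<open>A\<close> ranging over all subsets of \<open>'n\<close>.
\<close>

typedef 'n clifford = "UNIV :: ('n set \<Rightarrow> real) set"
  morphisms clcoeff Clifford ..

setup_lifting type_definition_clifford

lemma clifford_eq_iff: "x = y \<longleftrightarrow> (\<forall>A. clcoeff x A = clcoeff y A)"
  by transfer auto

lemma clifford_eqI: "(\<And>A. clcoeff x A = clcoeff y A) \<Longrightarrow> x = y"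
  by (simp add: clifford_eq_iff)

lift_definition blade :: "'n set \<Rightarrow> 'n clifford" is "\<lambda>A B. if A = B then 1 else 0" .

abbreviation gen :: "'n \<Rightarrow> 'n clifford" where
  "gen i \<equiv> blade {i}"

instantiation clifford :: (finite) real_vector
begin
lift_definition zero_clifford :: "'a clifford" is "\<lambda>_. 0" .
lift_definition plus_clifford :: "'a clifford \<Rightarrow> 'a clifford \<Rightarrow> 'a clifford" is "\<lambda>x y A. x A + y A" .
lift_definition minus_clifford :: "'a clifford \<Rightarrow> 'a clifford \<Rightarrow> 'a clifford" is "\<lambda>x y A. x A - y A" .
lift_definition uminus_clifford :: "'a clifford \<Rightarrow> 'a clifford" is "\<lambda>x A. - x A" .
lift_definition scaleR_clifford :: "real \<Rightarrow> 'a clifford \<Rightarrow> 'a clifford" is "\<lambda>r x A. r * x A" .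
instance
  by standard (transfer; force simp: algebra_simps)+
end

lemma clcoeff_simps [simp]:
  "clcoeff 0 A = 0"
  "clcoeff (x + y) A = clcoeff x A + clcoeff y A"
  "clcoeff (x - y) A = clcoeff x A - clcoeff y A"
  "clcoeff (- x) A = - clcoeff x A"
  "clcoeff (r *\<^sub>R x) A = r * clcoeff x A"
  "clcoeff (blade B) A = (if B = A then 1 else 0)"
  by (transfer; simp)+

lemma clcoeff_sum [simp]: "clcoeff (sum f S) A = (\<Sum>i\<in>S. clcoeff (f i) A)"
  by (induction S rule: infinite_finite_induct) auto

instantiation clifford :: (finite) real_inner
begin
definition inner_clifford :: "'a clifford \<Rightarrow> 'a clifford \<Rightarrow> real" where
  "inner_clifford x y = (\<Sum>A\<in>UNIV. clcoeff x A * clcoeff y A)"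
definition norm_clifford :: "'a clifford \<Rightarrow> real" where
  "norm_clifford x = sqrt (inner x x)"
definition dist_clifford :: "'a clifford \<Rightarrow> 'a clifford \<Rightarrow> real" where
  "dist_clifford x y = norm (x - y)"
definition sgn_clifford :: "'a clifford \<Rightarrow> 'a clifford" where
  "sgn_clifford x = x /\<^sub>R norm x"
definition uniformity_clifford :: "('a clifford \<times> 'a clifford) filter" where
  "uniformity_clifford = (INF e\<in>{0 <..}. principal {(x, y). dist x y < e})"
definition open_clifford :: "'a clifford set \<Rightarrow> bool" where
  "open_clifford U \<longleftrightarrow> (\<forall>x\<in>U. eventually (\<lambda>(x', y). x' = x \<longrightarrow> y \<in> U) uniformity)"
instance
proof
  fix x y z :: "'a clifford" and r :: real and U :: "'a clifford set"
  show "inner x y = inner y x"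
    by (simp add: inner_clifford_def mult.commute)
  show "inner (x + y) z = inner x z + inner y z"
    by (simp add: inner_clifford_def sum.distrib algebra_simps)
  show "inner (r *\<^sub>R x) y = r * inner x y"
    by (simp add: inner_clifford_def sum_distrib_left algebra_simps)
  show "0 \<le> inner x x"
    by (simp add: inner_clifford_def sum_nonneg)
  show "(inner x x = 0) = (x = 0)"
    by (simp add: inner_clifford_def sum_nonneg_eq_0_iff clifford_eq_iff)
qed (simp_all add: norm_clifford_def dist_clifford_def sgn_clifford_def
       uniformity_clifford_def open_clifford_def)
end

instantiation clifford :: (finite) euclidean_space
begin
definition Basis_clifford :: "'a clifford set" where
  "Basis_clifford = range blade"
instance
proof
  have inner_blade: "inner x (blade A) = clcoeff x A" for x :: "'a clifford" and A
    by (simp add: inner_clifford_def if_distrib[of "(*) _"] cong: if_cong)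
  fix x u v :: "'a clifford"
  show "(Basis :: 'a clifford set) \<noteq> {}" "finite (Basis :: 'a clifford set)"
    by (auto simp: Basis_clifford_def)
  show "(\<forall>u\<in>Basis. inner x u = 0) = (x = 0)"
    by (auto simp: Basis_clifford_def inner_blade clifford_eq_iff)
  show "inner u v = (if u = v then 1 else 0)" if "u \<in> Basis" "v \<in> Basis"
    using that by (auto simp: Basis_clifford_def inner_blade clifford_eq_iff)
qed
end

text \<open>
  Sorting the word \<open>e\<^sub>A e\<^sub>B\<close> costs a factor \<open>-1\<close> for every \<open>i \<in> A\<close>, \<open>j \<in> B\<close> with \<open>i > j\<close>
  (anticommutation) and a factor \<open>-1\<close> for every \<open>i \<in> A \<inter> B\<close> (\<open>e\<^sub>i\<^sup>2 = -1\<close>); hence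
  \<open>e\<^sub>A e\<^sub>B = blade_sign A B \<cdot> e\<^sub>C\<close>, where \<open>C\<close> is the symmetric difference of \<open>A\<close> and \<open>B\<close>.
\<close>

definition blade_sign :: "'n::linorder set \<Rightarrow> 'n set \<Rightarrow> real" where
  "blade_sign A B = (\<Prod>i\<in>A. \<Prod>j\<in>B. if i \<ge> j then -1 else 1)"

lemma prod_sym_diff:
  fixes f :: "'a \<Rightarrow> real"
  assumes "finite A" "finite B" and sq: "\<And>i. f i * f i = 1"
  shows "prod f (sym_diff A B) = prod f A * prod f B"
proof -
  have "prod f A = prod f (A - B) * prod f (A \<inter> B)"
    by (simp add: prod.Int_Diff[OF assms(1), of f B])
  moreover have "prod f B = prod f (B - A) * prod f (A \<inter> B)"
    by (simp add: prod.Int_Diff[OF assms(2), of f A] Int_commute)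
  moreover have "prod f (A \<inter> B) * prod f (A \<inter> B) = 1"
    by (simp add: sq flip: prod.distrib)
  moreover have "prod f (sym_diff A B) = prod f (A - B) * prod f (B - A)"
    using assms by (intro prod.union_disjoint) auto
  ultimately show ?thesis
    by algebra
qed

lemma blade_sign_sym_diff_left:
  fixes A B C :: "'n::{finite,linorder} set"
  shows "blade_sign (sym_diff A B) C = blade_sign A C * blade_sign B C"
  unfolding blade_sign_def
  by (rule prod_sym_diff) (simp_all add: prod.neutral flip: prod.distrib)

lemma blade_sign_sym_diff_right:
  fixes A B C :: "'n::{finite,linorder} set"
  shows "blade_sign C (sym_diff A B) = blade_sign C A * blade_sign C B"
  unfolding blade_sign_def
  by (subst prod_sym_diff) (simp_all add: prod.distrib)

lemma blade_sign_empty [simp]: "blade_sign {} B = 1" "blade_sign A {} = 1"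
  by (simp_all add: blade_sign_def)

lemma sum_sym_diff_reindex:
  fixes f :: "'n::finite set \<Rightarrow> real"
  shows "(\<Sum>B\<in>UNIV. f (sym_diff A B)) = (\<Sum>B\<in>UNIV. f B)"
  by (rule sum.reindex_bij_witness[where i = "sym_diff A" and j = "sym_diff A"]) auto

instantiation clifford :: ("{finite,linorder}") real_algebra_1
begin
definition one_clifford :: "'a clifford" where
  "one_clifford = blade {}"
lift_definition times_clifford :: "'a clifford \<Rightarrow> 'a clifford \<Rightarrow> 'a clifford" is
  "\<lambda>x y C. \<Sum>A\<in>UNIV. blade_sign A (sym_diff A C) * x A * y (sym_diff A C)" .
instance
proof
  fix a b c :: "'a clifford" and r :: real
  have coeff_mult: "clcoeff (x * y) C =
      (\<Sum>A\<in>UNIV. blade_sign A (sym_diff A C) * clcoeff x A * clcoeff y (sym_diff A C))"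
    for x y :: "'a clifford" and C by transfer simp
  show "a * b * c = a * (b * c)"
  proof (rule clifford_eqI)
    fix D
    have "clcoeff (a * b * c) D = (\<Sum>C\<in>UNIV. \<Sum>A\<in>UNIV. blade_sign C (sym_diff C D) *
        (blade_sign A (sym_diff A C) * clcoeff a A * clcoeff b (sym_diff A C)) * clcoeff c (sym_diff C D))"
      by (simp add: coeff_mult sum_distrib_left sum_distrib_right)
    also have "\<dots> = (\<Sum>A\<in>UNIV. \<Sum>C\<in>UNIV. blade_sign C (sym_diff C D) *
        (blade_sign A (sym_diff A C) * clcoeff a A * clcoeff b (sym_diff A C)) * clcoeff c (sym_diff C D))"
      by (rule sum.swap)
    also have "\<dots> = (\<Sum>A\<in>UNIV. \<Sum>B\<in>UNIV. blade_sign (sym_diff A B) (sym_diff (sym_diff A B) D) *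
        (blade_sign A (sym_diff A (sym_diff A B)) * clcoeff a A * clcoeff b (sym_diff A (sym_diff A B)))
        * clcoeff c (sym_diff (sym_diff A B) D))"
      by (rule sum.cong[OF refl], rule sum_sym_diff_reindex[symmetric])
    also have "\<dots> = (\<Sum>A\<in>UNIV. \<Sum>B\<in>UNIV. blade_sign A (sym_diff A D) * clcoeff a A *
        (blade_sign B (sym_diff B (sym_diff A D)) * clcoeff b B * clcoeff c (sym_diff B (sym_diff A D))))"
    proof (intro sum.cong refl)
      fix A B :: "'a set"
      have e1: "sym_diff A (sym_diff A B) = B" by auto
      have e2: "sym_diff (sym_diff A B) D = sym_diff B (sym_diff A D)" by auto
      have e3: "sym_diff B (sym_diff B (sym_diff A D)) = sym_diff A D" by auto
      have "blade_sign (sym_diff A B) (sym_diff B (sym_diff A D)) * blade_sign A B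
          = blade_sign A (sym_diff B (sym_diff B (sym_diff A D))) * blade_sign B (sym_diff B (sym_diff A D))"
        unfolding blade_sign_sym_diff_left[of A B] blade_sign_sym_diff_right[of A B "sym_diff B (sym_diff A D)"]
        by (simp add: algebra_simps)
      then have e4: "blade_sign (sym_diff A B) (sym_diff B (sym_diff A D)) * blade_sign A B
          = blade_sign A (sym_diff A D) * blade_sign B (sym_diff B (sym_diff A D))"
        unfolding e3 .
      show "blade_sign (sym_diff A B) (sym_diff (sym_diff A B) D) *
        (blade_sign A (sym_diff A (sym_diff A B)) * clcoeff a A * clcoeff b (sym_diff A (sym_diff A B)))
        * clcoeff c (sym_diff (sym_diff A B) D) =
        blade_sign A (sym_diff A D) * clcoeff a A *
        (blade_sign B (sym_diff B (sym_diff A D)) * clcoeff b B * clcoeff c (sym_diff B (sym_diff A D)))"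
        unfolding e1 e2 using e4 by algebra
    qed
    also have "\<dots> = clcoeff (a * (b * c)) D"
      by (simp add: coeff_mult sum_distrib_left)
    finally show "clcoeff (a * b * c) D = clcoeff (a * (b * c)) D" .
  qed
  show "(a + b) * c = a * c + b * c" "a * (b + c) = a * b + a * c"
    by (rule clifford_eqI; simp add: coeff_mult algebra_simps sum.distrib)+
  show "r *\<^sub>R a * b = r *\<^sub>R (a * b)" "a * r *\<^sub>R b = r *\<^sub>R (a * b)"
    by (rule clifford_eqI; simp add: coeff_mult sum_distrib_left mult_ac)+
  show "1 * a = a"
  proof (rule clifford_eqI)
    fix C
    have "clcoeff (1 * a) C = (\<Sum>A\<in>(UNIV :: 'a set set). if A = {} then clcoeff a C else 0)"
      unfolding coeff_mult one_clifford_def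
    proof (rule sum.cong[OF refl])
      fix A :: "'a set"
      show "blade_sign A (sym_diff A C) * clcoeff (blade {}) A * clcoeff a (sym_diff A C)
          = (if A = {} then clcoeff a C else 0)"
        by (cases "A = {}") auto
    qed
    then show "clcoeff (1 * a) C = clcoeff a C" by simp
  qed
  show "a * 1 = a"
  proof (rule clifford_eqI)
    fix C
    have "clcoeff (a * 1) C = (\<Sum>A\<in>UNIV. if A = C then clcoeff a C else 0)"
      unfolding coeff_mult one_clifford_def
    proof (rule sum.cong[OF refl])
      fix A :: "'a set"
      have "{} = sym_diff A C \<longleftrightarrow> A = C" by blast
      then show "blade_sign A (sym_diff A C) * clcoeff a A * clcoeff (blade {}) (sym_diff A C)
          = (if A = C then clcoeff a C else 0)"
        by (cases "A = C") (simp_all only: clcoeff_simps, simp_all)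
    qed
    then show "clcoeff (a * 1) C = clcoeff a C" by simp
  qed
  show "(0::'a clifford) \<noteq> 1"
    by (auto simp: one_clifford_def clifford_eq_iff)
qed
end

lemma clcoeff_mult:
  "clcoeff (x * y) C =
    (\<Sum>A\<in>UNIV. blade_sign A (sym_diff A C) * clcoeff x A * clcoeff y (sym_diff A C))"
  by transfer simp

lemma blade_mult: "blade A * blade B = blade_sign A B *\<^sub>R blade (sym_diff A B)"
proof (rule clifford_eqI)
  fix C
  have "clcoeff (blade A * blade B) C =
      (\<Sum>D\<in>UNIV. if D = A then (if sym_diff A B = C then blade_sign A B else 0) else 0)"
    unfolding clcoeff_mult
  proof (rule sum.cong[OF refl])
    fix D
    show "blade_sign D (sym_diff D C) * clcoeff (blade A) D * clcoeff (blade B) (sym_diff D C)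
        = (if D = A then (if sym_diff A B = C then blade_sign A B else 0) else 0)"
    proof (cases "D = A")
      case True
      show ?thesis
      proof (cases "sym_diff A B = C")
        case eq: True
        then have "sym_diff A C = B" by blast
        then show ?thesis using True eq by simp
      next
        case False
        then have "B \<noteq> sym_diff A C" by blast
        then show ?thesis using True False by simp
      qed
    qed simp
  qed
  then show "clcoeff (blade A * blade B) C = clcoeff (blade_sign A B *\<^sub>R blade (sym_diff A B)) C"
    by simp
qed

lemma gen_anticommute: "gen i * gen j + gen j * gen i = (if i = j then -2 else 0)"
proof (cases "i = j")
  case True
  then show ?thesis
    by (simp add: blade_mult blade_sign_def flip: one_clifford_def)
next
  case False
  then have "sym_diff {i} {j} = {i, j}" "sym_diff {j} {i} = {i, j}" by auto
  with False show ?thesis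
    by (auto simp: blade_mult blade_sign_def)
qed

lemma blade_eq_prod_gen: "blade A = prod_list (map gen (sorted_list_of_set A))"
proof -
  have "finite A" by simp
  then show ?thesis
  proof (induction A rule: finite_linorder_min_induct)
    case empty
    then show ?case by (simp add: one_clifford_def)
  next
    case (insert b A)
    have "sorted_list_of_set (insert b A) = b # sorted_list_of_set A"
      using insert by (intro sorted_list_of_set_unique[THEN iffD1]) (auto simp: card_insert_if)
    moreover have "sym_diff {b} A = insert b A"
      using insert by auto
    moreover have "blade_sign {b} A = 1"
      using insert by (auto simp: blade_sign_def intro!: prod.neutral)
    ultimately show ?case
      using insert.IH[symmetric] by (simp add: blade_mult)
  qed
qed

lemma clifford_expansion:
  fixes x :: "'n::finite clifford"
  shows "x = (\<Sum>A\<in>UNIV. clcoeff x A *\<^sub>R blade A)"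
  by (rule clifford_eqI) (simp add: if_distrib[of "(*) _"] cong: if_cong)

text \<open>
  The library's \<open>exp\<close> needs a submultiplicative norm, which the Clifford norm is not.
\<close>

definition clifford_exp :: "'n::{finite,linorder} clifford \<Rightarrow> 'n clifford" where
  "clifford_exp x = (\<Sum>k. x ^ k /\<^sub>R fact k)"


section \<open>Slice monogenic functions\<close>

definition paravectors :: "'n::{finite,linorder} clifford set" where
  "paravectors = {of_real x0 + (\<Sum>i\<in>UNIV. x i *\<^sub>R gen i) | x0 x. True}"

definition imag_sphere :: "'n::{finite,linorder} clifford set" where
  "imag_sphere = {(\<Sum>i\<in>UNIV. x i *\<^sub>R gen i) | x. (\<Sum>i\<in>UNIV. (x i)\<^sup>2) = 1}"

definition slice_pt :: "'n::{finite,linorder} clifford \<Rightarrow> real \<Rightarrow> real \<Rightarrow> 'n clifford" where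
  "slice_pt I u v = of_real u + v *\<^sub>R I"

definition half_space :: "'n::{finite,linorder} clifford set" where
  "half_space = {slice_pt I u v | I u v. I \<in> imag_sphere \<and> u > 0}"

text \<open>
  Functions are total on the algebra; only their values on \<open>U\<close> matter.  As \<open>U\<close> is open relative to
  the paravectors, \<open>differentiable_on\<close> (which is differentiability within \<open>U\<close>) is real
  differentiability in the \<open>n + 1\<close> paravector variables.
\<close>

definition slice_monogenic ::
    "'n::{finite,linorder} clifford set \<Rightarrow> ('n clifford \<Rightarrow> 'n clifford) set" where
  "slice_monogenic U = {f. openin (top_of_set paravectors) U \<and> f differentiable_on U \<and>
     (\<forall>I\<in>imag_sphere. \<forall>u v. slice_pt I u v \<in> U \<longrightarrow>
        (1/2) *\<^sub>R (vector_derivative (\<lambda>s. f (slice_pt I s v)) (at u)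
                 + I * vector_derivative (\<lambda>t. f (slice_pt I u t)) (at v)) = 0)}"

lemma paravector_clcoeff:
  fixes x0 :: real and x :: "'n::{finite,linorder} \<Rightarrow> real"
  shows "clcoeff (of_real x0 + (\<Sum>i\<in>UNIV. x i *\<^sub>R gen i)) {} = x0"
  by (simp add: of_real_def one_clifford_def)

lemma half_space_eq:
  "(half_space :: 'n::{finite,linorder} clifford set) = {x \<in> paravectors. clcoeff x {} > 0}"
proof (intro equalityI subsetI)
  fix x :: "'n clifford" assume "x \<in> half_space"
  then obtain I u v where x: "x = slice_pt I u v" and I: "I \<in> imag_sphere" and u: "u > 0"
    unfolding half_space_def by blast
  from I obtain y where y: "I = (\<Sum>i\<in>UNIV. y i *\<^sub>R gen i)"
    unfolding imag_sphere_def by blast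
  have "x = of_real u + (\<Sum>i\<in>UNIV. (v * y i) *\<^sub>R gen i)"
    unfolding x y slice_pt_def by (simp add: scaleR_sum_right)
  moreover from this have "clcoeff x {} = u"
    using paravector_clcoeff[of u "\<lambda>i. v * y i"] by (simp only:)
  ultimately show "x \<in> {x \<in> paravectors. clcoeff x {} > 0}"
    unfolding paravectors_def mem_Collect_eq using u
    by (intro conjI exI[of _ u] exI[of _ "\<lambda>i. v * y i"]) simp_all
next
  fix x :: "'n clifford" assume "x \<in> {x \<in> paravectors. clcoeff x {} > 0}"
  then obtain u y where x: "x = of_real u + (\<Sum>i\<in>UNIV. y i *\<^sub>R gen i)" and "clcoeff x {} > 0"
    unfolding paravectors_def by blast
  then have u: "u > 0"
    by (simp only: paravector_clcoeff)
  define v where "v = sqrt (\<Sum>i\<in>UNIV. (y i)\<^sup>2)"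
  obtain z v' where z: "(\<Sum>i\<in>UNIV. (z i)\<^sup>2) = 1" "\<And>i. y i = v' * z i"
  proof (cases "v = 0")
    case True
    then have "y i = 0" for i
      by (simp add: v_def sum_nonneg_eq_0_iff)
    moreover have "(\<Sum>i\<in>UNIV. (if i = k then 1 else 0 :: real)\<^sup>2) = 1" for k :: 'n
      by (simp add: if_distribR if_distrib[of "\<lambda>x. x\<^sup>2"] cong: if_cong)
    ultimately show thesis
      using that[of "\<lambda>i. if i = undefined then 1 else 0" 0] by simp
  next
    case False
    have "v\<^sup>2 = (\<Sum>i\<in>UNIV. (y i)\<^sup>2)" by (simp add: v_def sum_nonneg)
    moreover have "(\<Sum>i\<in>UNIV. (y i / v)\<^sup>2) = (\<Sum>i\<in>UNIV. (y i)\<^sup>2) / v\<^sup>2"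
      by (simp only: power_divide sum_divide_distrib)
    ultimately have "(\<Sum>i\<in>UNIV. (y i / v)\<^sup>2) = v\<^sup>2 / v\<^sup>2"
      by simp
    also have "\<dots> = 1"
      using False by simp
    finally have "(\<Sum>i\<in>UNIV. (y i / v)\<^sup>2) = 1" .
    with False show thesis using that[of "\<lambda>i. y i / v" v] by simp
  qed
  have "x = slice_pt (\<Sum>i\<in>UNIV. z i *\<^sub>R gen i) u v'"
    by (simp add: slice_pt_def x z(2) scaleR_sum_right)
  moreover have "(\<Sum>i\<in>UNIV. z i *\<^sub>R gen i) \<in> imag_sphere"
    using z(1) unfolding imag_sphere_def by blast
  ultimately show "x \<in> half_space"
    using u unfolding half_space_def by blast
qed

lemma openin_half_space:
  "openin (top_of_set paravectors) (half_space :: 'n::{finite,linorder} clifford set)"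
proof -
  have "clcoeff x {} = inner x (blade {})" for x :: "'n clifford"
    by (simp add: inner_clifford_def if_distrib[of "(*) _"] cong: if_cong)
  then have eq: "(\<lambda>x :: 'n clifford. clcoeff x {}) = (\<lambda>x. inner x (blade {}))"
    by (rule ext)
  have "continuous_on UNIV (\<lambda>x :: 'n clifford. clcoeff x {})"
    by (subst eq) (intro continuous_intros)
  then have "open {x :: 'n clifford. clcoeff x {} > 0}"
    by (intro open_Collect_less continuous_on_const)
  moreover have "(half_space :: 'n clifford set) = paravectors \<inter> {x. clcoeff x {} > 0}"
    by (auto simp: half_space_eq)
  ultimately show ?thesis unfolding openin_open by blast
qed


section \<open>Non-tangential boundary values and the Hardy space\<close>

definition has_nt_limit ::
    "('n::{finite,linorder} clifford \<Rightarrow> 'n clifford) \<Rightarrow> 'n clifford \<Rightarrow> real \<Rightarrow> 'n clifford \<Rightarrow> bool" where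
  "has_nt_limit f I v L \<longleftrightarrow>
     (\<forall>a>0. (f \<longlongrightarrow> L) (at (slice_pt I 0 v) within {slice_pt I s t | s t. s > 0 \<and> \<bar>t - v\<bar> < a * s}))"

definition nt_limit ::
    "('n::{finite,linorder} clifford \<Rightarrow> 'n clifford) \<Rightarrow> 'n clifford \<Rightarrow> real \<Rightarrow> 'n clifford" where
  "nt_limit f I v = (THE L. has_nt_limit f I v L)"

text \<open>
  The boundary conditions alone (last two clauses) do not define a Hardy space: for
  \<open>f x = exp x * (1 + x)\<^sup>-\<^sup>2\<close> they hold for every \<open>p\<close>, but the boundary values have Fourier spectrum
  \<open>(-\<infinity>, 1]\<close>.  As in the classical theory, the values \<open>f(Iv)\<close> are the boundary values of a function
  whose restriction to each slice \<open>\<Pi>\<^sub>+\<^sub>,\<^sub>I\<close> lies in the classical Hardy space of that half-plane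
  (second clause).
\<close>

definition classical_hardy_on_slice ::
    "real \<Rightarrow> 'n::{finite,linorder} clifford \<Rightarrow> ('n clifford \<Rightarrow> 'n clifford) \<Rightarrow> bool" where
  "classical_hardy_on_slice p I f \<longleftrightarrow>
     (SUP u\<in>{0<..}. \<integral>\<^sup>+ v. ennreal (norm (f (slice_pt I u v)) powr p) \<partial>lebesgue) < \<infinity>"

definition hardy_slice :: "real \<Rightarrow> ('n::{finite,linorder} clifford \<Rightarrow> 'n clifford) set" where
  "hardy_slice p = {f. f \<in> slice_monogenic half_space \<and>
     (\<forall>I\<in>imag_sphere. classical_hardy_on_slice p I f) \<and>
     (\<forall>I\<in>imag_sphere. AE v in lebesgue. \<exists>L. has_nt_limit f I v L) \<and>
     (SUP I\<in>imag_sphere. \<integral>\<^sup>+ v. ennreal (norm (nt_limit f I v) powr p) \<partial>lebesgue) < \<infinity>}"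


section \<open>The one-dimensional Clifford Fourier transform\<close>

definition Lp_fun :: "real \<Rightarrow> (real \<Rightarrow> 'n::finite clifford) set" where
  "Lp_fun p = {g \<in> borel_measurable lebesgue. integrable lebesgue (\<lambda>v. norm (g v) powr p)}"

definition Lp_tendsto ::
    "real \<Rightarrow> (nat \<Rightarrow> real \<Rightarrow> 'n::finite clifford) \<Rightarrow> (real \<Rightarrow> 'n clifford) \<Rightarrow> bool" where
  "Lp_tendsto p G g \<longleftrightarrow>
     (\<lambda>k. \<integral>\<^sup>+ v. ennreal (norm (G k v - g v) powr p) \<partial>lebesgue) \<longlonglongrightarrow> 0"

definition fourier_L1 ::
    "'n::{finite,linorder} clifford \<Rightarrow> (real \<Rightarrow> 'n clifford) \<Rightarrow> real \<Rightarrow> 'n clifford" where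
  "fourier_L1 I g w =
     (1 / sqrt (2 * pi)) *\<^sub>R (LINT v|lebesgue. clifford_exp (- ((v * w) *\<^sub>R I)) * g v)"

text \<open>
  For \<open>1 < p \<le> 2\<close> the transform is the extension by continuity \<open>L\<^sup>p \<rightarrow> L\<^sup>p\<^sup>'\<close>, \<open>p' = p / (p - 1)\<close>, from the
  dense subspace \<open>L\<^sup>1 \<inter> L\<^sup>p\<close>.  By the Hausdorff-Young inequality such an \<open>h\<close> exists for all \<open>g\<close> in \<open>L\<^sup>p\<close>;
  it is unique up to null sets, and the choice operator picks a representative.
\<close>

definition fourier ::
    "real \<Rightarrow> 'n::{finite,linorder} clifford \<Rightarrow> (real \<Rightarrow> 'n clifford) \<Rightarrow> real \<Rightarrow> 'n clifford" where
  "fourier p I g =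
     (if p = 1 then fourier_L1 I g
      else SOME h. h \<in> Lp_fun (p / (p - 1)) \<and>
        (\<forall>G. (\<forall>k. G k \<in> Lp_fun 1 \<inter> Lp_fun p) \<and> Lp_tendsto p G g \<longrightarrow>
             Lp_tendsto (p / (p - 1)) (\<lambda>k. fourier_L1 I (G k)) h))"

text \<open>Support in the sense of distributions, insensitive to null sets.\<close>

definition ess_support :: "(real \<Rightarrow> 'n::finite clifford) \<Rightarrow> real set" where
  "ess_support h = - \<Union>{U. open U \<and> (AE w in lebesgue. w \<in> U \<longrightarrow> h w = 0)}"

end

theory Submission
  imports Defs "HOL-Complex_Analysis.Complex_Analysis" "HOL-Probability.Sinc_Integral"
begin

text \<open>
  Left multiplication by \<open>J\<close> makes the Clifford algebra a complex vector space, and for every blade \<open>b\<close>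
  the complex linear functional \<open>a \<mapsto> \<langle>a, b\<rangle> + i \<langle>a, J b\<rangle>\<close> turns the restriction of \<open>f\<close> to the slice of
  \<open>J\<close> into a holomorphic function on the right half-plane.  This reduces the theorem to scalar
  functions.

  For a scalar \<open>F\<close> in the Hardy space \<open>H\<^sup>1\<close>, the maximum principle bounds \<open>\<bar>F\<bar>\<close> to the power \<open>1/2\<close> on
  \<open>Re z > \<delta>\<close> by the Poisson integral of its values on \<open>Re z = \<delta>\<close>.  These values are bounded in \<open>L\<^sup>2\<close>,
  so the bound survives \<open>\<delta> \<rightarrow> 0\<close>; squaring it shows that the \<open>L\<^sup>1\<close> norms on vertical lines do not
  exceed that of the boundary function \<open>g\<close>, hence \<open>F(\<delta> + i \<cdot>) \<rightarrow> g\<close> in \<open>L\<^sup>1\<close> and \<open>F\<close> is the Poisson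
  integral of \<open>g\<close>.  In particular the integral of \<open>F\<close> over vertical lines is constant; applied to
  \<open>F(z) e\<^sup>-\<^sup>z\<^sup>w\<close> with \<open>w > 0\<close>, whose line integrals decay, this gives the vanishing of the transform of
  \<open>g\<close> at \<open>w\<close>, and Fourier inversion of the Poisson kernel gives the representation.

  For \<open>1 < p \<le> 2\<close> the function \<open>f(z) / (1 + z/k)\<^sup>2\<close> belongs to \<open>H\<^sup>1\<close>, and \<open>k \<rightarrow> \<infinity>\<close> is justified by the
  Hausdorff-Young inequality, which is obtained (with some constant) by real interpolation.
\<close>

section \<open>Poisson majorants on the half-plane\<close>

text \<open>L^1 bounds on vertical lines yield, by weak compactness, only a measure on the boundary,
  and almost everywhere convergence to g does not exclude a singular part. The square root is there
  to exclude it: L^2 bounds make the functions sqrt |F| uniformly integrable against the Poisson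
  kernel, so their majorant survives the limit. Subharmonicity is replaced by a local condition:
  near each z there is a holomorphic K with Re K <= V and equality at z. It covers Re (c F) and sqrt
  |F| alike, is inherited by V minus a Poisson integral, and is all that the maximum principle
  needs. As the half-plane is unbounded, V has to be bounded above (Phragmen-Lindelof). For p > 1
  the weight has the power 2 in order to be integrable on vertical lines; its modulus is at most 1,
  so it keeps the L^p bounds. \<open>fourier\<close> chooses a function compatible with all
  approximating sequences, so the existence of one must be proved before anything is known about it.
  Continuity of the transform suffices for that, which is why any constant in the Hausdorff-Young
  inequality will do.\<close>

text \<open>
  Subtracting a small multiple of \<open>Re (csqrt (1 + z))\<close> makes the supremum attained on a compact set;
  at the leftmost maximum the local holomorphic minorant is constant, which yields a maximum
  further to the left.
\<close>

lemma half_plane_max_principle: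
  fixes V :: "complex \<Rightarrow> real"
  assumes cont: "continuous_on {z. 0 \<le> Re z} V"
    and bdd: "\<And>z. 0 \<le> Re z \<Longrightarrow> V z \<le> B"
    and bdry: "\<And>z. Re z = 0 \<Longrightarrow> V z \<le> 0"
    and supp: "\<And>z. 0 < Re z \<Longrightarrow> \<exists>r>0. \<exists>K. K holomorphic_on ball z r \<and>
                 (\<forall>w\<in>ball z r. 0 < Re w \<longrightarrow> Re (K w) \<le> V w) \<and> Re (K z) = V z"
    and z: "0 \<le> Re z"
  shows "V z \<le> 0"
proof (rule ccontr)
  assume "\<not> V z \<le> 0"
  then have Vz: "V z > 0" by simp
  \<comment> \<open>The summand 1 makes \<open>e * Re (csqrt (1 + z))\<close> strictly smaller than
    \<open>V z\<close>, so that W is still positive at z.\<close>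
  define c where "c = Re (csqrt (1 + z)) + 1"
  have c: "c > 0" using csqrt_principal[of "1 + z"] by (auto simp: c_def add_pos_nonneg complex_eq_iff)
  define e where "e = V z / c"
  have e: "e > 0" using Vz c by (simp add: e_def)
  define W where "W = (\<lambda>w. V w - e * Re (csqrt (1 + w)))"
  have nn: "0 \<le> Re (csqrt (1 + w))" for w
    using abs_Re_le_cmod[of "1 + w"] by (simp add: abs_le_iff)
  have Wz: "W z > 0"
  proof -
    have "e * Re (csqrt (1 + z)) < e * c" using e by (simp add: c_def)
    also have "\<dots> = V z" using c by (simp add: e_def)
    finally show ?thesis by (simp add: W_def)
  qed
  \<comment> \<open>For Re w >= 0, \<open>Re (csqrt (1 + w))\<close> is at least sqrt (|1 + w| / 2),
    hence at least B / e once |1 + w| >= 2 (B / e)^2. The summand 1 pays for passing from w to 1 +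
    w.\<close>
  define R where "R = 2 * (B / e)\<^sup>2 + 1 + cmod z"
  have out: "W w \<le> 0" if "0 \<le> Re w" "cmod w > R" for w
  proof -
    have "2 * (B/e)\<^sup>2 \<le> cmod (1 + w)"
    proof -
      have "cmod w \<le> cmod (1 + w) + 1" using norm_triangle_ineq4[of "1+w" 1] by simp
      then show ?thesis using that by (simp add: R_def) (smt (verit) norm_ge_zero)
    qed
    then have "(B/e)\<^sup>2 \<le> (cmod (1 + w) + Re (1 + w)) / 2"
      using that by simp
    then have "sqrt ((B/e)\<^sup>2) \<le> sqrt ((cmod (1 + w) + Re (1 + w)) / 2)"
      by (rule real_sqrt_le_mono)
    then have "B / e \<le> Re (csqrt (1 + w))" unfolding real_sqrt_abs csqrt.simps by linarith
    then have "B \<le> e * Re (csqrt (1 + w))" using e by (simp add: field_simps)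
    then show ?thesis using bdd[OF that(1)] by (simp add: W_def)
  qed
  define K0 where "K0 = {w. 0 \<le> Re w} \<inter> cball 0 R"
  have zK: "z \<in> K0" using z out[of z] Wz by (force simp: K0_def not_le[symmetric])
  have contW: "continuous_on {w. 0 \<le> Re w} W"
    unfolding W_def
    by (intro continuous_intros cont holomorphic_on_imp_continuous_on holomorphic_intros)
       (auto simp: complex_nonpos_Reals_iff)
  have compK: "compact K0"
    unfolding K0_def by (intro closed_Int_compact closed_halfspace_Re_ge) auto
  have contK: "continuous_on K0 W" by (rule continuous_on_subset[OF contW]) (auto simp: K0_def)
  obtain zm where zm: "zm \<in> K0" "\<And>w. w \<in> K0 \<Longrightarrow> W w \<le> W zm"
    using continuous_attains_sup[OF compK _ contK] zK by blast
  define m where "m = W zm"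
  have m: "m > 0" using zm(2)[OF zK] Wz by (simp add: m_def)
  have glob: "W w \<le> m" if "0 \<le> Re w" for w
    using zm(2)[of w] out[of w] that m by (cases "cmod w \<le> R") (auto simp: K0_def m_def)
  define S where "S = K0 \<inter> W -` {m}"
  have compS: "compact S"
    unfolding S_def
    using continuous_closed_preimage[OF contK compact_imp_closed[OF compK], of "{m}"]
      compact_Int_closed[OF compK] by (metis Int_assoc Int_left_absorb closed_singleton)
  have "zm \<in> S" using zm by (simp add: S_def m_def)
  then obtain z0 where z0: "z0 \<in> S" "\<And>w. w \<in> S \<Longrightarrow> Re z0 \<le> Re w"
    using continuous_attains_inf[OF compS, of Re] continuous_on_Re[OF continuous_on_id[of S]] by auto
  have W0: "W z0 = m" and "0 \<le> Re z0" using z0 by (auto simp: S_def K0_def)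
  have "Re z0 \<noteq> 0"
  proof
    assume "Re z0 = 0"
    from bdry[OF this] have "W z0 \<le> 0" using e nn[of z0] unfolding W_def
      by (smt (verit) mult_nonneg_nonneg)
    then show False using W0 m by simp
  qed
  with \<open>0 \<le> Re z0\<close> have pos: "Re z0 > 0" by simp
  obtain r0 K where r0: "r0 > 0" and K: "K holomorphic_on ball z0 r0"
    "\<And>w. w \<in> ball z0 r0 \<Longrightarrow> 0 < Re w \<Longrightarrow> Re (K w) \<le> V w" "Re (K z0) = V z0"
    using supp[OF pos] by blast
  define r where "r = min r0 (Re z0)"
  have r: "r > 0" "r \<le> r0" "r \<le> Re z0" using r0 pos by (auto simp: r_def)
  have pos': "0 < Re w" if "w \<in> ball z0 r" for w
  proof -
    have "\<bar>Re (z0 - w)\<bar> < Re z0"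
      using that r abs_Re_le_cmod[of "z0 - w"] by (simp add: dist_norm)
    then show ?thesis by simp
  qed
  define L where "L = (\<lambda>w. K w - of_real e * csqrt (1 + w))"
  have "ball z0 r \<subseteq> ball z0 r0" using r by auto
  then have holL: "L holomorphic_on ball z0 r"
    unfolding L_def
    by (intro holomorphic_intros holomorphic_on_subset[OF K(1)])
       (use pos' in \<open>force simp: complex_nonpos_Reals_iff\<close>)+
  have LW: "Re (L w) \<le> W w" if "w \<in> ball z0 r" for w
    using K(2)[of w] that pos'[OF that] \<open>ball z0 r \<subseteq> ball z0 r0\<close> by (auto simp: L_def W_def simp del: csqrt.simps)
  have L0: "Re (L z0) = m" using K(3) W0 by (simp add: L_def W_def del: csqrt.simps)
  \<comment> \<open>Exponentiating turns the maximum of Re L at the centre into a maximum of a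
    modulus.\<close>
  have const: "(\<lambda>w. exp (L w)) constant_on ball z0 r"
  proof (rule maximum_modulus_principle[where U = "ball z0 r" and \<xi> = z0])
    show "(\<lambda>w. exp (L w)) holomorphic_on ball z0 r" by (intro holomorphic_intros holL)
    fix w assume "w \<in> ball z0 r"
    then have "Re (L w) \<le> m" using LW[of w] glob[of w] pos'[of w] by linarith
    then show "norm (exp (L w)) \<le> norm (exp (L z0))" by (simp add: L0)
  qed (use r in auto)
  define w where "w = z0 - of_real (r/2)"
  have w: "w \<in> ball z0 r" using r by (simp add: w_def dist_norm)
  have "exp (L w) = exp (L z0)"
    using const w r by (auto simp: constant_on_def)
  then have "Re (L w) = m" using L0 by (metis norm_exp_eq_Re exp_inj_iff)
  then have "W w = m" using LW[OF w] glob[of w] pos'[OF w] by linarith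
  moreover have "cmod w \<le> R" using out[of w] pos'[OF w] m \<open>W w = m\<close> by (force simp: not_le[symmetric])
  ultimately have "w \<in> S" using pos'[OF w] by (auto simp: S_def K0_def)
  from z0(2)[OF this] show False using r by (simp add: w_def)
qed

section \<open>The Poisson kernel and Poisson integrals of bounded functions\<close>

definition poisson_kernel :: "real \<Rightarrow> real \<Rightarrow> real" where
  "poisson_kernel u t = u / (pi * (u\<^sup>2 + t\<^sup>2))"

text \<open>The usual convolution after the substitution t = Im z + Re z * s. In this form it also
  makes sense for Re z = 0, where it returns the boundary value, and continuity up to the boundary
  is dominated convergence with a fixed kernel.\<close>

definition poisson_integral :: "(real \<Rightarrow> real) \<Rightarrow> complex \<Rightarrow> real" where
  "poisson_integral \<phi> z = (\<integral>s. poisson_kernel 1 s * \<phi> (Im z + Re z * s) \<partial>lborel)"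

lemma poisson_kernel_measurable [measurable]: "poisson_kernel u \<in> borel_measurable borel"
  unfolding poisson_kernel_def by measurable

lemma poisson_kernel_minus [simp]: "poisson_kernel u (-t) = poisson_kernel u t"
  by (simp add: poisson_kernel_def)

lemma poisson_kernel_nonneg: "u \<ge> 0 \<Longrightarrow> poisson_kernel u t \<ge> 0"
  by (simp add: poisson_kernel_def)

lemma poisson_kernel_scale: "u > 0 \<Longrightarrow> u * poisson_kernel u (u * s) = poisson_kernel 1 s"
proof -
  assume u: "u > 0"
  have "u\<^sup>2 + (u * s)\<^sup>2 = u * u * (1 + s\<^sup>2)"
    by (simp add: algebra_simps power2_eq_square)
  then show ?thesis
    using u by (simp add: poisson_kernel_def)
qed

lemma has_bochner_integral_poisson_kernel_1: "has_bochner_integral lborel (poisson_kernel 1) 1"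
proof -
  have *: "poisson_kernel 1 = (\<lambda>s. (1/pi) * inverse (1 + s\<^sup>2))"
    by (auto simp: poisson_kernel_def field_simps)
  have "einterval (-\<infinity>) \<infinity> = UNIV" by (simp add: einterval_def)
  then show ?thesis
    unfolding has_bochner_integral_iff *
    using integrable_inverse_1_plus_square LBINT_inverse_1_plus_square
    by (simp add: set_integrable_def interval_lebesgue_integral_def set_lebesgue_integral_def)
qed

lemma has_bochner_integral_poisson_kernel:
  assumes "u > 0"
  shows "has_bochner_integral lborel (\<lambda>t. poisson_kernel u (v - t)) 1"
proof -
  have "has_bochner_integral lborel (\<lambda>t. poisson_kernel 1 (-v/u + (1/u) * t)) (1 /\<^sub>R \<bar>1/u\<bar>)"
    using assms by (intro lborel_has_bochner_integral_real_affine_iff[THEN iffD1]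
        has_bochner_integral_poisson_kernel_1) auto
  then have "has_bochner_integral lborel (\<lambda>t. (1/u) * poisson_kernel 1 (-v/u + (1/u) * t)) ((1/u) * (1 /\<^sub>R \<bar>1/u\<bar>))"
    by (intro has_bochner_integral_mult_right) auto
  moreover have "(1/u) * poisson_kernel 1 (-v/u + (1/u) * t) = poisson_kernel u (v - t)" for t
  proof -
    have "u * (-v/u + (1/u) * t) = - (v - t)"
      using assms by (simp add: field_simps)
    then show ?thesis
      using poisson_kernel_scale[OF assms, of "-v/u + (1/u) * t"] assms
        poisson_kernel_minus[of u "v - t"]
      by (metis divide_inverse_commute inverse_eq_divide mult.assoc mult_1 nonzero_mult_div_cancel_left order_less_irrefl)
  qed
  ultimately show ?thesis using assms by simp
qed

lemma poisson_integral_eq: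
  assumes "u > 0"
  shows "poisson_integral \<phi> (Complex u v) = (\<integral>t. poisson_kernel u (v - t) * \<phi> t \<partial>lborel)"
proof -
  have "(\<integral>t. poisson_kernel u (v - t) * \<phi> t \<partial>lborel) =
      \<bar>u\<bar> *\<^sub>R (\<integral>s. poisson_kernel u (v - (v + u * s)) * \<phi> (v + u * s) \<partial>lborel)"
    using assms by (intro lborel_integral_real_affine) auto
  also have "\<dots> = (\<integral>s. u * (poisson_kernel u (v - (v + u * s)) * \<phi> (v + u * s)) \<partial>lborel)"
    using assms by simp
  also have "\<dots> = (\<integral>s. poisson_kernel 1 s * \<phi> (v + u * s) \<partial>lborel)"
    by (intro Bochner_Integration.integral_cong refl)
       (simp add: poisson_kernel_scale[OF assms] mult.assoc[symmetric])
  finally show ?thesis by (simp add: poisson_integral_def)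
qed

lemma poisson_integral_bound:
  assumes [measurable]: "\<phi> \<in> borel_measurable borel" and bdd: "\<And>t. \<bar>\<phi> t\<bar> \<le> B"
  shows "\<bar>poisson_integral \<phi> z\<bar> \<le> B"
proof -
  have bnd: "norm (poisson_kernel 1 s * \<phi> (Im z + Re z * s)) \<le> poisson_kernel 1 s * B" for s
    by (simp add: abs_mult poisson_kernel_nonneg bdd mult_left_mono)
  have int: "integrable lborel (\<lambda>s. poisson_kernel 1 s * B)"
    using has_bochner_integral_poisson_kernel_1 by (simp add: has_bochner_integral_iff)
  have "integrable lborel (\<lambda>s. poisson_kernel 1 s * \<phi> (Im z + Re z * s))"
    by (rule Bochner_Integration.integrable_bound[OF int])
       (use bnd in \<open>auto intro: order_trans[OF _ abs_ge_self]\<close>)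
  then have "norm (poisson_integral \<phi> z) \<le> (\<integral>s. poisson_kernel 1 s * B \<partial>lborel)"
    unfolding poisson_integral_def
    using int bnd by (rule Bochner_Integration.integral_norm_bound_integral)
  also have "\<dots> = B" using has_bochner_integral_poisson_kernel_1 by (simp add: has_bochner_integral_iff)
  finally show ?thesis by simp
qed

lemma continuous_on_poisson_integral:
  assumes cont: "continuous_on UNIV \<phi>" and bdd: "\<And>t. \<bar>\<phi> t\<bar> \<le> B"
  shows "continuous_on UNIV (poisson_integral \<phi>)"
  unfolding continuous_on_sequentially
proof (intro allI ballI impI, elim conjE)
  fix x :: "nat \<Rightarrow> complex" and a assume lim: "x \<longlonglongrightarrow> a"
  have [measurable]: "\<phi> \<in> borel_measurable borel"
    using cont by (rule borel_measurable_continuous_onI)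
  have "(\<lambda>n. \<integral>s. poisson_kernel 1 s * \<phi> (Im (x n) + Re (x n) * s) \<partial>lborel) \<longlonglongrightarrow>
     (\<integral>s. poisson_kernel 1 s * \<phi> (Im a + Re a * s) \<partial>lborel)"
  proof (rule integral_dominated_convergence[where w = "\<lambda>s. poisson_kernel 1 s * B"])
    show "integrable lborel (\<lambda>s. poisson_kernel 1 s * B)"
      using has_bochner_integral_poisson_kernel_1 by (simp add: has_bochner_integral_iff)
    show "AE s in lborel. norm (poisson_kernel 1 s * \<phi> (Im (x n) + Re (x n) * s)) \<le> poisson_kernel 1 s * B" for n
      by (simp add: abs_mult poisson_kernel_nonneg bdd mult_left_mono)
    have "isCont \<phi> y" for y using cont by (simp add: continuous_on_eq_continuous_at)
    then have "(\<lambda>n. \<phi> (Im (x n) + Re (x n) * s)) \<longlonglongrightarrow> \<phi> (Im a + Re a * s)" for s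
      by (rule isCont_tendsto_compose) (intro tendsto_intros lim)
    then show "AE s in lborel. (\<lambda>n. poisson_kernel 1 s * \<phi> (Im (x n) + Re (x n) * s))
        \<longlonglongrightarrow> poisson_kernel 1 s * \<phi> (Im a + Re a * s)"
      by (intro AE_I2 tendsto_intros)
  qed measurable
  then show "(poisson_integral \<phi> \<circ> x) \<longlonglongrightarrow> poisson_integral \<phi> a"
    by (simp add: poisson_integral_def[abs_def] o_def)
qed

lemma cmod_diff_imaginary:
  "(cmod (z - \<i> * of_real t))\<^sup>2 = (Re z)\<^sup>2 + (Im z - t)\<^sup>2"
  by (simp add: cmod_power2)

lemma poisson_kernel_eq_Re:
  "poisson_kernel (Re z) (Im z - t) = Re (1 / (z - \<i> * of_real t)) / pi"
  by (simp add: poisson_kernel_def Re_divide cmod_power2)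

lemma poisson_kernel_eq_cmod:
  "poisson_kernel (Re z) (Im z - t) = Re z / pi * (1 / (cmod (z - \<i> * of_real t))\<^sup>2)"
  by (simp add: poisson_kernel_def cmod_diff_imaginary)

text \<open>Subtracting the kernel at \<open>1\<close> makes the Cauchy kernel integrable against bounded functions.\<close>

lemma poisson_integral_eq_Re_holomorphic:
  assumes [measurable]: "\<phi> \<in> borel_measurable borel" and bdd: "\<And>t. \<bar>\<phi> t\<bar> \<le> B"
  obtains H where "H holomorphic_on {z. 0 < Re z}"
    "\<And>z. 0 < Re z \<Longrightarrow> poisson_integral \<phi> z = Re (H z)"
proof -
  define k where "k = (\<lambda>z t. of_real (\<phi> t) * (1 / (z - \<i> * of_real t) - 1 / (1 - \<i> * of_real t)))"
  have [measurable]: "k z \<in> borel_measurable borel" for z unfolding k_def by measurable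
  have nz: "z - \<i> * of_real t \<noteq> 0" if "0 < Re z" for z t
    using that by (auto simp: complex_eq_iff)
  have B: "0 \<le> B" using bdd[of 0] by linarith
  have int_sq: "integrable lborel (\<lambda>t. 1 / (cmod (z - \<i> * of_real t))\<^sup>2)" if "0 < Re z" for z
  proof -
    have "integrable lborel (\<lambda>t. pi / Re z * poisson_kernel (Re z) (Im z - t))"
      using has_bochner_integral_poisson_kernel[OF that, of "Im z"]
      by (simp add: has_bochner_integral_iff)
    then show ?thesis using that by (simp add: poisson_kernel_eq_cmod)
  qed
  have int_k: "integrable lborel (k z)" if "0 < Re z" for z
  proof (rule Bochner_Integration.integrable_bound)
    show "integrable lborel (\<lambda>t. B * cmod (1 - z) *
        (1 / (cmod (z - \<i> * of_real t))\<^sup>2 + 1 / (cmod (1 - \<i> * of_real t))\<^sup>2))"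
      by (intro integrable_mult_right Bochner_Integration.integrable_add int_sq that) simp_all
    show "AE t in lborel. norm (k z t) \<le> norm (B * cmod (1 - z) *
        (1 / (cmod (z - \<i> * of_real t))\<^sup>2 + 1 / (cmod (1 - \<i> * of_real t))\<^sup>2))"
    proof (rule AE_I2)
      fix t
      define a b where "a = 1 / cmod (z - \<i> * of_real t)" and "b = 1 / cmod (1 - \<i> * of_real t)"
      \<comment> \<open>The difference of the two Cauchy kernels is a multiple of their product,
        which decays quadratically; a * b <= a^2 + b^2 then bounds it by two Poisson
        kernels.\<close>
      have "k z t = of_real (\<phi> t) * (1 - z) * (1 / (z - \<i> * of_real t)) * (1 / (1 - \<i> * of_real t))"
        using nz[OF that, of t] nz[of 1 t] by (simp add: k_def divide_simps)
      then have "norm (k z t) = \<bar>\<phi> t\<bar> * cmod (1 - z) * (a * b)"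
        by (simp add: norm_mult norm_divide a_def b_def)
      also have "\<dots> \<le> B * cmod (1 - z) * (a\<^sup>2 + b\<^sup>2)"
      proof (intro mult_mono bdd)
        have "a * b + a * b \<le> a\<^sup>2 + b\<^sup>2" using sum_squares_bound[of a b] by simp
        moreover have "0 \<le> a * b" by (simp add: a_def b_def)
        ultimately show "a * b \<le> a\<^sup>2 + b\<^sup>2" by linarith
      qed (auto simp: B a_def b_def)
      also have "\<dots> \<le> norm \<dots>" by simp
      finally show "norm (k z t) \<le> norm (B * cmod (1 - z) *
        (1 / (cmod (z - \<i> * of_real t))\<^sup>2 + 1 / (cmod (1 - \<i> * of_real t))\<^sup>2))"
        by (simp add: a_def b_def power_divide)
    qed
  qed measurable
  \<comment> \<open>The real part of the Cauchy kernel is pi times the Poisson kernel, so the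
    integral yields the Poisson integral minus its value at 1, which is added back.\<close>
  define H where "H = (\<lambda>z. of_real (1 / pi) * (LBINT t. k z t) + of_real (poisson_integral \<phi> 1))"
  have deriv: "\<exists>D. (H has_field_derivative D) (at z)" if z: "0 < Re z" for z
  proof -
    \<comment> \<open>\<open>d w\<close> is the difference quotient of k between w and z, and
      \<open>d z\<close> its limit as w tends to z. On the ball of radius Re z / 2 the distance of w
      to a boundary point is at least half that of z, which gives a dominating function independent
      of w.\<close>
    define d where "d = (\<lambda>w t. - of_real (\<phi> t) / ((w - \<i> * of_real t) * (z - \<i> * of_real t)))"
    have [measurable]: "d w \<in> borel_measurable borel" for w unfolding d_def by measurable
    have pos: "0 < Re w" if "w \<in> ball z (Re z / 2)" for w
    proof -
      have "\<bar>Re (z - w)\<bar> < Re z / 2"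
        using that abs_Re_le_cmod[of "z - w"] by (simp add: dist_norm)
      then show ?thesis using z by (simp add: abs_if split: if_splits)
    qed
    have "((\<lambda>w. ((LBINT t. k w t) - (LBINT t. k z t)) / (w - z)) \<longlongrightarrow> (LBINT t. d z t)) (at z within ball z (Re z / 2))"
      unfolding tendsto_at_iff_sequentially
    proof (intro allI impI)
      fix X assume X: "\<forall>i. X i \<in> ball z (Re z / 2) - {z}" and lim: "X \<longlonglongrightarrow> z"
      have X0: "0 < Re (X i)" "X i \<noteq> z" "cmod (X i - z) < Re z / 2" for i
        using X pos[of "X i"] by (auto simp: dist_norm norm_minus_commute)
      have quot: "((LBINT t. k (X i) t) - (LBINT t. k z t)) / (X i - z) = (LBINT t. d (X i) t)" for i
      proof -
        have "d (X i) t = (k (X i) t - k z t) / (X i - z)" for t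
        proof -
          have *: "- p / (a * b) = (p * (1 / a - c) - p * (1 / b - c)) / (a - b)"
            if "a \<noteq> 0" "b \<noteq> 0" "a \<noteq> b" for a b c p :: complex
          proof -
            have "p * (1 / a - c) - p * (1 / b - c) = p * (b - a) / (a * b)"
              using that by (simp add: divide_simps) (simp add: algebra_simps)
            also have "\<dots> = (- p / (a * b)) * (a - b)"
              by (simp only: times_divide_eq_left) (simp add: algebra_simps)
            finally show ?thesis using that(3) by simp
          qed
          show ?thesis
            using *[OF nz[OF X0(1)[of i], of t] nz[OF z, of t]] X0(2)[of i]
            by (simp add: k_def d_def)
        qed
        then show ?thesis
          by (simp add: int_k X0 z)
      qed
      have "(\<lambda>i. LBINT t. d (X i) t) \<longlonglongrightarrow> (LBINT t. d z t)"
      proof (rule integral_dominated_convergence[where w = "\<lambda>t. 2 * B * (1 / (cmod (z - \<i> * of_real t))\<^sup>2)"])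
        show "integrable lborel (\<lambda>t. 2 * B * (1 / (cmod (z - \<i> * of_real t))\<^sup>2))"
          by (intro integrable_mult_right int_sq z)
        show "AE t in lborel. (\<lambda>i. d (X i) t) \<longlonglongrightarrow> d z t"
          unfolding d_def using nz[OF z] by (intro AE_I2 tendsto_intros lim) auto
        fix i
        have "norm (d (X i) t) \<le> 2 * B * (1 / (cmod (z - \<i> * of_real t))\<^sup>2)" for t
        proof -
          define m where "m = cmod (z - \<i> * of_real t)"
          have m: "Re z \<le> m" using complex_Re_le_cmod[of "z - \<i> * of_real t"] by (simp add: m_def)
          have "m \<le> cmod (X i - \<i> * of_real t) + cmod (X i - z)"
            using norm_triangle_ineq4[of "X i - \<i> * of_real t" "X i - z"] by (simp add: m_def)
          then have *: "m / 2 \<le> cmod (X i - \<i> * of_real t)" using X0(3)[of i] m by linarith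
          have "norm (d (X i) t) = \<bar>\<phi> t\<bar> / (cmod (X i - \<i> * of_real t) * m)"
            by (simp add: d_def m_def norm_divide norm_mult)
          also have "\<dots> \<le> B / (m / 2 * m)"
            using m z * by (intro frac_le bdd mult_right_mono B mult_pos_pos) auto
          finally show ?thesis by (simp add: m_def power2_eq_square mult.commute)
        qed
        then show "AE t in lborel. norm (d (X i) t) \<le> 2 * B * (1 / (cmod (z - \<i> * of_real t))\<^sup>2)"
          by simp
      qed measurable
      then show "((\<lambda>w. ((LBINT t. k w t) - (LBINT t. k z t)) / (w - z)) \<circ> X) \<longlonglongrightarrow> (LBINT t. d z t)"
        by (simp add: o_def quot)
    qed
    then have "((\<lambda>z. LBINT t. k z t) has_field_derivative (LBINT t. d z t)) (at z within ball z (Re z / 2))"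
      by (simp add: has_field_derivative_iff)
    then have "((\<lambda>z. LBINT t. k z t) has_field_derivative (LBINT t. d z t)) (at z)"
      using z by (subst (asm) at_within_open) auto
    then show ?thesis
      unfolding H_def by (auto intro!: exI derivative_eq_intros)
  qed
  have "H holomorphic_on {z. 0 < Re z}"
    using deriv by (auto simp: holomorphic_on_def field_differentiable_def intro: has_field_derivative_at_within)
  moreover have "poisson_integral \<phi> z = Re (H z)" if "0 < Re z" for z
  proof -
    have eq: "poisson_integral \<phi> w = (LBINT t. poisson_kernel (Re w) (Im w - t) * \<phi> t)" if "0 < Re w" for w
      using poisson_integral_eq[OF that, of \<phi> "Im w"] by simp
    have int: "integrable lborel (\<lambda>t. poisson_kernel (Re w) (Im w - t) * \<phi> t)" if w: "0 < Re w" for w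
    proof (rule Bochner_Integration.integrable_bound)
      show "integrable lborel (\<lambda>t. poisson_kernel (Re w) (Im w - t) * B)"
        using has_bochner_integral_poisson_kernel[OF w, of "Im w"] by (simp add: has_bochner_integral_iff)
      show "AE t in lborel. norm (poisson_kernel (Re w) (Im w - t) * \<phi> t) \<le> norm (poisson_kernel (Re w) (Im w - t) * B)"
        using bdd B w by (auto simp: abs_mult intro!: mult_left_mono)
    qed measurable
    have "Re (LBINT t. k z t) = (LBINT t. Re (k z t))"
      using int_k[OF that] by simp
    also have "\<dots> = (LBINT t. pi * (poisson_kernel (Re z) (Im z - t) * \<phi> t - poisson_kernel (Re 1) (Im 1 - t) * \<phi> t))"
      unfolding poisson_kernel_eq_Re[of z] poisson_kernel_eq_Re[of 1]
    proof (intro Bochner_Integration.integral_cong refl)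
      fix t
      define X Y where "X = 1 / (z - \<i> * of_real t)" and "Y = 1 / (1 - \<i> * of_real t)"
      have "k z t = of_real (\<phi> t) * (X - Y)" by (simp only: k_def X_def Y_def)
      then have "Re (k z t) = \<phi> t * (Re X - Re Y)" by (simp del: X_def Y_def)
      then show "Re (k z t) = pi * (Re (1 / (z - \<i> * of_real t)) / pi * \<phi> t - Re (1 / (1 - \<i> * of_real t)) / pi * \<phi> t)"
        unfolding X_def[symmetric] Y_def[symmetric] by (simp add: right_diff_distrib mult.commute)
    qed
    also have "\<dots> = pi * (poisson_integral \<phi> z - poisson_integral \<phi> 1)"
      unfolding eq[OF that] eq[of 1, simplified]
      using int[OF that] int[of 1, simplified] by simp
    finally show ?thesis by (simp add: H_def)
  qed
  ultimately show thesis by (rule that)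
qed

text \<open>V minus the Poisson integral of its boundary values is bounded and vanishes on the
  boundary. Since the Poisson integral is the real part of a holomorphic H, the local minorants K of
  V become minorants K - H of the difference, and the maximum principle applies.\<close>

lemma poisson_majorant:
  fixes V :: "complex \<Rightarrow> real"
  assumes cont: "continuous_on {z. 0 \<le> Re z} V"
    and bdd: "\<And>z. 0 \<le> Re z \<Longrightarrow> \<bar>V z\<bar> \<le> B"
    and supp: "\<And>z. 0 < Re z \<Longrightarrow> \<exists>r>0. \<exists>K. K holomorphic_on ball z r \<and>
                 (\<forall>w\<in>ball z r. 0 < Re w \<longrightarrow> Re (K w) \<le> V w) \<and> Re (K z) = V z"
    and z: "0 \<le> Re z"
  shows "V z \<le> poisson_integral (\<lambda>t. V (\<i> * of_real t)) z"
proof -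
  let ?\<phi> = "\<lambda>t. V (\<i> * of_real t)"
  have cont\<phi>: "continuous_on UNIV ?\<phi>"
    by (rule continuous_on_compose2[OF cont]) (auto intro!: continuous_intros)
  have meas: "?\<phi> \<in> borel_measurable borel"
    using cont\<phi> by (rule borel_measurable_continuous_onI)
  have bdd\<phi>: "\<bar>?\<phi> t\<bar> \<le> B" for t by (rule bdd) simp
  obtain H where H: "H holomorphic_on {z. 0 < Re z}"
    "\<And>z. 0 < Re z \<Longrightarrow> poisson_integral ?\<phi> z = Re (H z)"
    using poisson_integral_eq_Re_holomorphic[OF meas bdd\<phi>] by metis
  have "V z - poisson_integral ?\<phi> z \<le> 0"
  proof (rule half_plane_max_principle[where V = "\<lambda>z. V z - poisson_integral ?\<phi> z" and B = "B + B"])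
    show "continuous_on {z. 0 \<le> Re z} (\<lambda>z. V z - poisson_integral ?\<phi> z)"
      by (intro continuous_intros cont continuous_on_subset[OF continuous_on_poisson_integral[OF cont\<phi> bdd\<phi>]]) auto
    show "V z - poisson_integral ?\<phi> z \<le> B + B" if "0 \<le> Re z" for z
      using bdd[OF that] poisson_integral_bound[OF meas bdd\<phi>, of z] by linarith
    show "V z - poisson_integral ?\<phi> z \<le> 0" if "Re z = 0" for z
    proof -
      have "poisson_integral ?\<phi> z = V (\<i> * of_real (Im z)) * (LBINT s. poisson_kernel 1 s)"
        using that by (simp add: poisson_integral_def)
      also have "\<i> * of_real (Im z) = z" using that by (simp add: complex_eq_iff)
      finally show ?thesis using has_bochner_integral_poisson_kernel_1 by (simp add: has_bochner_integral_iff)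
    qed
    fix z assume z: "0 < Re z"
    from supp[OF z] obtain r K where rK: "r > 0" "K holomorphic_on ball z r"
      "\<And>w. w\<in>ball z r \<Longrightarrow> 0 < Re w \<Longrightarrow> Re (K w) \<le> V w" "Re (K z) = V z" by blast
    have pos: "0 < Re w" if "w \<in> ball z (min r (Re z))" for w
    proof -
      have "\<bar>Re (z - w)\<bar> < Re z"
        using that abs_Re_le_cmod[of "z - w"] by (simp add: dist_norm)
      then show ?thesis by simp
    qed
    have hol: "(\<lambda>w. K w - H w) holomorphic_on ball z (min r (Re z))"
      by (intro holomorphic_intros holomorphic_on_subset[OF rK(2)] holomorphic_on_subset[OF H(1)])
         (use pos in auto)
    show "\<exists>r>0. \<exists>K. K holomorphic_on ball z r \<and>
       (\<forall>w\<in>ball z r. 0 < Re w \<longrightarrow> Re (K w) \<le> V w - poisson_integral ?\<phi> w) \<and>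
       Re (K z) = V z - poisson_integral ?\<phi> z"
      by (rule exI[of _ "min r (Re z)"], intro conjI exI[of _ "\<lambda>w. K w - H w"])
         (use rK z hol H(2) in auto)
  qed (rule z)
  then show ?thesis by simp
qed

section \<open>The Hardy space of the half-plane for exponent one\<close>

text \<open>
  For a primitive \<open>G\<close> of \<open>F\<close> the increments \<open>G (z + i h) - G z\<close> are bounded by \<open>M\<close>, so by Cauchy's
  inequality \<open>F\<close> varies along a vertical line by at most \<open>2 M / Re z\<close>; being integrable there, it is
  arbitrarily small somewhere.
\<close>

lemma half_plane_integral_bound:
  fixes F :: "complex \<Rightarrow> complex" and M :: real
  assumes hol: "F holomorphic_on {z. 0 < Re z}"
    and bdd: "\<And>u. 0 < u \<Longrightarrow> (\<integral>\<^sup>+v. ennreal (cmod (F (Complex u v))) \<partial>lborel) \<le> ennreal M"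
    and M: "0 \<le> M" and z: "0 < Re z"
  shows "cmod (F z) \<le> 2 * M / Re z"
proof -
  let ?H = "{z. 0 < Re z}"
  have opn: "open ?H" by (rule open_halfspace_Re_gt)
  have Complex_eq': "Complex u v = of_real u + \<i> * of_real v" for u v
    by (simp add: complex_eq_iff)
  have contF: "continuous_on UNIV (\<lambda>v. F (Complex u v))" if "0 < u" for u
    by (rule continuous_on_compose2[OF holomorphic_on_imp_continuous_on[OF hol]])
       (use that in \<open>auto intro!: continuous_intros simp: Complex_eq'\<close>)
  have int: "integrable lborel (\<lambda>v. F (Complex u v))" if u: "0 < u" for u
    using borel_measurable_continuous_onI[OF contF[OF u]] bdd[OF u]
    by (intro integrableI_bounded) (auto simp: le_less_trans ennreal_less_top)
  obtain G where G: "\<And>x. x \<in> ?H \<Longrightarrow> (G has_field_derivative F x) (at x within ?H)"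
    using holomorphic_convex_primitive'[OF convex_halfspace_Re_gt opn hol] by blast
  have G': "(G has_field_derivative F x) (at x)" if "0 < Re x" for x
    using G[of x] that at_within_open[of x ?H] opn by simp
  have increment: "cmod (G (w + \<i> * of_real h) - G w) \<le> M" if w: "0 < Re w" and h: "0 \<le> h" for w h
  proof -
    let ?f = "\<lambda>t. \<i> * F (Complex (Re w) (Im w + t))"
    have cont: "continuous_on {0..h} ?f"
      by (intro continuous_intros continuous_on_compose2[OF contF[OF w]]) auto
    have der: "((\<lambda>t. G (Complex (Re w) (Im w + t))) has_vector_derivative ?f t) (at t within {0..h})" for t
    proof -
      have "((\<lambda>t. Complex (Re w) (Im w + t)) has_vector_derivative \<i>) (at t within {0..h})"
        unfolding Complex_eq' has_vector_derivative_def
        by (auto intro!: derivative_eq_intros simp: scaleR_conv_of_real mult.commute)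
      from field_vector_diff_chain_within[OF this has_field_derivative_at_within[OF G']] w
      show ?thesis by (simp add: o_def mult.commute)
    qed
    have FTC: "has_bochner_integral lborel (\<lambda>t. indicator {0..h} t *\<^sub>R ?f t)
        (G (Complex (Re w) (Im w + h)) - G (Complex (Re w) (Im w + 0)))"
      by (rule has_bochner_integral_FTC_Icc[OF h der cont])
    have int': "integrable lborel (\<lambda>t. F (Complex (Re w) (Im w + 1 * t)))"
      by (rule lborel_integrable_real_affine[OF int[OF w]]) simp
    have "cmod (LBINT t. indicator {0..h} t *\<^sub>R ?f t) \<le> (LBINT t. cmod (F (Complex (Re w) (Im w + 1 * t))))"
      by (rule Bochner_Integration.integral_norm_bound_integral)
         (use FTC int' in \<open>auto simp: has_bochner_integral_iff norm_mult indicator_def\<close>)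
    also have "\<dots> = (LBINT t. cmod (F (Complex (Re w) t)))"
      using lborel_integral_real_affine[of 1 "\<lambda>t. cmod (F (Complex (Re w) t))" "Im w"] by simp
    also have "\<dots> \<le> M"
      using bdd[OF w] M int[OF w] by (simp add: nn_integral_eq_integral)
    finally have le: "cmod (LBINT t. indicator {0..h} t *\<^sub>R ?f t) \<le> M" .
    show ?thesis
    proof -
      have "Complex (Re w) (Im w + h) = w + \<i> * of_real h" "Complex (Re w) (Im w + 0) = w"
        by (simp_all add: complex_eq_iff)
      then have "G (w + \<i> * of_real h) - G w = (LBINT t. indicator {0..h} t *\<^sub>R ?f t)"
        using FTC unfolding has_bochner_integral_iff by metis
      then show ?thesis using le by simp
    qed
  qed
  have shift: "cmod (F (z + \<i> * of_real h) - F z) \<le> 2 * M / Re z" if h: "0 \<le> h" for h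
  proof -
    let ?\<Psi> = "\<lambda>w. G (w + \<i> * of_real h) - G w"
    have der: "(?\<Psi> has_field_derivative F (w + \<i> * of_real h) - F w) (at w)" if "0 < Re w" for w
    proof (intro DERIV_diff G'[OF that])
      show "((\<lambda>w. G (w + \<i> * of_real h)) has_field_derivative F (w + \<i> * of_real h)) (at w)"
        using G'[of "w + \<i> * of_real h"] that by (subst DERIV_shift[symmetric]) simp
    qed
    have pos: "0 < Re w" if "w \<in> cball z (Re z / 2)" for w
    proof -
      have "\<bar>Re (z - w)\<bar> \<le> Re z / 2"
        using that abs_Re_le_cmod[of "z - w"] by (simp add: dist_norm)
      then have "Re z - Re w \<le> Re z / 2" unfolding minus_complex.sel by (rule order_trans[OF abs_ge_self])
      then show ?thesis using z by simp
    qed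
    have hol\<Psi>: "?\<Psi> holomorphic_on ?H"
      unfolding holomorphic_on_def field_differentiable_def
      using has_field_derivative_at_within[OF der] by blast
    have "cmod ((deriv ^^ 1) ?\<Psi> z) \<le> fact 1 * M / (Re z / 2) ^ 1"
    proof (rule Cauchy_inequality)
      show "?\<Psi> holomorphic_on ball z (Re z / 2)"
        by (rule holomorphic_on_subset[OF hol\<Psi>]) (use pos in auto)
      show "continuous_on (cball z (Re z / 2)) ?\<Psi>"
        by (rule holomorphic_on_imp_continuous_on, rule holomorphic_on_subset[OF hol\<Psi>]) (use pos in auto)
      show "0 < Re z / 2" using z by simp
      fix w assume "norm (z - w) = Re z / 2"
      then have "0 < Re w" by (intro pos) (simp add: dist_norm)
      then show "cmod (?\<Psi> w) \<le> M" by (rule increment[OF _ h])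
    qed
    then show ?thesis using DERIV_imp_deriv[OF der[OF z]] by (simp add: mult.commute)
  qed
  show ?thesis
  proof (rule field_le_epsilon)
    fix e :: real assume e: "0 < e"
    have "\<exists>h\<ge>0. cmod (F (z + \<i> * of_real h)) \<le> e"
    proof (rule ccontr)
      assume "\<not> ?thesis"
      then have big: "e \<le> cmod (F (z + \<i> * of_real h))" if "0 \<le> h" for h using that by force
      have "(\<integral>\<^sup>+v. ennreal e * indicator {Im z..} v \<partial>lborel) \<le> (\<integral>\<^sup>+v. ennreal (cmod (F (Complex (Re z) v))) \<partial>lborel)"
      proof (intro nn_integral_mono)
        fix v
        show "ennreal e * indicator {Im z..} v \<le> ennreal (cmod (F (Complex (Re z) v)))"
        proof (cases "Im z \<le> v")
          case True
          then have "z + \<i> * of_real (v - Im z) = Complex (Re z) v" by (simp add: complex_eq_iff)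
          then show ?thesis using big[of "v - Im z"] True by (auto intro!: ennreal_leI)
        qed simp
      qed
      also have "\<dots> \<le> ennreal M" by (rule bdd[OF z])
      also have "\<dots> < \<infinity>" by simp
      finally have "ennreal e * emeasure lborel {Im z..} < \<infinity>"
        by (simp add: nn_integral_cmult_indicator)
      moreover have "emeasure lborel {Im z..} = \<infinity>"
      proof (rule ccontr)
        assume "emeasure lborel {Im z..} \<noteq> \<infinity>"
        then obtain c where c: "emeasure lborel {Im z..} = ennreal c" "0 \<le> c"
          by (cases "emeasure lborel {Im z..}") auto
        have "emeasure lborel {Im z..Im z + (c + 1)} \<le> emeasure lborel {Im z..}"
          by (intro emeasure_mono) auto
        then show False using c by simp
      qed
      ultimately show False using e by (simp add: ennreal_mult_top)
    qed
    then obtain h where h: "0 \<le> h" "cmod (F (z + \<i> * of_real h)) \<le> e" by blast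
    have "cmod (F z) \<le> cmod (F (z + \<i> * of_real h)) + cmod (F (z + \<i> * of_real h) - F z)"
      by (metis norm_minus_commute norm_triangle_sub)
    then show "cmod (F z) \<le> 2 * M / Re z + e" using shift[OF h(1)] h(2) by linarith
  qed
qed

lemma poisson_kernel_le: "0 < u \<Longrightarrow> poisson_kernel u t \<le> 1 / (pi * u)"
proof -
  assume u: "0 < u"
  have "poisson_kernel u t \<le> u / (pi * u\<^sup>2)"
    unfolding poisson_kernel_def using u by (intro divide_left_mono mult_left_mono mult_pos_pos add_pos_nonneg) auto
  then show ?thesis using u by (simp add: power2_eq_square)
qed

lemma integrable_poisson_kernel_mult:
  fixes h :: "real \<Rightarrow> 'a::{banach, second_countable_topology}"
  assumes "0 < u" and int: "integrable lborel h"
  shows "integrable lborel (\<lambda>t. poisson_kernel u (v - t) *\<^sub>R h t)"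
proof (rule Bochner_Integration.integrable_bound)
  show "integrable lborel (\<lambda>t. 1 / (pi * u) * norm (h t))"
    using int by (intro integrable_mult_right integrable_norm)
  have [measurable]: "h \<in> borel_measurable borel" using int by simp
  show "(\<lambda>t. poisson_kernel u (v - t) *\<^sub>R h t) \<in> borel_measurable lborel" by measurable
  show "AE t in lborel. norm (poisson_kernel u (v - t) *\<^sub>R h t) \<le> norm (1 / (pi * u) * norm (h t))"
    using assms poisson_kernel_nonneg[of u] mult_right_mono[OF poisson_kernel_le[of u] norm_ge_zero]
    by (auto intro!: AE_I2 simp: abs_mult)
qed

text \<open>H^1 of the right half-plane with boundary function g. Convergence is only asked along
  the sequence \<open>1 / Suc n\<close>, so non-tangential approach stays out of the scalar theory;
  g is a Borel function because the scalar part integrates over \<open>lborel\<close>.\<close>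

locale half_plane_hardy1 =
  fixes F :: "complex \<Rightarrow> complex" and g :: "real \<Rightarrow> complex" and M :: real
  assumes hol: "F holomorphic_on {z. 0 < Re z}"
    and M_nonneg: "0 \<le> M"
    and bdd: "\<And>u. 0 < u \<Longrightarrow> (\<integral>\<^sup>+v. ennreal (cmod (F (Complex u v))) \<partial>lborel) \<le> ennreal M"
    and g_measurable [measurable]: "g \<in> borel_measurable borel"
    and lim: "AE v in lborel. (\<lambda>n. F (Complex (1 / Suc n) v)) \<longlonglongrightarrow> g v"
begin

lemma cont: "continuous_on {z. 0 < Re z} F"
  by (rule holomorphic_on_imp_continuous_on[OF hol])

lemma isCont_F: "0 < Re z \<Longrightarrow> isCont F z"
  using cont continuous_on_eq_continuous_at[OF open_halfspace_Re_gt[of 0]] by auto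

lemma continuous_line: "0 < u \<Longrightarrow> continuous_on UNIV (\<lambda>v. F (Complex u v))"
  unfolding Complex_eq
  by (rule continuous_on_compose2[OF cont]) (auto intro!: continuous_intros)

lemma measurable_line [measurable (raw)]: "0 < u \<Longrightarrow> (\<lambda>v. F (Complex u v)) \<in> borel_measurable borel"
  by (rule borel_measurable_continuous_onI[OF continuous_line])

lemma integrable_line: "0 < u \<Longrightarrow> integrable lborel (\<lambda>v. F (Complex u v))"
  using bdd[of u] measurable_line[of u]
  by (intro integrableI_bounded) (auto simp: le_less_trans ennreal_less_top)

lemma integral_line_le: "0 < u \<Longrightarrow> (LBINT v. cmod (F (Complex u v))) \<le> M"
  using bdd[of u] integrable_line[of u] M_nonneg by (simp add: nn_integral_eq_integral)

lemma bound: "0 < Re z \<Longrightarrow> cmod (F z) \<le> 2 * M / Re z"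
  by (rule half_plane_integral_bound[OF hol bdd M_nonneg])

lemma bound_shift:
  assumes "0 < d" "0 \<le> Re z"
  shows "cmod (F (z + of_real d)) \<le> 2 * M / d"
proof -
  have "cmod (F (z + of_real d)) \<le> 2 * M / (Re z + d)" using bound[of "z + of_real d"] assms by simp
  also have "\<dots> \<le> 2 * M / d" using assms M_nonneg by (intro divide_left_mono mult_pos_pos) auto
  finally show ?thesis .
qed

lemma continuous_shift:
  "0 < d \<Longrightarrow> continuous_on {z. 0 \<le> Re z} (\<lambda>z. F (z + of_real d))"
  by (rule continuous_on_compose2[OF cont]) (auto intro!: continuous_intros)

lemma holomorphic_shift:
  assumes "0 < d" "S \<subseteq> {z. 0 \<le> Re z}"
  shows "(\<lambda>z. F (z + of_real d)) holomorphic_on S"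
proof -
  have "(F \<circ> (\<lambda>z. z + of_real d)) holomorphic_on S"
    by (rule holomorphic_on_compose_gen[OF _ hol]) (use assms in \<open>auto intro!: holomorphic_intros simp: add_nonneg_pos subset_iff\<close>)
  then show ?thesis by (simp add: o_def)
qed

lemma ball_half_plane: "w \<in> ball z (Re z) \<Longrightarrow> 0 < Re w"
  using abs_Re_le_cmod[of "z - w"] by (simp add: dist_norm)

lemma shift_imaginary: "F (\<i> * of_real t + of_real d) = F (Complex d t)"
  by (simp add: Complex_eq add.commute)

text \<open>The majorant applies to Re (c F) for every constant c. With c the conjugate of F (z + d)
  - I, where I is the right-hand side, it says that |F (z + d) - I|^2 <= 0.\<close>

lemma poisson_shift:
  assumes d: "0 < d" and z: "0 < Re z"
  shows "F (z + of_real d) = (LBINT t. poisson_kernel (Re z) (Im z - t) *\<^sub>R F (Complex d t))"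
proof -
  define I where "I = (LBINT t. poisson_kernel (Re z) (Im z - t) *\<^sub>R F (Complex d t))"
  define c where "c = cnj (F (z + of_real d) - I)"
  let ?V = "\<lambda>w. Re (c * F (w + of_real d))"
  have "?V z \<le> poisson_integral (\<lambda>t. ?V (\<i> * of_real t)) z"
  proof (rule poisson_majorant)
    show "continuous_on {z. 0 \<le> Re z} ?V"
      by (intro continuous_intros continuous_shift d)
    show "\<bar>?V w\<bar> \<le> cmod c * (2 * M / d)" if "0 \<le> Re w" for w
    proof -
      have "\<bar>?V w\<bar> \<le> cmod c * cmod (F (w + of_real d))" using abs_Re_le_cmod norm_mult by metis
      also have "\<dots> \<le> cmod c * (2 * M / d)" by (intro mult_left_mono bound_shift d that) auto
      finally show ?thesis .
    qed
    fix w :: complex assume w: "0 < Re w"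
    have "(\<lambda>w. c * F (w + of_real d)) holomorphic_on ball w (Re w)"
      by (intro holomorphic_intros holomorphic_shift d) (use ball_half_plane[of _ w] in force)
    then show "\<exists>r>0. \<exists>K. K holomorphic_on ball w r \<and>
        (\<forall>x\<in>ball w r. 0 < Re x \<longrightarrow> Re (K x) \<le> ?V x) \<and> Re (K w) = ?V w"
      by (intro exI[of _ "Re w"] conjI w exI[of _ "\<lambda>w. c * F (w + of_real d)"]) auto
  qed (use z in simp)
  also have "\<dots> = (LBINT t. Re (c * (poisson_kernel (Re z) (Im z - t) *\<^sub>R F (Complex d t))))"
    using poisson_integral_eq[OF z, of _ "Im z"] unfolding complex_surj shift_imaginary
    by (simp only:) (intro Bochner_Integration.integral_cong refl, simp add: algebra_simps)
  also have "\<dots> = Re (c * I)"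
  proof -
    have int: "integrable lborel (\<lambda>t. c * (poisson_kernel (Re z) (Im z - t) *\<^sub>R F (Complex d t)))"
      by (intro integrable_mult_right integrable_poisson_kernel_mult integrable_line z d)
    show ?thesis unfolding integral_Re[OF int] unfolding I_def by (simp only: integral_mult_right_zero)
  qed
  finally have "Re (c * (F (z + of_real d) - I)) \<le> 0" by (simp add: algebra_simps)
  moreover have "Re (c * (F (z + of_real d) - I)) = (cmod (F (z + of_real d) - I))\<^sup>2"
    unfolding c_def by (metis Re_complex_of_real complex_norm_square mult.commute)
  ultimately have "(cmod (F (z + of_real d) - I))\<^sup>2 \<le> 0" by linarith
  then show ?thesis by (simp add: I_def)
qed

text \<open>At a zero of F the constant 0 is a minorant. Near a value a \<noteq> 0, the rotated
  function F |a| / a has positive real part, so its principal square root is holomorphic; the real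
  part of that root is at most its modulus sqrt |F|, with equality at the centre, where the rotated
  value is |a|.\<close>

lemma sqrt_majorant_shift:
  assumes d: "0 < d" and z: "0 < Re z"
  shows "sqrt (cmod (F (z + of_real d))) \<le>
    (LBINT t. poisson_kernel (Re z) (Im z - t) * sqrt (cmod (F (Complex d t))))"
proof -
  let ?V = "\<lambda>w. sqrt (cmod (F (w + of_real d)))"
  have "?V z \<le> poisson_integral (\<lambda>t. ?V (\<i> * of_real t)) z"
  proof (rule poisson_majorant)
    show "continuous_on {z. 0 \<le> Re z} ?V"
      by (intro continuous_intros continuous_shift d)
    show "\<bar>?V w\<bar> \<le> sqrt (2 * M / d)" if "0 \<le> Re w" for w
      using bound_shift[OF d that] by (simp del: real_sqrt_divide)
    fix w :: complex assume w: "0 < Re w"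
    define a where "a = F (w + of_real d)"
    show "\<exists>r>0. \<exists>K. K holomorphic_on ball w r \<and>
        (\<forall>x\<in>ball w r. 0 < Re x \<longrightarrow> Re (K x) \<le> ?V x) \<and> Re (K w) = ?V w"
    proof (cases "a = 0")
      case True
      then show ?thesis
        by (intro exI[of _ "1::real"] conjI exI[of _ "\<lambda>_. 0::complex"]) (auto simp: a_def)
    next
      case False
      have "isCont (\<lambda>x. F (x + of_real d)) w"
        using isCont_F[of "w + of_real d"] w d
        by (intro continuous_at_compose[unfolded o_def, of w "\<lambda>x. x + of_real d" F] continuous_intros) auto
      then obtain e where e: "e > 0" "\<And>x. dist x w < e \<Longrightarrow> dist (F (x + of_real d)) a < cmod a"
        using False unfolding continuous_at_eps_delta a_def by (metis zero_less_norm_iff)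
      define r where "r = min e (Re w)"
      let ?G = "\<lambda>x. F (x + of_real d) * (of_real (cmod a) / a)"
      have cG: "cmod (?G x) = cmod (F (x + of_real d))" for x
        using False by (simp add: norm_mult norm_divide)
      have ReG: "0 < Re (?G x)" if "x \<in> ball w r" for x
      proof -
        have "?G x - of_real (cmod a) = (F (x + of_real d) - a) * (of_real (cmod a) / a)"
          using False by (simp add: field_simps)
        then have "cmod (?G x - of_real (cmod a)) = cmod (F (x + of_real d) - a)"
          using False by (simp add: norm_mult norm_divide)
        also have "\<dots> < cmod a" using e(2)[of x] that by (simp add: r_def dist_norm norm_minus_commute)
        finally have "\<bar>Re (?G x - of_real (cmod a))\<bar> < cmod a"
          by (rule le_less_trans[OF abs_Re_le_cmod])
        then show ?thesis unfolding minus_complex.sel Re_complex_of_real by linarith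
      qed
      have sub: "ball w r \<subseteq> {z. 0 \<le> Re z}"
        using ball_half_plane[of _ w] by (force simp: r_def)
      have "(\<lambda>x. csqrt (?G x)) holomorphic_on ball w r"
        by (intro holomorphic_intros holomorphic_shift d sub)
           (use ReG in \<open>force simp: complex_nonpos_Reals_iff\<close>)
      moreover have "Re (csqrt (?G x)) \<le> ?V x" for x
        using complex_Re_le_cmod[of "csqrt (?G x)"] unfolding cG[symmetric] norm_csqrt .
      moreover have "Re (csqrt (?G w)) = ?V w"
        using False by (simp add: a_def[symmetric])
      ultimately show ?thesis
        using e w by (intro exI[of _ r] conjI exI[of _ "\<lambda>x. csqrt (?G x)"]) (auto simp: r_def)
    qed
  qed (use z in simp)
  also have "\<dots> = (LBINT t. poisson_kernel (Re z) (Im z - t) * sqrt (cmod (F (Complex d t))))"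
    using poisson_integral_eq[OF z, of _ "Im z"] unfolding complex_surj shift_imaginary .
  finally show ?thesis .
qed

end

text \<open>Fatou's lemma, for integrals with a common bound.\<close>

lemma nn_integral_le_of_tendsto:
  fixes f :: "nat \<Rightarrow> 'a \<Rightarrow> ennreal"
  assumes [measurable]: "\<And>n. f n \<in> borel_measurable M"
    and lim: "AE x in M. (\<lambda>n. f n x) \<longlonglongrightarrow> h x"
    and le: "\<And>n. (\<integral>\<^sup>+x. f n x \<partial>M) \<le> C"
  shows "(\<integral>\<^sup>+x. h x \<partial>M) \<le> C"
proof -
  have "(\<integral>\<^sup>+x. h x \<partial>M) = (\<integral>\<^sup>+x. liminf (\<lambda>n. f n x) \<partial>M)"
    by (rule nn_integral_cong_AE) (use lim in eventually_elim, metis lim_imp_Liminf sequentially_bot)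
  also have "\<dots> \<le> liminf (\<lambda>n. \<integral>\<^sup>+x. f n x \<partial>M)" by (rule nn_integral_liminf) simp
  also have "\<dots> \<le> C"
  proof -
    have "liminf (\<lambda>n. \<integral>\<^sup>+x. f n x \<partial>M) \<le> limsup (\<lambda>n. \<integral>\<^sup>+x. f n x \<partial>M)"
      by (intro Liminf_le_Limsup sequentially_bot)
    also have "\<dots> \<le> C" by (intro Limsup_bounded always_eventually allI le)
    finally show ?thesis .
  qed
  finally show ?thesis .
qed

section \<open>Passage to the boundary\<close>

context half_plane_hardy1
begin

lemma nn_integral_g_le: "(\<integral>\<^sup>+v. ennreal (cmod (g v)) \<partial>lborel) \<le> ennreal M"
proof (rule nn_integral_le_of_tendsto)
  show "AE v in lborel. (\<lambda>n. ennreal (cmod (F (Complex (1 / Suc n) v)))) \<longlonglongrightarrow> ennreal (cmod (g v))"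
    using lim by eventually_elim (intro tendsto_ennrealI tendsto_norm)
qed (auto intro!: bdd measurable_compose[OF measurable_line])

lemma integrable_g: "integrable lborel g"
  using nn_integral_g_le by (intro integrableI_bounded) (auto simp: le_less_trans ennreal_less_top)

lemma tendsto_shift: "0 < Re z \<Longrightarrow> (\<lambda>n. F (z + of_real (1 / Suc n))) \<longlonglongrightarrow> F z"
proof -
  assume "0 < Re z"
  moreover have "(\<lambda>n. z + of_real (1 / Suc n)) \<longlonglongrightarrow> z + of_real 0"
    by (intro tendsto_intros LIMSEQ_Suc[OF lim_1_over_n, where ?'a1 = real])
  ultimately show ?thesis using isCont_tendsto_compose[OF isCont_F, of z] by simp
qed

text \<open>
  The splitting \<open>\<phi> \<le> min \<phi> N + \<phi>\<^sup>2 / N\<close> makes dominated convergence applicable, as the \<open>L\<^sup>2\<close> norms of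
  \<open>\<phi> = sqrt \<bar>F\<bar>\<close> on vertical lines are bounded.
\<close>

lemma sqrt_majorant:
  assumes z: "0 < Re z"
  shows "sqrt (cmod (F z)) \<le> (LBINT t. poisson_kernel (Re z) (Im z - t) * sqrt (cmod (g t)))"
proof -
  define k where "k = (\<lambda>t. poisson_kernel (Re z) (Im z - t))"
  have [measurable]: "k \<in> borel_measurable borel" unfolding k_def by measurable
  have k0: "0 \<le> k t" for t using z by (simp add: k_def poisson_kernel_nonneg)
  have int_k: "integrable lborel k"
    using has_bochner_integral_poisson_kernel[OF z, of "Im z"] by (simp add: k_def has_bochner_integral_iff)
  define C where "C = 1 / (pi * Re z)"
  have kC: "k t \<le> C" for t using z by (simp add: k_def C_def poisson_kernel_le)
  have C: "0 \<le> C" using k0[of 0] kC[of 0] by linarith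
  have int_k_mult: "integrable lborel (\<lambda>t. k t * h t)" if "integrable lborel h" for h :: "real \<Rightarrow> real"
    using integrable_poisson_kernel_mult[OF z that, of "Im z"] by (simp add: k_def)
  have int_sqrt: "integrable lborel (\<lambda>t. k t * sqrt (cmod (h t)))" if h: "integrable lborel h" for h :: "real \<Rightarrow> complex"
  proof (rule Bochner_Integration.integrable_bound)
    have [measurable]: "h \<in> borel_measurable borel" using h by simp
    show "(\<lambda>t. k t * sqrt (cmod (h t))) \<in> borel_measurable lborel" by measurable
    show "integrable lborel (\<lambda>t. k t + k t * cmod (h t))"
      by (intro Bochner_Integration.integrable_add int_k int_k_mult integrable_norm h)
    have "sqrt x \<le> 1 + x" if "0 \<le> x" for x :: real
    proof (rule real_le_lsqrt)
      have "x \<le> (1 + x)\<^sup>2" using that by (simp add: power2_eq_square algebra_simps)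
      then show "x \<le> (1 + x)\<^sup>2" .
    qed (use that in auto)
    then have "k t * sqrt (cmod (h t)) \<le> k t * (1 + cmod (h t))" for t
      by (intro mult_left_mono k0) auto
    then show "AE t in lborel. norm (k t * sqrt (cmod (h t))) \<le> norm (k t + k t * cmod (h t))"
      using k0 by (auto simp: abs_mult algebra_simps)
  qed
  have main: "sqrt (cmod (F z)) \<le> (LBINT t. k t * sqrt (cmod (g t))) + C * M / N" if N: "0 < N" for N
  proof -
    have int_min: "integrable lborel (\<lambda>t. k t * min (sqrt (cmod (h t))) N)"
      if [measurable]: "h \<in> borel_measurable borel" for h :: "real \<Rightarrow> complex"
      by (rule Bochner_Integration.integrable_bound[OF integrable_mult_left[OF int_k, of N]])
         (use N k0 in \<open>auto simp: abs_mult intro!: mult_left_mono\<close>)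
    have up: "sqrt (cmod (F (z + of_real (1 / Suc n)))) \<le>
        (LBINT t. k t * min (sqrt (cmod (F (Complex (1 / Suc n) t)))) N) + C * M / N" for n
    proof -
      define h where "h = (\<lambda>t. F (Complex (1 / Suc n) t))"
      have h: "integrable lborel h" "(LBINT t. cmod (h t)) \<le> M"
        unfolding h_def by (auto intro: integrable_line integral_line_le)
      have [measurable]: "h \<in> borel_measurable borel" using h by simp
      have "sqrt (cmod (F (z + of_real (1 / Suc n)))) \<le> (LBINT t. k t * sqrt (cmod (h t)))"
        using sqrt_majorant_shift[OF _ z, of "1 / Suc n"] by (simp add: k_def h_def)
      also have "\<dots> \<le> (LBINT t. k t * min (sqrt (cmod (h t))) N + 1 / N * (k t * cmod (h t)))"
      proof (rule integral_mono)
        show "integrable lborel (\<lambda>t. k t * sqrt (cmod (h t)))" by (rule int_sqrt[OF h(1)])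
        show "integrable lborel (\<lambda>t. k t * min (sqrt (cmod (h t))) N + 1 / N * (k t * cmod (h t)))"
          by (intro Bochner_Integration.integrable_add int_min integrable_mult_right int_k_mult integrable_norm h) simp
        fix t
        have "sqrt x \<le> min (sqrt x) N + x / N" if x: "0 \<le> x" for x
        proof (cases "sqrt x \<le> N")
          case False
          then have "sqrt x * N \<le> sqrt x * sqrt x" by (intro mult_left_mono) (use x in auto)
          then have "sqrt x \<le> x / N" using N x by (simp add: pos_le_divide_eq)
          then show ?thesis using False N by (simp add: min_def)
        qed (use N x in \<open>simp add: min_def\<close>)
        then have "k t * sqrt (cmod (h t)) \<le> k t * (min (sqrt (cmod (h t))) N + cmod (h t) / N)"
          by (intro mult_left_mono k0) auto
        then show "k t * sqrt (cmod (h t)) \<le> k t * min (sqrt (cmod (h t))) N + 1 / N * (k t * cmod (h t))"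
          by (simp add: algebra_simps)
      qed
      also have "\<dots> = (LBINT t. k t * min (sqrt (cmod (h t))) N) + 1 / N * (LBINT t. k t * cmod (h t))"
        by (subst Bochner_Integration.integral_add, intro int_min, simp)
           (intro integrable_mult_right int_k_mult integrable_norm h, simp)
      finally have 1: "sqrt (cmod (F (z + of_real (1 / Suc n)))) \<le>
        (LBINT t. k t * min (sqrt (cmod (h t))) N) + 1 / N * (LBINT t. k t * cmod (h t))" .
      have "(LBINT t. k t * cmod (h t)) \<le> (LBINT t. C * cmod (h t))"
        by (rule integral_mono) (auto intro!: int_k_mult h mult_right_mono kC)
      also have "\<dots> \<le> C * M" using h C by (simp add: mult_left_mono)
      finally have "1 / N * (LBINT t. k t * cmod (h t)) \<le> 1 / N * (C * M)"
        using N by (intro mult_left_mono) auto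
      then show ?thesis using 1 by (simp add: h_def)
    qed
    have "sqrt (cmod (F z)) \<le> (LBINT t. k t * min (sqrt (cmod (g t))) N) + C * M / N"
    proof (rule LIMSEQ_le)
      show "(\<lambda>n. sqrt (cmod (F (z + of_real (1 / Suc n))))) \<longlonglongrightarrow> sqrt (cmod (F z))"
        by (intro tendsto_intros tendsto_shift z)
      show "(\<lambda>n. (LBINT t. k t * min (sqrt (cmod (F (Complex (1 / Suc n) t)))) N) + C * M / N)
         \<longlonglongrightarrow> (LBINT t. k t * min (sqrt (cmod (g t))) N) + C * M / N"
      proof (intro tendsto_add tendsto_const integral_dominated_convergence[where w = "\<lambda>t. k t * N"])
        show "AE t in lborel. (\<lambda>n. k t * min (sqrt (cmod (F (Complex (1 / Suc n) t)))) N)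
            \<longlonglongrightarrow> k t * min (sqrt (cmod (g t))) N"
          using lim by eventually_elim (intro tendsto_intros)
        show "AE t in lborel. norm (k t * min (sqrt (cmod (F (Complex (1 / Suc n) t)))) N) \<le> k t * N" for n
          using N k0 by (auto simp: abs_mult intro!: mult_left_mono)
        show "(\<lambda>t. k t * min (sqrt (cmod (F (Complex (1 / Suc n) t)))) N) \<in> borel_measurable lborel" for n
          using int_min[OF measurable_line[of "1 / Suc n"]] by auto
      qed (use int_k in auto)
    qed (use up in blast)
    also have "(LBINT t. k t * min (sqrt (cmod (g t))) N) \<le> (LBINT t. k t * sqrt (cmod (g t)))"
      by (rule integral_mono) (auto intro!: int_min int_sqrt integrable_g mult_left_mono k0)
    finally show ?thesis by simp
  qed
  have "sqrt (cmod (F z)) \<le> (LBINT t. k t * sqrt (cmod (g t)))"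
  proof (rule field_le_epsilon)
    fix e :: real assume e: "0 < e"
    have CM: "0 \<le> C * M" using C M_nonneg by simp
    \<comment> \<open>The summand 1 keeps N positive when C * M = 0.\<close>
    define N where "N = (C * M + 1) / e"
    have N: "0 < N" using CM e by (simp add: N_def)
    have "C * M / N \<le> e" using CM e by (simp add: N_def field_simps)
    then show "sqrt (cmod (F z)) \<le> (LBINT t. k t * sqrt (cmod (g t))) + e"
      using main[OF N] by linarith
  qed
  then show ?thesis by (simp add: k_def)
qed

text \<open>Jensen's inequality for the square and the probability density k: expanding the integral
  of k (sqrt |g| - m)^2 >= 0 gives m^2 <= integral of k |g|.\<close>

lemma majorant:
  assumes z: "0 < Re z"
  shows "cmod (F z) \<le> (LBINT t. poisson_kernel (Re z) (Im z - t) * cmod (g t))"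
proof -
  define k where "k = (\<lambda>t. poisson_kernel (Re z) (Im z - t))"
  have k0: "0 \<le> k t" for t using z by (simp add: k_def poisson_kernel_nonneg)
  have k1: "integrable lborel k" "(LBINT t. k t) = 1"
    using has_bochner_integral_poisson_kernel[OF z, of "Im z"] by (simp_all add: k_def has_bochner_integral_iff)
  define m where "m = (LBINT t. k t * sqrt (cmod (g t)))"
  have int_g: "integrable lborel (\<lambda>t. k t * cmod (g t))"
    using integrable_poisson_kernel_mult[OF z integrable_norm[OF integrable_g], of "Im z"] by (simp add: k_def)
  \<comment> \<open>The Bochner integral of a non-integrable function is 0, so m \<noteq> 0 already
    implies integrability; for m = 0 the bound on m^2 is immediate.\<close>
  have int_s: "integrable lborel (\<lambda>t. k t * sqrt (cmod (g t)))" if "m \<noteq> 0"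
    using that not_integrable_integral_eq[of lborel "\<lambda>t. k t * sqrt (cmod (g t))"] by (auto simp: m_def)
  have m: "sqrt (cmod (F z)) \<le> m" using sqrt_majorant[OF z] by (simp add: m_def k_def)
  have "m\<^sup>2 \<le> (LBINT t. k t * cmod (g t))"
  proof (cases "m = 0")
    case False
    have "0 \<le> (LBINT t. k t * (sqrt (cmod (g t)) - m)\<^sup>2)"
      by (intro integral_nonneg_AE AE_I2 mult_nonneg_nonneg k0) auto
    also have "\<dots> = (LBINT t. k t * cmod (g t) - 2 * m * (k t * sqrt (cmod (g t))) + m\<^sup>2 * k t)"
      by (intro Bochner_Integration.integral_cong refl) (simp add: power2_diff algebra_simps)
    also have "\<dots> = (LBINT t. k t * cmod (g t)) - 2 * m * m + m\<^sup>2 * 1"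
      using int_g int_s[OF False] k1 by (simp add: m_def)
    finally show ?thesis by (simp add: power2_eq_square)
  qed (use k0 in \<open>auto intro!: integral_nonneg_AE\<close>)
  moreover have "cmod (F z) \<le> m\<^sup>2"
    using power_mono[OF m, of 2] by simp
  ultimately show ?thesis by (simp add: k_def)
qed

text \<open>Tonelli, since the symmetric kernel has mass 1 in either variable. A bound by the norm
  of g itself, and not merely by M, is what Scheffe's lemma requires: together with almost
  everywhere convergence it gives convergence in L^1.\<close>

lemma nn_integral_line_le_g:
  assumes u: "0 < u"
  shows "(\<integral>\<^sup>+v. ennreal (cmod (F (Complex u v))) \<partial>lborel) \<le> (\<integral>\<^sup>+v. ennreal (cmod (g v)) \<partial>lborel)"
proof -
  have "ennreal (cmod (F (Complex u v))) \<le> (\<integral>\<^sup>+t. ennreal (poisson_kernel u (v - t) * cmod (g t)) \<partial>lborel)" for v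
    using majorant[of "Complex u v"] u
      integrable_poisson_kernel_mult[OF u integrable_norm[OF integrable_g], of v]
    by (subst nn_integral_eq_integral) (auto simp: poisson_kernel_nonneg intro!: ennreal_leI)
  then have "(\<integral>\<^sup>+v. ennreal (cmod (F (Complex u v))) \<partial>lborel) \<le>
      (\<integral>\<^sup>+v. \<integral>\<^sup>+t. ennreal (poisson_kernel u (v - t) * cmod (g t)) \<partial>lborel \<partial>lborel)"
    by (intro nn_integral_mono)
  also have "\<dots> = (\<integral>\<^sup>+t. \<integral>\<^sup>+v. ennreal (poisson_kernel u (v - t) * cmod (g t)) \<partial>lborel \<partial>lborel)"
    by (intro lborel_pair.Fubini') measurable
  also have "\<dots> = (\<integral>\<^sup>+t. ennreal (cmod (g t)) \<partial>lborel)"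
  proof (intro nn_integral_cong)
    fix t
    have "poisson_kernel u (v - t) = poisson_kernel u (t - v)" for v
      using poisson_kernel_minus[of u "t - v"] by simp
    then have "(\<integral>\<^sup>+v. ennreal (poisson_kernel u (v - t)) \<partial>lborel) = 1"
      using has_bochner_integral_poisson_kernel[OF u, of t] u
      by (simp add: nn_integral_eq_integral has_bochner_integral_iff poisson_kernel_nonneg)
    then show "(\<integral>\<^sup>+v. ennreal (poisson_kernel u (v - t) * cmod (g t)) \<partial>lborel) = ennreal (cmod (g t))"
      using u by (simp add: ennreal_mult poisson_kernel_nonneg nn_integral_multc)
  qed
  finally show ?thesis .
qed

lemma L1_tendsto: "(\<lambda>n. \<integral>\<^sup>+v. ennreal (cmod (F (Complex (1 / Suc n) v) - g v)) \<partial>lborel) \<longlonglongrightarrow> 0"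
  by (rule Scheffe_lemma2[OF _ integrable_g lim])
     (auto intro!: nn_integral_line_le_g measurable_compose[OF measurable_line])

text \<open>The limit of \<open>poisson_shift\<close> along d = 1 / (n + 1). For fixed z the kernel
  is bounded by 1 / (pi Re z), so convergence in L^1 on the lines is enough.\<close>

lemma poisson:
  assumes z: "0 < Re z"
  shows "F z = (LBINT t. poisson_kernel (Re z) (Im z - t) *\<^sub>R g t)"
proof -
  define k where "k = (\<lambda>t. poisson_kernel (Re z) (Im z - t))"
  have k0: "0 \<le> k t" for t using z by (simp add: k_def poisson_kernel_nonneg)
  define C where "C = 1 / (pi * Re z)"
  have kC: "k t \<le> C" for t using z by (simp add: k_def C_def poisson_kernel_le)
  have "(\<lambda>n. LBINT t. k t *\<^sub>R F (Complex (1 / Suc n) t)) \<longlonglongrightarrow> (LBINT t. k t *\<^sub>R g t)"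
  proof (rule tendsto_L1_int)
    show "\<And>n. integrable lborel (\<lambda>t. k t *\<^sub>R F (Complex (1 / Suc n) t))" "integrable lborel (\<lambda>t. k t *\<^sub>R g t)"
      unfolding k_def by (intro integrable_poisson_kernel_mult z integrable_line integrable_g; simp)+
    have le: "(\<integral>\<^sup>+t. ennreal (norm (k t *\<^sub>R F (Complex (1 / Suc n) t) - k t *\<^sub>R g t)) \<partial>lborel) \<le>
        ennreal C * (\<integral>\<^sup>+t. ennreal (cmod (F (Complex (1 / Suc n) t) - g t)) \<partial>lborel)" for n
    proof -
      have "norm (k t *\<^sub>R F (Complex (1 / Suc n) t) - k t *\<^sub>R g t) \<le> C * cmod (F (Complex (1 / Suc n) t) - g t)" for t
        using k0[of t] mult_right_mono[OF kC norm_ge_zero] by (simp add: scaleR_diff_right[symmetric] del: scaleR_diff_right)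
      then have "(\<integral>\<^sup>+t. ennreal (norm (k t *\<^sub>R F (Complex (1 / Suc n) t) - k t *\<^sub>R g t)) \<partial>lborel) \<le>
          (\<integral>\<^sup>+t. ennreal (C * cmod (F (Complex (1 / Suc n) t) - g t)) \<partial>lborel)"
        by (intro nn_integral_mono ennreal_leI)
      also have "\<dots> = ennreal C * (\<integral>\<^sup>+t. ennreal (cmod (F (Complex (1 / Suc n) t) - g t)) \<partial>lborel)"
      proof -
        have [measurable]: "(\<lambda>t. F (Complex (1 / Suc n) t)) \<in> borel_measurable borel" by (rule measurable_line) simp
        have "0 \<le> C" using z by (simp add: C_def)
        then show ?thesis
          by (subst nn_integral_cmult[symmetric]) (measurable, simp add: ennreal_mult)
      qed
      finally show ?thesis .
    qed
    have up: "(\<lambda>n. ennreal C * (\<integral>\<^sup>+t. ennreal (cmod (F (Complex (1 / Suc n) t) - g t)) \<partial>lborel)) \<longlonglongrightarrow> ennreal C * 0"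
      by (intro ennreal_tendsto_cmult L1_tendsto) simp
    show "(\<lambda>n. \<integral>\<^sup>+t. ennreal (norm (k t *\<^sub>R F (Complex (1 / Suc n) t) - k t *\<^sub>R g t)) \<partial>lborel) \<longlonglongrightarrow> 0"
      by (rule tendsto_sandwich[OF _ _ tendsto_const up[unfolded mult_zero_right]])
         (intro always_eventually allI zero_le le)+
  qed
  moreover have "(LBINT t. k t *\<^sub>R F (Complex (1 / Suc n) t)) = F (z + of_real (1 / Suc n))" for n
    using poisson_shift[OF _ z, of "1 / Suc n"] by (simp add: k_def)
  ultimately have "(\<lambda>n. F (z + of_real (1 / Suc n))) \<longlonglongrightarrow> (LBINT t. k t *\<^sub>R g t)" by simp
  from LIMSEQ_unique[OF tendsto_shift[OF z] this] show ?thesis by (simp add: k_def)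
qed

end

section \<open>The Poisson kernel as a Fourier integral\<close>

lemma measurable_cis [measurable]: "cis \<in> borel_measurable borel"
  by (intro borel_measurable_continuous_onI continuous_intros)

lemma integrable_exp_half_line:
  fixes u :: real
  assumes u: "0 < u"
  shows "integrable lborel (\<lambda>w. indicator {0..} w * exp (-(u * w)))"
proof (rule integrableI_bounded)
  have "(\<integral>\<^sup>+w. ennreal (exp (-(u * w))) * indicator {0..} w \<partial>lborel) = ennreal (0 - (- exp (-(u * 0)) / u))"
  proof (rule nn_integral_FTC_atLeast[where F = "\<lambda>w. - exp (-(u * w)) / u"])
    show "((\<lambda>w. - exp (-(u * w)) / u) has_real_derivative exp (-(u * x))) (at x)" for x
      using u by (auto intro!: derivative_eq_intros)
    have "filterlim (\<lambda>w. u * w) at_top at_top"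
      using u by (intro filterlim_tendsto_pos_mult_at_top[OF tendsto_const _ filterlim_ident])
    then have "((\<lambda>w. exp (-(u * w))) \<longlongrightarrow> 0) at_top"
      by (intro filterlim_compose[OF exp_at_bot]) (simp add: filterlim_uminus_at_bot)
    then show "((\<lambda>w. - exp (-(u * w)) / u) \<longlongrightarrow> 0) at_top"
      using tendsto_divide[OF tendsto_minus tendsto_const, of "\<lambda>w. exp (-(u * w))" 0 at_top u] u by simp
  qed auto
  then show "(\<integral>\<^sup>+w. ennreal (norm (indicator {0..} w * exp (-(u * w)))) \<partial>lborel) < \<infinity>"
    by (simp add: mult.commute ennreal_mult' ennreal_indicator abs_mult)
qed simp

lemma integral_cexp_half_line:
  assumes a: "0 < Re a"
  shows "has_bochner_integral lborel (\<lambda>w. indicator {0..} w *\<^sub>R exp (-(a * of_real w))) (1 / a)"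
proof -
  have a0: "a \<noteq> 0" using a by auto
  have dom: "norm (indicator {0..real n} w *\<^sub>R exp (-(a * of_real w))) \<le> indicator {0..} w * exp (-(Re a * w))" for n w
    by (auto simp: indicator_def)
  have int: "integrable lborel (\<lambda>w. indicator {0..} w *\<^sub>R exp (-(a * of_real w)))"
    by (rule Bochner_Integration.integrable_bound[OF integrable_exp_half_line[OF a]]) (auto simp: indicator_def)
  have 1: "(\<lambda>n. LBINT w. indicator {0..real n} w *\<^sub>R exp (-(a * of_real w))) \<longlonglongrightarrow>
      (LBINT w. indicator {0..} w *\<^sub>R exp (-(a * of_real w)))"
  proof (rule integral_dominated_convergence[OF _ _ integrable_exp_half_line[OF a]])
    have "(\<lambda>n. indicator {0..real n} w *\<^sub>R exp (-(a * of_real w))) \<longlonglongrightarrow> indicator {0..} w *\<^sub>R exp (-(a * of_real w))" for w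
    proof (rule tendsto_eventually)
      have "eventually (\<lambda>n. w \<le> real n) sequentially"
        using filterlim_real_sequentially by (auto simp: filterlim_at_top)
      then show "eventually (\<lambda>n. indicator {0..real n} w *\<^sub>R exp (-(a * of_real w)) = indicator {0..} w *\<^sub>R exp (-(a * of_real w))) sequentially"
        by eventually_elim (simp add: indicator_def)
    qed
    then show "AE w in lborel. (\<lambda>n. indicator {0..real n} w *\<^sub>R exp (-(a * of_real w))) \<longlonglongrightarrow> indicator {0..} w *\<^sub>R exp (-(a * of_real w))"
      by simp
    show "AE w in lborel. norm (indicator {0..real n} w *\<^sub>R exp (-(a * of_real w))) \<le> indicator {0..} w * exp (-(Re a * w))" for n
      by (rule AE_I2) (rule dom)
  qed measurable
  \<comment> \<open>Integer endpoints turn the boundary term into a power of exp (- a), whose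
    modulus is below 1, so the limit is that of a geometric sequence.\<close>
  have "(LBINT w. indicator {0..real n} w *\<^sub>R exp (-(a * of_real w))) = (1 - exp (-a) ^ n) / a" for n
  proof -
    have "has_bochner_integral lborel (\<lambda>w. indicator {0..real n} w *\<^sub>R exp (-(a * of_real w)))
       (- exp (-(a * of_real (real n))) / a - (- exp (-(a * of_real 0)) / a))"
    proof (rule has_bochner_integral_FTC_Icc)
      fix x
      have "((\<lambda>z. - exp (-(a * z)) / a) has_field_derivative exp (-(a * of_real x))) (at (of_real x))"
        using a0 by (auto intro!: derivative_eq_intros)
      then show "((\<lambda>w. - exp (-(a * of_real w)) / a) has_vector_derivative exp (-(a * of_real x))) (at x within {0..real n})"
        by (rule has_vector_derivative_real_field)
    qed (auto intro!: continuous_intros)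
    moreover have "- exp (-(a * of_real (real n))) / a - (- exp (-(a * of_real 0)) / a) = (1 - exp (-a) ^ n) / a"
      by (simp add: exp_of_nat_mult[symmetric] diff_divide_distrib mult.commute)
    ultimately show ?thesis by (simp add: has_bochner_integral_iff)
  qed
  moreover have "(\<lambda>n. (1 - exp (-a) ^ n) / a) \<longlonglongrightarrow> (1 - 0) / a"
    using a a0 by (intro tendsto_intros LIMSEQ_power_zero) auto
  ultimately have "(LBINT w. indicator {0..} w *\<^sub>R exp (-(a * of_real w))) = 1 / a"
    using LIMSEQ_unique[OF 1] by simp
  then show ?thesis using int by (simp add: has_bochner_integral_iff)
qed

lemma integrable_exp_abs:
  fixes u :: real
  assumes u: "0 < u"
  shows "integrable lborel (\<lambda>w. exp (-(u * \<bar>w\<bar>)))"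
proof (rule Bochner_Integration.integrable_bound)
  have "integrable lborel (\<lambda>w::real. indicator {0..} (0 + (-1) * w) * exp (-(u * (0 + (-1) * w))))"
    by (rule lborel_integrable_real_affine[OF integrable_exp_half_line[OF u]]) simp
  then show "integrable lborel (\<lambda>w. indicator {0..} w * exp (-(u * w)) + indicator {0..} (- w) * exp (-(u * (- w))))"
    using integrable_exp_half_line[OF u] by (intro Bochner_Integration.integrable_add) simp_all
qed (auto simp: indicator_def)

text \<open>The two half-lines contribute 1 / (u - i x) and 1 / (u + i x), with sum 2 u / (u^2 +
  x^2). They overlap at w = 0, so the integrand is split only almost everywhere.\<close>

lemma fourier_exp_abs:
  assumes u: "0 < u"
  shows "(LBINT w. exp (-(u * \<bar>w\<bar>)) *\<^sub>R cis (x * w)) = of_real (2 * pi * poisson_kernel u x)"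
proof -
  define f where "f = (\<lambda>w. exp (-(u * \<bar>w\<bar>)) *\<^sub>R cis (x * w))"
  have 1: "has_bochner_integral lborel (\<lambda>w. indicator {0..} w *\<^sub>R f w) (1 / Complex u (- x))"
  proof -
    have "indicator {0..} w *\<^sub>R f w = indicator {0..} w *\<^sub>R exp (-(Complex u (- x) * of_real w))" for w
      by (auto simp: f_def indicator_def exp_eq_polar scaleR_conv_of_real exp_of_real mult.commute)
    then have "(\<lambda>w. indicator {0..} w *\<^sub>R f w) = (\<lambda>w. indicator {0..} w *\<^sub>R exp (-(Complex u (- x) * of_real w)))"
      by (rule ext)
    then show ?thesis using integral_cexp_half_line[of "Complex u (- x)"] u by (simp only: complex.sel)
  qed
  have 2: "has_bochner_integral lborel (\<lambda>w. indicator {..0} w *\<^sub>R f w) (1 / Complex u x)"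
  proof -
    have eq: "indicator {..0} w *\<^sub>R f w = indicator {0..} (0 + (-1) * w) *\<^sub>R exp (-(Complex u x * of_real (0 + (-1) * w)))" for w
      by (auto simp: f_def indicator_def exp_eq_polar scaleR_conv_of_real exp_of_real mult.commute)
    have "has_bochner_integral lborel (\<lambda>w. indicator {0..} w *\<^sub>R exp (-(Complex u x * of_real w))) (1 / Complex u x)"
      using integral_cexp_half_line[of "Complex u x"] u by simp
    then show ?thesis unfolding eq
      by (subst (asm) lborel_has_bochner_integral_real_affine_iff[of "-1" _ _ 0]) simp_all
  qed
  have "(LBINT w. f w) = (LBINT w. indicator {0..} w *\<^sub>R f w + indicator {..0} w *\<^sub>R f w)"
  proof (rule integral_cong_AE)
    show "AE w in lborel. f w = indicator {0..} w *\<^sub>R f w + indicator {..0} w *\<^sub>R f w"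
      using AE_lborel_singleton[of "0::real"] by eventually_elim (auto simp: indicator_def)
  qed (auto simp: f_def)
  also have "\<dots> = 1 / Complex u (- x) + 1 / Complex u x"
    using 1 2 by (simp add: has_bochner_integral_iff)
  also have "\<dots> = of_real (2 * pi * poisson_kernel u x)"
    using u by (simp add: complex_eq_iff poisson_kernel_def Re_divide Im_divide power2_eq_square)
  finally show ?thesis by (simp add: f_def)
qed

lemma integrable_pair_Fubini:
  fixes f :: "real \<times> real \<Rightarrow> 'a::{banach, second_countable_topology}"
  assumes [measurable]: "f \<in> borel_measurable borel"
    and 1: "integrable lborel a" and 2: "integrable lborel b"
    and le: "\<And>x y. norm (f (x, y)) \<le> a x * b y"
  shows "integrable (lborel \<Otimes>\<^sub>M lborel) f"
proof (rule lborel_pair.Fubini_integrable)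
  have meas [measurable]: "f \<in> borel_measurable (lborel \<Otimes>\<^sub>M lborel)"
    using assms(1) by (simp add: lborel_prod)
  then show "f \<in> borel_measurable (lborel \<Otimes>\<^sub>M lborel)" .
  have int: "integrable lborel (\<lambda>y. f (x, y))" for x
  proof (rule Bochner_Integration.integrable_bound)
    show "integrable lborel (\<lambda>y. a x * b y)" using 2 by simp
    show "AE y in lborel. norm (f (x, y)) \<le> norm (a x * b y)"
      by (intro AE_I2) (metis abs_ge_self le order_trans real_norm_def)
  qed measurable
  then show "AE x in lborel. integrable lborel (\<lambda>y. f (x, y))" by simp
  show "integrable lborel (\<lambda>x. LBINT y. norm (f (x, y)))"
  proof (rule Bochner_Integration.integrable_bound)
    show "integrable lborel (\<lambda>x. a x * (LBINT y. b y))" using 1 by simp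
    have "(LBINT y. norm (f (x, y))) \<le> (LBINT y. a x * b y)" for x
      by (rule integral_mono) (use int 2 le in auto)
    then have "(LBINT y. norm (f (x, y))) \<le> a x * (LBINT y. b y)" for x by simp
    then show "AE x in lborel. norm (LBINT y. norm (f (x, y))) \<le> norm (a x * (LBINT y. b y))"
      by (intro AE_I2) (metis abs_of_nonneg integral_nonneg_AE AE_I2 norm_ge_zero order_trans abs_ge_self real_norm_def)
  qed measurable
qed

section \<open>The Fourier transform of the boundary function\<close>

context half_plane_hardy1
begin

text \<open>Fubini in the Poisson formula, as the kernel has mass 1 in v. This takes the place of
  moving the line of integration by Cauchy's theorem.\<close>

lemma integral_line_eq:
  assumes u: "0 < u"
  shows "(LBINT v. F (Complex u v)) = (LBINT t. g t)"
proof -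
  have *: "integrable (lborel \<Otimes>\<^sub>M lborel) (\<lambda>(t, v). poisson_kernel u (t - v) *\<^sub>R g t)"
  proof (rule lborel_pair.Fubini_integrable)
    have k: "integrable lborel (\<lambda>v. poisson_kernel u (t - v))" "(LBINT v. poisson_kernel u (t - v)) = 1" for t
      using has_bochner_integral_poisson_kernel[OF u, of t] by (simp_all add: has_bochner_integral_iff)
    show "AE t in lborel. integrable lborel (\<lambda>v. case (t, v) of (t, v) \<Rightarrow> poisson_kernel u (t - v) *\<^sub>R g t)"
      using k by simp
    show "integrable lborel (\<lambda>t. LBINT v. norm (case (t, v) of (t, v) \<Rightarrow> poisson_kernel u (t - v) *\<^sub>R g t))"
      using integrable_g k u by (simp add: poisson_kernel_nonneg)
  qed measurable
  have sym: "poisson_kernel u (v - t) = poisson_kernel u (t - v)" for t v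
    using poisson_kernel_minus[of u "t - v"] by simp
  have "(LBINT v. F (Complex u v)) = (LBINT v. LBINT t. poisson_kernel u (t - v) *\<^sub>R g t)"
    using poisson[of "Complex u _"] u by (simp add: sym)
  also have "\<dots> = (LBINT t. LBINT v. poisson_kernel u (t - v) *\<^sub>R g t)"
    by (rule lborel_pair.Fubini_integral[OF *])
  also have "\<dots> = (LBINT t. g t)"
    using has_bochner_integral_poisson_kernel[OF u] by (simp add: has_bochner_integral_iff)
  finally show ?thesis .
qed

end

text \<open>For w >= 0 the factor exp (- w z) has modulus at most 1 on the half-plane, so the
  constant M is unchanged.\<close>

lemma (in half_plane_hardy1) half_plane_hardy1_mult_exp:
  assumes w: "0 \<le> w"
  shows "half_plane_hardy1 (\<lambda>z. exp (-(of_real w * z)) * F z) (\<lambda>t. cis (-(t * w)) * g t) M"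
proof
  show "(\<lambda>z. exp (-(of_real w * z)) * F z) holomorphic_on {z. 0 < Re z}"
    by (intro holomorphic_intros hol)
  show "(\<integral>\<^sup>+v. ennreal (cmod (exp (-(of_real w * Complex u v)) * F (Complex u v))) \<partial>lborel) \<le> ennreal M"
    if u: "0 < u" for u
  proof -
    have "cmod (exp (-(of_real w * Complex u v)) * F (Complex u v)) \<le> 1 * cmod (F (Complex u v))" for v
      unfolding norm_mult using u w by (intro mult_right_mono) auto
    then show ?thesis
      by (intro order_trans[OF nn_integral_mono bdd[OF u]] ennreal_leI) simp
  qed
  show "AE v in lborel. (\<lambda>n. exp (-(of_real w * Complex (1 / Suc n) v)) * F (Complex (1 / Suc n) v)) \<longlonglongrightarrow> cis (-(v * w)) * g v"
    using lim
  proof eventually_elim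
    fix v assume v: "(\<lambda>n. F (Complex (1 / Suc n) v)) \<longlonglongrightarrow> g v"
    have "(\<lambda>n. exp (-(of_real w * (of_real (1 / Suc n) + \<i> * of_real v)))) \<longlonglongrightarrow> exp (-(of_real w * (of_real 0 + \<i> * of_real v)))"
      by (intro tendsto_intros LIMSEQ_Suc[OF lim_1_over_n, where ?'a1 = real])
    also have "exp (-(of_real w * (of_real 0 + \<i> * of_real v))) = cis (-(v * w))"
      by (simp add: cis_conv_exp mult_ac)
    finally have "(\<lambda>n. exp (-(of_real w * Complex (1 / Suc n) v))) \<longlonglongrightarrow> cis (-(v * w))"
      by (simp add: Complex_eq)
    then show "(\<lambda>n. exp (-(of_real w * Complex (1 / Suc n) v)) * F (Complex (1 / Suc n) v)) \<longlonglongrightarrow> cis (-(v * w)) * g v"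
      by (intro tendsto_mult v)
  qed
  show "(\<lambda>t. cis (-(t * w)) * g t) \<in> borel_measurable borel" by measurable
qed (rule M_nonneg)

context half_plane_hardy1
begin

lemma fourier_vanishes:
  assumes w: "0 < w"
  shows "(LBINT t. cis (-(t * w)) * g t) = 0"
proof -
  interpret G: half_plane_hardy1 "\<lambda>z. exp (-(of_real w * z)) * F z" "\<lambda>t. cis (-(t * w)) * g t" M
    by (rule half_plane_hardy1_mult_exp) (use w in simp)
  have le: "cmod (LBINT t. cis (-(t * w)) * g t) \<le> exp (- w) ^ Suc n * M" for n
  proof -
    define u where "u = real (Suc n)"
    have u: "0 < u" by (simp add: u_def)
    have nrm: "cmod (exp (-(of_real w * Complex u v)) * F (Complex u v)) = exp (-(u * w)) * cmod (F (Complex u v))" for v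
      by (simp add: norm_mult mult.commute)
    have "cmod (LBINT t. cis (-(t * w)) * g t) = cmod (LBINT v. exp (-(of_real w * Complex u v)) * F (Complex u v))"
      by (simp only: G.integral_line_eq[OF u])
    also have "\<dots> \<le> (LBINT v. cmod (exp (-(of_real w * Complex u v)) * F (Complex u v)))"
      by (rule integral_norm_bound)
    also have "\<dots> = exp (-(u * w)) * (LBINT v. cmod (F (Complex u v)))"
      by (simp only: nrm) simp
    also have "\<dots> \<le> exp (-(u * w)) * M"
      by (intro mult_left_mono integral_line_le u) simp
    also have "exp (-(u * w)) = exp (- w) ^ Suc n"
      unfolding u_def exp_of_nat_mult[symmetric] by (simp only: mult_minus_right of_nat_Suc)
    finally show ?thesis .
  qed
  have "(\<lambda>n. exp (- w) ^ Suc n * M) \<longlonglongrightarrow> 0 * M"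
    using w by (intro tendsto_mult tendsto_const LIMSEQ_Suc[OF LIMSEQ_power_zero]) simp
  then have "cmod (LBINT t. cis (-(t * w)) * g t) \<le> 0"
    using le by (intro LIMSEQ_le_const) auto
  then show ?thesis by simp
qed

text \<open>The kernel in the Poisson formula is replaced by its Fourier integral, whose weight exp
  (- u |w|) justifies Fubini. For w <= 0 this weight combines with the phase to exp (w z); for w > 0
  it does not, but there the transform of g vanishes.\<close>

lemma fourier_representation:
  assumes z: "0 < Re z"
  shows "2 * pi * F z = (LBINT w. indicator {..0} w *\<^sub>R (exp (of_real w * z) * (LBINT t. cis (-(t * w)) * g t)))"
proof -
  define u v where "u = Re z" and "v = Im z"
  have u: "0 < u" using z by (simp add: u_def)
  define f where "f = (\<lambda>t w. exp (-(u * \<bar>w\<bar>)) *\<^sub>R (cis ((v - t) * w) * g t))"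
  have int: "integrable (lborel \<Otimes>\<^sub>M lborel) (\<lambda>(t, w). f t w)"
  proof (rule integrable_pair_Fubini[OF _ integrable_norm[OF integrable_g] integrable_exp_abs[OF u]])
    show "(\<lambda>(t, w). f t w) \<in> borel_measurable borel"
      unfolding f_def borel_prod[symmetric] by measurable
  qed (simp add: f_def norm_mult)
  have "2 * pi * F z = (LBINT t. LBINT w. f t w)"
  proof -
    have "2 * pi * F z = (LBINT t. of_real (2 * pi) * (poisson_kernel u (v - t) *\<^sub>R g t))"
      unfolding poisson[OF z] u_def v_def by (subst integral_mult_right_zero) simp
    also have "\<dots> = (LBINT t. (LBINT w. exp (-(u * \<bar>w\<bar>)) *\<^sub>R cis ((v - t) * w)) * g t)"
      unfolding fourier_exp_abs[OF u] by (simp add: scaleR_conv_of_real mult_ac)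
    also have "\<dots> = (LBINT t. LBINT w. f t w)"
      unfolding f_def by (simp add: mult_scaleR_left[symmetric] del: mult_scaleR_left)
    finally show ?thesis .
  qed
  also have "\<dots> = (LBINT w. LBINT t. f t w)"
    by (rule lborel_pair.Fubini_integral[OF int, symmetric])
  also have "\<dots> = (LBINT w. indicator {..0} w *\<^sub>R (exp (of_real w * z) * (LBINT t. cis (-(t * w)) * g t)))"
  proof (intro Bochner_Integration.integral_cong refl)
    fix w :: real
    have cis: "cis ((v - t) * w) = cis (v * w) * cis (-(t * w))" for t
      by (simp add: cis_mult algebra_simps)
    have "(LBINT t. f t w) = exp (-(u * \<bar>w\<bar>)) *\<^sub>R (cis (v * w) * (LBINT t. cis (-(t * w)) * g t))"
      unfolding f_def cis by (simp add: mult.assoc)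
    also have "\<dots> = indicator {..0} w *\<^sub>R (exp (of_real w * z) * (LBINT t. cis (-(t * w)) * g t))"
    proof (cases "w \<le> 0")
      case True
      have "exp (of_real w * z) = exp (-(u * \<bar>w\<bar>)) *\<^sub>R cis (v * w)"
        using True by (simp add: exp_eq_polar u_def v_def scaleR_conv_of_real exp_of_real mult.commute)
      then show ?thesis using True by (simp add: indicator_def)
    qed (simp add: fourier_vanishes indicator_def)
    finally show "(LBINT t. f t w) = indicator {..0} w *\<^sub>R (exp (of_real w * z) * (LBINT t. cis (-(t * w)) * g t))" .
  qed
  finally show ?thesis .
qed

end

section \<open>Plancherel inequality and real interpolation\<close>

lemma measurable_cnj [measurable]: "cnj \<in> borel_measurable borel"
  by (intro borel_measurable_continuous_onI continuous_intros)

lemma norm_integral_le_nn_integral: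
  fixes f :: "'a \<Rightarrow> 'b::{banach, second_countable_topology}"
  shows "ennreal (norm (integral\<^sup>L M f)) \<le> (\<integral>\<^sup>+x. ennreal (norm (f x)) \<partial>M)"
  by (cases "integrable M f") (auto intro: integral_norm_bound_ennreal simp: not_integrable_integral_eq)

text \<open>With the weight exp (- e |w|) the left side becomes the double integral of 2 pi times
  the Poisson kernel of s - t against cnj (f s) * f t. Since 2 a b <= a^2 + b^2 and the kernel has
  mass 1 in both variables, this is at most 2 pi times the integral of |f|^2; Fatou removes the
  weight. The right side may be infinite, so f need not be in L^2.\<close>

lemma Plancherel_inequality:
  fixes f :: "real \<Rightarrow> complex"
  assumes f: "integrable lborel f"
  shows "(\<integral>\<^sup>+w. ennreal ((cmod (LBINT t. cis (-(t * w)) * f t))\<^sup>2) \<partial>lborel)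
      \<le> ennreal (2 * pi) * (\<integral>\<^sup>+t. ennreal ((cmod (f t))\<^sup>2) \<partial>lborel)"
proof -
  have [measurable]: "f \<in> borel_measurable borel" using f by simp
  define h where "h = (\<lambda>w. LBINT t. cis (-(t * w)) * f t)"
  have [measurable]: "h \<in> borel_measurable borel" unfolding h_def by measurable
  define C where "C = (LBINT t. cmod (f t))"
  have h_le: "cmod (h w) \<le> C" for w
  proof -
    have "cmod (h w) \<le> (LBINT t. cmod (cis (-(t * w)) * f t))" unfolding h_def by (rule integral_norm_bound)
    then show ?thesis by (simp add: C_def norm_mult)
  qed
  have C: "0 \<le> C" unfolding C_def by simp
  have approx: "(\<integral>\<^sup>+w. ennreal (exp (-(e * \<bar>w\<bar>)) * (cmod (h w))\<^sup>2) \<partial>lborel)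
      \<le> ennreal (2 * pi) * (\<integral>\<^sup>+t. ennreal ((cmod (f t))\<^sup>2) \<partial>lborel)" if e: "0 < e" for e :: real
  proof -
    note ie = integrable_exp_abs[OF e]
    have int_h2: "integrable lborel (\<lambda>w. exp (-(e * \<bar>w\<bar>)) * (cmod (h w))\<^sup>2)"
    proof (rule Bochner_Integration.integrable_bound)
      show "integrable lborel (\<lambda>w. exp (-(e * \<bar>w\<bar>)) * C\<^sup>2)" using ie by simp
      show "AE w in lborel. norm (exp (-(e * \<bar>w\<bar>)) * (cmod (h w))\<^sup>2) \<le> norm (exp (-(e * \<bar>w\<bar>)) * C\<^sup>2)"
        using h_le by (auto intro!: power_mono AE_I2 simp: abs_mult)
    qed measurable
    \<comment> \<open>By Fubini, K is 2 pi times the convolution of cnj f with the Poisson kernel at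
      height e.\<close>
    define K where "K = (\<lambda>t. LBINT w. exp (-(e * \<bar>w\<bar>)) *\<^sub>R (cnj (h w) * cis (-(t * w))))"
    have K_eq: "K t = (LBINT s. of_real (2 * pi * poisson_kernel e (s - t)) * cnj (f s))" for t
    proof -
      have int: "integrable (lborel \<Otimes>\<^sub>M lborel) (\<lambda>(s, w). exp (-(e * \<bar>w\<bar>)) *\<^sub>R (cis ((s - t) * w) * cnj (f s)))"
      proof (rule integrable_pair_Fubini[OF _ integrable_norm[OF f] ie])
        show "(\<lambda>(s, w). exp (-(e * \<bar>w\<bar>)) *\<^sub>R (cis ((s - t) * w) * cnj (f s))) \<in> borel_measurable borel"
          unfolding borel_prod[symmetric] by measurable
      qed (simp add: norm_mult)
      have "exp (-(e * \<bar>w\<bar>)) *\<^sub>R (cnj (h w) * cis (-(t * w))) =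
          (LBINT s. exp (-(e * \<bar>w\<bar>)) *\<^sub>R (cis ((s - t) * w) * cnj (f s)))" for w
      proof -
        have c: "cis ((s - t) * w) = cis (-(t * w)) * cnj (cis (-(s * w)))" for s
          by (simp add: cis_cnj cis_mult algebra_simps)
        have "cnj (h w) = (LBINT s. cnj (cis (-(s * w)) * f s))"
          unfolding h_def
          by (rule integral_bounded_linear[OF bounded_linear_cnj, symmetric]) (use f in \<open>auto intro!: Bochner_Integration.integrable_bound[OF f] simp: norm_mult\<close>)
        also have "\<dots> = (LBINT s. cnj (cis (-(s * w))) * cnj (f s))"
          by (simp only: complex_cnj_mult)
        finally have h: "cnj (h w) = (LBINT s. cnj (cis (-(s * w))) * cnj (f s))" .
        have "(LBINT s. exp (-(e * \<bar>w\<bar>)) *\<^sub>R (cis ((s - t) * w) * cnj (f s))) =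
            exp (-(e * \<bar>w\<bar>)) *\<^sub>R (cis (-(t * w)) * (LBINT s. cnj (cis (-(s * w))) * cnj (f s)))"
          unfolding c mult.assoc integral_scaleR_right integral_mult_right_zero ..
        then show ?thesis unfolding h by (simp only: mult.commute)
      qed
      then have "K t = (LBINT w. LBINT s. exp (-(e * \<bar>w\<bar>)) *\<^sub>R (cis ((s - t) * w) * cnj (f s)))"
        by (simp add: K_def)
      also have "\<dots> = (LBINT s. LBINT w. exp (-(e * \<bar>w\<bar>)) *\<^sub>R (cis ((s - t) * w) * cnj (f s)))"
        by (rule lborel_pair.Fubini_integral[OF int])
      also have "\<dots> = (LBINT s. (LBINT w. exp (-(e * \<bar>w\<bar>)) *\<^sub>R cis ((s - t) * w)) * cnj (f s))"
        by (simp add: mult_scaleR_left[symmetric] del: mult_scaleR_left)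
      finally show ?thesis unfolding fourier_exp_abs[OF e] .
    qed
    have int2: "integrable (lborel \<Otimes>\<^sub>M lborel) (\<lambda>(t, w). exp (-(e * \<bar>w\<bar>)) *\<^sub>R (cnj (h w) * cis (-(t * w)) * f t))"
    proof (rule integrable_pair_Fubini[OF _ integrable_norm[OF f] integrable_mult_left[OF ie, of C]])
      show "(\<lambda>(t, w). exp (-(e * \<bar>w\<bar>)) *\<^sub>R (cnj (h w) * cis (-(t * w)) * f t)) \<in> borel_measurable borel"
        unfolding borel_prod[symmetric] by measurable
      show "norm (case (t, w) of (t, w) \<Rightarrow> exp (-(e * \<bar>w\<bar>)) *\<^sub>R (cnj (h w) * cis (-(t * w)) * f t))
          \<le> cmod (f t) * (exp (-(e * \<bar>w\<bar>)) * C)" for t w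
        using mult_right_mono[OF h_le[of w], of "cmod (f t) * exp (-(e * \<bar>w\<bar>))"] by (simp add: norm_mult mult_ac)
    qed
    have "of_real (LBINT w. exp (-(e * \<bar>w\<bar>)) * (cmod (h w))\<^sup>2) = (LBINT w. exp (-(e * \<bar>w\<bar>)) *\<^sub>R (cnj (h w) * h w))"
      unfolding integral_complex_of_real[symmetric]
      by (intro Bochner_Integration.integral_cong refl) (simp add: scaleR_conv_of_real complex_norm_square[unfolded of_real_power] mult.commute)
    also have "\<dots> = (LBINT w. LBINT t. exp (-(e * \<bar>w\<bar>)) *\<^sub>R (cnj (h w) * cis (-(t * w)) * f t))"
      unfolding h_def by (simp add: mult.assoc)
    also have "\<dots> = (LBINT t. LBINT w. exp (-(e * \<bar>w\<bar>)) *\<^sub>R (cnj (h w) * cis (-(t * w)) * f t))"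
      by (rule lborel_pair.Fubini_integral[OF int2])
    also have "\<dots> = (LBINT t. K t * f t)"
      unfolding K_def by (simp add: mult_scaleR_left[symmetric] del: mult_scaleR_left)
    finally have "ennreal (LBINT w. exp (-(e * \<bar>w\<bar>)) * (cmod (h w))\<^sup>2) = ennreal (cmod (LBINT t. K t * f t))"
    proof -
      assume "complex_of_real (LBINT w. exp (-(e * \<bar>w\<bar>)) * (cmod (h w))\<^sup>2) = (LBINT t. K t * f t)"
      from arg_cong[OF this, of cmod] show ?thesis
        unfolding norm_of_real by (simp add: abs_of_nonneg integral_nonneg_AE)
    qed
    also have "\<dots> \<le> (\<integral>\<^sup>+t. ennreal (cmod (K t * f t)) \<partial>lborel)"
      by (rule norm_integral_le_nn_integral)
    also have "\<dots> \<le> (\<integral>\<^sup>+t. \<integral>\<^sup>+s. ennreal (2 * pi * poisson_kernel e (s - t) * (cmod (f s) * cmod (f t))) \<partial>lborel \<partial>lborel)"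
    proof (rule nn_integral_mono)
      fix t
      have "ennreal (cmod (K t)) \<le> (\<integral>\<^sup>+s. ennreal (2 * pi * poisson_kernel e (s - t) * cmod (f s)) \<partial>lborel)"
      proof -
        have nrm: "cmod (of_real (2 * pi * poisson_kernel e (s - t)) * cnj (f s)) = 2 * pi * poisson_kernel e (s - t) * cmod (f s)" for s
          using poisson_kernel_nonneg[of e "s - t"] e by (simp add: norm_mult)
        have "ennreal (cmod (K t)) \<le> (\<integral>\<^sup>+s. ennreal (cmod (of_real (2 * pi * poisson_kernel e (s - t)) * cnj (f s))) \<partial>lborel)"
          unfolding K_eq
          by (rule norm_integral_le_nn_integral)
        then show ?thesis unfolding nrm .
      qed
      then have "ennreal (cmod (K t)) * ennreal (cmod (f t)) \<le>
         (\<integral>\<^sup>+s. ennreal (2 * pi * poisson_kernel e (s - t) * cmod (f s)) \<partial>lborel) * ennreal (cmod (f t))"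
        by (rule mult_right_mono) simp
      also have "\<dots> = (\<integral>\<^sup>+s. ennreal (2 * pi * poisson_kernel e (s - t) * (cmod (f s) * cmod (f t))) \<partial>lborel)"
        using poisson_kernel_nonneg[of e] e
        by (subst nn_integral_multc[symmetric]) (auto simp: ennreal_mult[symmetric] mult_ac)
      finally show "ennreal (cmod (K t * f t)) \<le> (\<integral>\<^sup>+s. ennreal (2 * pi * poisson_kernel e (s - t) * (cmod (f s) * cmod (f t))) \<partial>lborel)"
        by (simp add: norm_mult ennreal_mult)
    qed
    also have "\<dots> \<le> (\<integral>\<^sup>+t. \<integral>\<^sup>+s. ennreal (pi * poisson_kernel e (s - t) * (cmod (f s))\<^sup>2) + ennreal (pi * poisson_kernel e (s - t) * (cmod (f t))\<^sup>2) \<partial>lborel \<partial>lborel)"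
    proof (intro nn_integral_mono)
      fix s t
      have "2 * (cmod (f s) * cmod (f t)) \<le> (cmod (f s))\<^sup>2 + (cmod (f t))\<^sup>2"
        using sum_squares_bound[of "cmod (f s)" "cmod (f t)"] by simp
      then have "pi * poisson_kernel e (s - t) * (2 * (cmod (f s) * cmod (f t))) \<le> pi * poisson_kernel e (s - t) * ((cmod (f s))\<^sup>2 + (cmod (f t))\<^sup>2)"
        using poisson_kernel_nonneg[of e "s - t"] e by (intro mult_left_mono) auto
      then show "ennreal (2 * pi * poisson_kernel e (s - t) * (cmod (f s) * cmod (f t))) \<le>
          ennreal (pi * poisson_kernel e (s - t) * (cmod (f s))\<^sup>2) + ennreal (pi * poisson_kernel e (s - t) * (cmod (f t))\<^sup>2)"
      proof -
        assume *: "pi * poisson_kernel e (s - t) * (2 * (cmod (f s) * cmod (f t))) \<le> pi * poisson_kernel e (s - t) * ((cmod (f s))\<^sup>2 + (cmod (f t))\<^sup>2)"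
        have "2 * pi * poisson_kernel e (s - t) * (cmod (f s) * cmod (f t)) \<le>
            pi * poisson_kernel e (s - t) * (cmod (f s))\<^sup>2 + pi * poisson_kernel e (s - t) * (cmod (f t))\<^sup>2"
          using * by (simp add: distrib_left mult_ac)
        then have "ennreal (2 * pi * poisson_kernel e (s - t) * (cmod (f s) * cmod (f t))) \<le>
            ennreal (pi * poisson_kernel e (s - t) * (cmod (f s))\<^sup>2 + pi * poisson_kernel e (s - t) * (cmod (f t))\<^sup>2)"
          by (rule ennreal_leI)
        also have "\<dots> = ennreal (pi * poisson_kernel e (s - t) * (cmod (f s))\<^sup>2) + ennreal (pi * poisson_kernel e (s - t) * (cmod (f t))\<^sup>2)"
          using poisson_kernel_nonneg[of e "s - t"] e by (intro ennreal_plus) auto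
        finally show ?thesis .
      qed
    qed
    also have "\<dots> = (\<integral>\<^sup>+t. \<integral>\<^sup>+s. ennreal (pi * poisson_kernel e (s - t) * (cmod (f s))\<^sup>2) \<partial>lborel \<partial>lborel) +
        (\<integral>\<^sup>+t. \<integral>\<^sup>+s. ennreal (pi * poisson_kernel e (s - t) * (cmod (f t))\<^sup>2) \<partial>lborel \<partial>lborel)"
      by (simp add: nn_integral_add)
    also have "(\<integral>\<^sup>+t. \<integral>\<^sup>+s. ennreal (pi * poisson_kernel e (s - t) * (cmod (f s))\<^sup>2) \<partial>lborel \<partial>lborel)
        = (\<integral>\<^sup>+s. \<integral>\<^sup>+t. ennreal (pi * poisson_kernel e (s - t) * (cmod (f s))\<^sup>2) \<partial>lborel \<partial>lborel)"
      by (intro lborel_pair.Fubini') measurable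
    also have "\<dots> = (\<integral>\<^sup>+s. ennreal (pi * (cmod (f s))\<^sup>2) \<partial>lborel)"
    proof (intro nn_integral_cong)
      fix s
      have "(\<integral>\<^sup>+t. ennreal (poisson_kernel e (s - t)) \<partial>lborel) = 1"
        using has_bochner_integral_poisson_kernel[OF e, of s] e
        by (simp add: nn_integral_eq_integral has_bochner_integral_iff poisson_kernel_nonneg)
      then show "(\<integral>\<^sup>+t. ennreal (pi * poisson_kernel e (s - t) * (cmod (f s))\<^sup>2) \<partial>lborel) = ennreal (pi * (cmod (f s))\<^sup>2)"
        using e by (simp add: ennreal_mult poisson_kernel_nonneg nn_integral_multc nn_integral_cmult)
    qed
    also have "(\<integral>\<^sup>+t. \<integral>\<^sup>+s. ennreal (pi * poisson_kernel e (s - t) * (cmod (f t))\<^sup>2) \<partial>lborel \<partial>lborel) = (\<integral>\<^sup>+t. ennreal (pi * (cmod (f t))\<^sup>2) \<partial>lborel)"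
    proof (intro nn_integral_cong)
      fix t
      have sym: "poisson_kernel e (s - t) = poisson_kernel e (t - s)" for s
        using poisson_kernel_minus[of e "t - s"] by simp
      have "(\<integral>\<^sup>+s. ennreal (poisson_kernel e (t - s)) \<partial>lborel) = 1"
        using has_bochner_integral_poisson_kernel[OF e, of t] e
        by (simp add: nn_integral_eq_integral has_bochner_integral_iff poisson_kernel_nonneg)
      then show "(\<integral>\<^sup>+s. ennreal (pi * poisson_kernel e (s - t) * (cmod (f t))\<^sup>2) \<partial>lborel) = ennreal (pi * (cmod (f t))\<^sup>2)"
        unfolding sym using e by (simp add: ennreal_mult poisson_kernel_nonneg nn_integral_multc nn_integral_cmult)
    qed
    also have "(\<integral>\<^sup>+s. ennreal (pi * (cmod (f s))\<^sup>2) \<partial>lborel) + (\<integral>\<^sup>+t. ennreal (pi * (cmod (f t))\<^sup>2) \<partial>lborel)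
        = ennreal (2 * pi) * (\<integral>\<^sup>+t. ennreal ((cmod (f t))\<^sup>2) \<partial>lborel)"
    proof -
      have "ennreal (2 * pi) = ennreal pi + ennreal pi" by (subst ennreal_plus[symmetric]) auto
      then show ?thesis by (simp add: ennreal_mult nn_integral_cmult distrib_right)
    qed
    finally show ?thesis
      using int_h2 by (subst nn_integral_eq_integral) auto
  qed
  have "(\<integral>\<^sup>+w. ennreal ((cmod (h w))\<^sup>2) \<partial>lborel) \<le> ennreal (2 * pi) * (\<integral>\<^sup>+t. ennreal ((cmod (f t))\<^sup>2) \<partial>lborel)"
  proof (rule nn_integral_le_of_tendsto[where f = "\<lambda>n w. ennreal (exp (-(1 / Suc n * \<bar>w\<bar>)) * (cmod (h w))\<^sup>2)"])
    show "AE w in lborel. (\<lambda>n. ennreal (exp (-(1 / Suc n * \<bar>w\<bar>)) * (cmod (h w))\<^sup>2)) \<longlonglongrightarrow> ennreal ((cmod (h w))\<^sup>2)"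
    proof (intro AE_I2 tendsto_ennrealI)
      fix w
      have "(\<lambda>n. exp (-(1 / Suc n * \<bar>w\<bar>)) * (cmod (h w))\<^sup>2) \<longlonglongrightarrow> exp (-(0 * \<bar>w\<bar>)) * (cmod (h w))\<^sup>2"
        by (intro tendsto_intros LIMSEQ_Suc[OF lim_1_over_n, where ?'a1 = real])
      then show "(\<lambda>n. exp (-(1 / Suc n * \<bar>w\<bar>)) * (cmod (h w))\<^sup>2) \<longlonglongrightarrow> (cmod (h w))\<^sup>2" by simp
    qed
    show "(\<integral>\<^sup>+w. ennreal (exp (-(1 / Suc n * \<bar>w\<bar>)) * (cmod (h w))\<^sup>2) \<partial>lborel)
      \<le> ennreal (2 * pi) * (\<integral>\<^sup>+t. ennreal ((cmod (f t))\<^sup>2) \<partial>lborel)" for n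
      by (rule approx) simp
  qed measurable
  then show ?thesis by (simp add: h_def)
qed

section \<open>Real interpolation\<close>

lemma nn_integral_powr_Ioc:
  fixes a y :: real
  assumes "a > -1" "0 \<le> y"
  shows "(\<integral>\<^sup>+s. ennreal (if 0 < s \<and> s \<le> y then s powr a else 0) \<partial>lborel) = ennreal (y powr (a + 1) / (a + 1))"
proof -
  have "((\<lambda>s. s powr a) has_integral (y powr (a + 1) / (a + 1))) {0..y}"
    using has_integral_powr_from_0[OF assms] by simp
  then have "(\<integral>\<^sup>+s. ennreal (indicator {0..y} s * (s powr a)) \<partial>lborel) = ennreal (y powr (a + 1) / (a + 1))"
  proof (intro nn_integral_has_integral_lborel)
    have "(\<lambda>s. indicator {0..y} s * (s powr a)) = (\<lambda>s. if s \<in> {0..y} then s powr a else 0)"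
      by (auto simp: indicator_def)
    then show "((\<lambda>s. indicator {0..y} s * (s powr a)) has_integral (y powr (a + 1) / (a + 1))) UNIV"
      using \<open>((\<lambda>s. s powr a) has_integral _) {0..y}\<close> by (simp only: has_integral_restrict_UNIV)
  qed auto
  also have "(\<integral>\<^sup>+s. ennreal (indicator {0..y} s * (s powr a)) \<partial>lborel) = (\<integral>\<^sup>+s. ennreal (if 0 < s \<and> s \<le> y then s powr a else 0) \<partial>lborel)"
    by (intro nn_integral_cong) (auto simp: indicator_def)
  finally show ?thesis .
qed

text \<open>
  Real interpolation between \<open>L\<^sup>1 \<rightarrow> L\<^sup>\<infinity>\<close> and \<open>L\<^sup>2 \<rightarrow> L\<^sup>2\<close>: at height \<open>s\<close> the part of \<open>f\<close> with
  \<open>s \<bar>f\<bar> powr (p - 1) > 2 A\<close> contributes at most \<open>s / 2\<close>, so that \<open>T f\<close> is controlled by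
  the \<open>L\<^sup>2\<close> bound for the other part wherever \<open>\<bar>T f\<bar> \<ge> s\<close>.
\<close>

lemma real_interpolation:
  fixes T :: "(real \<Rightarrow> 'a::{banach, second_countable_topology}) \<Rightarrow> real \<Rightarrow> 'b::{banach, second_countable_topology}"
  assumes p: "1 < p" "p < 2" and q: "q = p / (p - 1)"
    and A: "0 < A" and B: "0 \<le> B"
    and add: "\<And>f1 f2 w. integrable lborel f1 \<Longrightarrow> integrable lborel f2 \<Longrightarrow> T (\<lambda>t. f1 t + f2 t) w = T f1 w + T f2 w"
    and sup: "\<And>f w. integrable lborel f \<Longrightarrow> norm (T f w) \<le> A * (LBINT t. norm (f t))"
    and L2: "\<And>f. integrable lborel f \<Longrightarrow>
       (\<integral>\<^sup>+w. ennreal ((norm (T f w))\<^sup>2) \<partial>lborel) \<le> ennreal B * (\<integral>\<^sup>+t. ennreal ((norm (f t))\<^sup>2) \<partial>lborel)"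
    and meas: "\<And>f. integrable lborel f \<Longrightarrow> T f \<in> borel_measurable borel"
    and f: "integrable lborel f" and f1: "(\<integral>\<^sup>+t. ennreal (norm (f t) powr p) \<partial>lborel) \<le> 1"
  shows "(\<integral>\<^sup>+w. ennreal (norm (T f w) powr q) \<partial>lborel) \<le> ennreal (4 * B * (2 * A) powr (q - 2))"
proof -
  have [measurable]: "f \<in> borel_measurable borel" "T f \<in> borel_measurable borel" using f meas by simp_all
  have q2: "2 < q" using p by (simp add: q field_simps)
  \<comment> \<open>This identity for conjugate exponents is what turns |f|^2 / |f|^((p - 1) (q -
    2)) into |f|^p at the end.\<close>
  have pq: "(p - 1) * (q - 2) = 2 - p" using p by (simp add: q field_simps)
  have int_p: "integrable lborel (\<lambda>t. norm (f t) powr p)"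
    using f1 by (intro integrableI_bounded) (auto intro: le_less_trans)
  have int_p_le: "(LBINT t. norm (f t) powr p) \<le> 1"
    using f1 int_p by (simp add: nn_integral_eq_integral)
  define small where "small = (\<lambda>s t. s * norm (f t) powr (p - 1) \<le> 2 * A)"
  have level: "(\<integral>\<^sup>+w. ennreal (if s \<le> norm (T f w) then (norm (T f w))\<^sup>2 else 0) \<partial>lborel) \<le>
      ennreal (4 * B) * (\<integral>\<^sup>+t. ennreal (if small s t then (norm (f t))\<^sup>2 else 0) \<partial>lborel)" if s: "0 < s" for s
  proof -
    define f2 where "f2 = (\<lambda>t. if small s t then f t else 0)"
    define f3 where "f3 = (\<lambda>t. if small s t then 0 else f t)"
    have [measurable]: "Measurable.pred borel (small s)" unfolding small_def by measurable
    have f2: "integrable lborel f2" unfolding f2_def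
      by (rule Bochner_Integration.integrable_bound[OF f]) auto
    have f3: "integrable lborel f3" unfolding f3_def
      by (rule Bochner_Integration.integrable_bound[OF f]) auto
    have [measurable]: "T f2 \<in> borel_measurable borel" by (rule meas[OF f2])
    \<comment> \<open>Where f3 does not vanish, s |f|^(p - 1) > 2 A, that is, |f| <= s / (2 A) *
      |f|^p; so the L^1 norm of f3 is controlled by the L^p energy of f.\<close>
    have "A * (LBINT t. norm (f3 t)) \<le> A * (LBINT t. s / (2 * A) * norm (f t) powr p)"
    proof (intro mult_left_mono integral_mono integrable_norm f3 integrable_mult_right int_p)
      fix t
      show "norm (f3 t) \<le> s / (2 * A) * norm (f t) powr p"
      proof (cases "small s t \<or> f t = 0")
        case False
        then have "norm (f t) * (2 * A) \<le> norm (f t) * (s * norm (f t) powr (p - 1))"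
          by (intro mult_left_mono) (auto simp: small_def)
        also have "\<dots> = s * norm (f t) powr p"
          using False by (simp add: powr_diff)
        finally show ?thesis using A False by (simp add: f3_def field_simps)
      qed (use A s in \<open>auto simp: f3_def\<close>)
    qed (use A in simp)
    also have "\<dots> = s / 2 * (LBINT t. norm (f t) powr p)" using A by simp
    also have "\<dots> \<le> s / 2 * 1" using s by (intro mult_left_mono int_p_le) auto
    finally have le3: "norm (T f3 w) \<le> s / 2" for w using sup[OF f3, of w] by simp
    have "T f w = T f2 w + T f3 w" for w
    proof -
      have "f = (\<lambda>t. f2 t + f3 t)" by (auto simp: f2_def f3_def)
      then show ?thesis using add[OF f2 f3, of w] by simp
    qed
    then have "norm (T f w) \<le> norm (T f2 w) + s / 2" for w
      using norm_triangle_ineq[of "T f2 w" "T f3 w"] le3[of w] by simp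
    \<comment> \<open>Where |T f| >= s, the error s / 2 is at most half of |T f|, hence |T f| <= 2
      |T f2|; this is the origin of the factor 4.\<close>
    then have pt: "(if s \<le> norm (T f w) then (norm (T f w))\<^sup>2 else 0) \<le> 4 * (norm (T f2 w))\<^sup>2" for w
    proof -
      assume *: "\<And>w. norm (T f w) \<le> norm (T f2 w) + s / 2"
      have "s \<le> norm (T f w) \<Longrightarrow> (norm (T f w))\<^sup>2 \<le> (2 * norm (T f2 w))\<^sup>2"
        using *[of w] by (intro power_mono) auto
      then show ?thesis by auto
    qed
    have "(\<integral>\<^sup>+w. ennreal (if s \<le> norm (T f w) then (norm (T f w))\<^sup>2 else 0) \<partial>lborel) \<le> (\<integral>\<^sup>+w. ennreal (4 * (norm (T f2 w))\<^sup>2) \<partial>lborel)"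
      by (intro nn_integral_mono ennreal_leI pt)
    also have "\<dots> = ennreal 4 * (\<integral>\<^sup>+w. ennreal ((norm (T f2 w))\<^sup>2) \<partial>lborel)"
      by (subst nn_integral_cmult[symmetric]) (auto simp: ennreal_mult)
    also have "\<dots> \<le> ennreal 4 * (ennreal B * (\<integral>\<^sup>+t. ennreal ((norm (f2 t))\<^sup>2) \<partial>lborel))"
      by (intro mult_left_mono L2 f2) simp
    also have "(\<integral>\<^sup>+t. ennreal ((norm (f2 t))\<^sup>2) \<partial>lborel) = (\<integral>\<^sup>+t. ennreal (if small s t then (norm (f t))\<^sup>2 else 0) \<partial>lborel)"
      by (intro nn_integral_cong) (auto simp: f2_def)
    finally show ?thesis using B by (simp add: ennreal_mult mult.assoc)
  qed
  \<comment> \<open>The level estimate is integrated against s^(q - 3) ds. The inner integral over 0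
    < s <= y is y^(q - 2) / (q - 2), finite because q > 2, and the factor y^2 completes it to y^q.
    On the other side s runs up to 2 A / |f|^(p - 1).\<close>
  have LHS: "(\<integral>\<^sup>+s. ennreal (if 0 < s then s powr (q - 3) else 0) *
        (\<integral>\<^sup>+w. ennreal (if s \<le> norm (T f w) then (norm (T f w))\<^sup>2 else 0) \<partial>lborel) \<partial>lborel)
      = ennreal (1 / (q - 2)) * (\<integral>\<^sup>+w. ennreal (norm (T f w) powr q) \<partial>lborel)"
  proof -
    have "(\<integral>\<^sup>+s. ennreal (if 0 < s then s powr (q - 3) else 0) *
        (\<integral>\<^sup>+w. ennreal (if s \<le> norm (T f w) then (norm (T f w))\<^sup>2 else 0) \<partial>lborel) \<partial>lborel)
      = (\<integral>\<^sup>+s. \<integral>\<^sup>+w. ennreal (if 0 < s \<and> s \<le> norm (T f w) then s powr (q - 3) else 0) * ennreal ((norm (T f w))\<^sup>2) \<partial>lborel \<partial>lborel)"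
      by (intro nn_integral_cong) (auto simp: nn_integral_cmult[symmetric] intro!: nn_integral_cong)
    also have "\<dots> = (\<integral>\<^sup>+w. \<integral>\<^sup>+s. ennreal (if 0 < s \<and> s \<le> norm (T f w) then s powr (q - 3) else 0) * ennreal ((norm (T f w))\<^sup>2) \<partial>lborel \<partial>lborel)"
      by (intro lborel_pair.Fubini') measurable
    also have "\<dots> = (\<integral>\<^sup>+w. ennreal (1 / (q - 2)) * ennreal (norm (T f w) powr q) \<partial>lborel)"
    proof (intro nn_integral_cong)
      fix w
      define y where "y = norm (T f w)"
      have y: "0 \<le> y" by (simp add: y_def)
      have "(\<integral>\<^sup>+s. ennreal (if 0 < s \<and> s \<le> y then s powr (q - 3) else 0) * ennreal (y\<^sup>2) \<partial>lborel)
          = ennreal (y powr (q - 2) / (q - 2)) * ennreal (y\<^sup>2)"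
        using nn_integral_powr_Ioc[of "q - 3" y] q2 y by (simp add: nn_integral_multc)
      also have "\<dots> = ennreal (1 / (q - 2) * (y powr (q - 2) * y powr 2))"
        using q2 y by (simp add: ennreal_mult[symmetric] powr_numeral)
      also have "y powr (q - 2) * y powr 2 = y powr q" by (simp add: powr_add[symmetric])
      finally show "(\<integral>\<^sup>+s. ennreal (if 0 < s \<and> s \<le> norm (T f w) then s powr (q - 3) else 0) * ennreal ((norm (T f w))\<^sup>2) \<partial>lborel)
          = ennreal (1 / (q - 2)) * ennreal (norm (T f w) powr q)"
      proof -
        assume "(\<integral>\<^sup>+s. ennreal (if 0 < s \<and> s \<le> y then s powr (q - 3) else 0) * ennreal (y\<^sup>2) \<partial>lborel) = ennreal (1 / (q - 2) * y powr q)"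
        moreover have "ennreal (1 / (q - 2) * y powr q) = ennreal (1 / (q - 2)) * ennreal (y powr q)"
          using q2 by (intro ennreal_mult) auto
        ultimately show ?thesis by (simp only: y_def)
      qed
    qed
    finally show ?thesis by (simp add: nn_integral_cmult)
  qed
  have RHS: "(\<integral>\<^sup>+s. ennreal (if 0 < s then s powr (q - 3) else 0) *
        (\<integral>\<^sup>+t. ennreal (if small s t then (norm (f t))\<^sup>2 else 0) \<partial>lborel) \<partial>lborel)
      = ennreal ((2 * A) powr (q - 2) / (q - 2)) * (\<integral>\<^sup>+t. ennreal (norm (f t) powr p) \<partial>lborel)"
  proof -
    have "(\<integral>\<^sup>+s. ennreal (if 0 < s then s powr (q - 3) else 0) *
        (\<integral>\<^sup>+t. ennreal (if small s t then (norm (f t))\<^sup>2 else 0) \<partial>lborel) \<partial>lborel)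
      = (\<integral>\<^sup>+s. \<integral>\<^sup>+t. ennreal (if 0 < s \<and> s * norm (f t) powr (p - 1) \<le> 2 * A then s powr (q - 3) else 0) * ennreal ((norm (f t))\<^sup>2) \<partial>lborel \<partial>lborel)"
      unfolding small_def
      by (intro nn_integral_cong) (auto simp: nn_integral_cmult[symmetric] intro!: nn_integral_cong)
    also have "\<dots> = (\<integral>\<^sup>+t. \<integral>\<^sup>+s. ennreal (if 0 < s \<and> s * norm (f t) powr (p - 1) \<le> 2 * A then s powr (q - 3) else 0) * ennreal ((norm (f t))\<^sup>2) \<partial>lborel \<partial>lborel)"
      by (intro lborel_pair.Fubini') measurable
    also have "\<dots> = (\<integral>\<^sup>+t. ennreal ((2 * A) powr (q - 2) / (q - 2)) * ennreal (norm (f t) powr p) \<partial>lborel)"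
    proof (intro nn_integral_cong)
      fix t
      define y where "y = norm (f t)"
      have "(\<integral>\<^sup>+s. ennreal (if 0 < s \<and> s * y powr (p - 1) \<le> 2 * A then s powr (q - 3) else 0) * ennreal (y\<^sup>2) \<partial>lborel)
          = ennreal ((2 * A) powr (q - 2) / (q - 2)) * ennreal (y powr p)"
      proof (cases "y = 0")
        case False
        then have y: "0 < y" by (simp add: y_def)
        have "s * y powr (p - 1) \<le> 2 * A \<longleftrightarrow> s \<le> 2 * A / y powr (p - 1)" for s
          using y by (simp add: pos_le_divide_eq)
        then have "(\<integral>\<^sup>+s. ennreal (if 0 < s \<and> s * y powr (p - 1) \<le> 2 * A then s powr (q - 3) else 0) * ennreal (y\<^sup>2) \<partial>lborel)
          = ennreal ((2 * A / y powr (p - 1)) powr (q - 2) / (q - 2)) * ennreal (y\<^sup>2)"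
          using nn_integral_powr_Ioc[of "q - 3" "2 * A / y powr (p - 1)"] q2 y A by (simp add: nn_integral_multc)
        also have "\<dots> = ennreal ((2 * A / y powr (p - 1)) powr (q - 2) / (q - 2) * y powr 2)"
          using q2 y by (simp add: ennreal_mult[symmetric] powr_numeral)
        also have "(2 * A / y powr (p - 1)) powr (q - 2) = (2 * A) powr (q - 2) / y powr (2 - p)"
          using y A by (simp add: powr_divide powr_powr pq)
        also have "(2 * A) powr (q - 2) / y powr (2 - p) / (q - 2) * y powr 2 = (2 * A) powr (q - 2) / (q - 2) * (y powr 2 / y powr (2 - p))"
          by simp
        also have "y powr 2 / y powr (2 - p) = y powr p" unfolding powr_diff[symmetric] by simp
        also have "ennreal ((2 * A) powr (q - 2) / (q - 2) * y powr p) = ennreal ((2 * A) powr (q - 2) / (q - 2)) * ennreal (y powr p)"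
          using q2 by (intro ennreal_mult) auto
        finally show ?thesis .
      qed simp
      then show "(\<integral>\<^sup>+s. ennreal (if 0 < s \<and> s * norm (f t) powr (p - 1) \<le> 2 * A then s powr (q - 3) else 0) * ennreal ((norm (f t))\<^sup>2) \<partial>lborel)
          = ennreal ((2 * A) powr (q - 2) / (q - 2)) * ennreal (norm (f t) powr p)"
        by (simp add: y_def)
    qed
    finally show ?thesis by (simp add: nn_integral_cmult)
  qed
  have [measurable]: "Measurable.pred (lborel \<Otimes>\<^sub>M lborel) (\<lambda>(s, t). small s t)" unfolding small_def by measurable
  have "ennreal (1 / (q - 2)) * (\<integral>\<^sup>+w. ennreal (norm (T f w) powr q) \<partial>lborel)
      \<le> (\<integral>\<^sup>+s. ennreal (4 * B) * (ennreal (if 0 < s then s powr (q - 3) else 0) *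
        (\<integral>\<^sup>+t. ennreal (if small s t then (norm (f t))\<^sup>2 else 0) \<partial>lborel)) \<partial>lborel)"
    unfolding LHS[symmetric]
  proof (rule nn_integral_mono)
    fix s
    show "ennreal (if 0 < s then s powr (q - 3) else 0) *
        (\<integral>\<^sup>+w. ennreal (if s \<le> norm (T f w) then (norm (T f w))\<^sup>2 else 0) \<partial>lborel)
      \<le> ennreal (4 * B) * (ennreal (if 0 < s then s powr (q - 3) else 0) *
        (\<integral>\<^sup>+t. ennreal (if small s t then (norm (f t))\<^sup>2 else 0) \<partial>lborel))"
      using mult_left_mono[OF level[of s], of "ennreal (s powr (q - 3))"] by (auto simp: mult_ac)
  qed
  also have "\<dots> = ennreal (4 * B) * (ennreal ((2 * A) powr (q - 2) / (q - 2)) * (\<integral>\<^sup>+t. ennreal (norm (f t) powr p) \<partial>lborel))"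
    unfolding RHS[symmetric] by (rule nn_integral_cmult) measurable
  also have "\<dots> \<le> ennreal (4 * B) * (ennreal ((2 * A) powr (q - 2) / (q - 2)) * 1)"
    by (intro mult_left_mono f1) auto
  finally have "ennreal (q - 2) * (ennreal (1 / (q - 2)) * (\<integral>\<^sup>+w. ennreal (norm (T f w) powr q) \<partial>lborel)) \<le>
     ennreal (q - 2) * (ennreal (4 * B) * ennreal ((2 * A) powr (q - 2) / (q - 2)))"
    by (intro mult_left_mono) auto
  moreover have "ennreal (q - 2) * (ennreal (1 / (q - 2)) * X) = X" for X
  proof -
    have "ennreal (q - 2) * ennreal (1 / (q - 2)) = ennreal ((q - 2) * (1 / (q - 2)))"
      using q2 by (intro ennreal_mult[symmetric]) auto
    then show ?thesis using q2 by (simp add: mult.assoc[symmetric])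
  qed
  moreover have "ennreal (q - 2) * (ennreal (4 * B) * ennreal ((2 * A) powr (q - 2) / (q - 2))) = ennreal (4 * B * (2 * A) powr (q - 2))"
  proof -
    have "ennreal (q - 2) * (ennreal (4 * B) * ennreal ((2 * A) powr (q - 2) / (q - 2))) = ennreal ((q - 2) * (4 * B * ((2 * A) powr (q - 2) / (q - 2))))"
      using q2 B by (subst ennreal_mult, simp, simp, subst ennreal_mult) auto
    also have "(q - 2) * (4 * B * ((2 * A) powr (q - 2) / (q - 2))) = 4 * B * (2 * A) powr (q - 2)"
      using q2 by simp
    finally show ?thesis .
  qed
  ultimately show ?thesis by simp
qed

section \<open>Completeness of L^q\<close>

lemma powr_norm_add_le:
  fixes a b :: "'a::real_normed_vector"
  assumes "0 \<le> q"
  shows "norm (a + b) powr q \<le> 2 powr q * (norm a powr q + norm b powr q)"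
proof -
  have "norm (a + b) \<le> 2 * max (norm a) (norm b)" using norm_triangle_ineq[of a b] by simp
  then have "norm (a + b) powr q \<le> (2 * max (norm a) (norm b)) powr q"
    using assms by (intro powr_mono2) auto
  also have "\<dots> = 2 powr q * max (norm a) (norm b) powr q" by (simp add: powr_mult)
  also have "\<dots> \<le> 2 powr q * (norm a powr q + norm b powr q)"
    by (intro mult_left_mono) (auto simp: max_def)
  finally show ?thesis .
qed

lemma nn_integral_powr_norm_add_le:
  fixes f g :: "'a \<Rightarrow> 'b::{banach, second_countable_topology}"
  assumes "0 \<le> q" and [measurable]: "f \<in> borel_measurable M" "g \<in> borel_measurable M"
  shows "(\<integral>\<^sup>+x. ennreal (norm (f x + g x) powr q) \<partial>M) \<le>
    ennreal (2 powr q) * ((\<integral>\<^sup>+x. ennreal (norm (f x) powr q) \<partial>M) + (\<integral>\<^sup>+x. ennreal (norm (g x) powr q) \<partial>M))"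
proof -
  have "(\<integral>\<^sup>+x. ennreal (norm (f x + g x) powr q) \<partial>M) \<le>
      (\<integral>\<^sup>+x. ennreal (2 powr q) * (ennreal (norm (f x) powr q) + ennreal (norm (g x) powr q)) \<partial>M)"
    using powr_norm_add_le[OF assms(1)]
    by (intro nn_integral_mono) (simp add: ennreal_mult[symmetric] ennreal_plus[symmetric] del: ennreal_plus)
  then show ?thesis by (simp add: nn_integral_cmult nn_integral_add)
qed

lemma tendsto_0_ennrealI:
  fixes f :: "'a \<Rightarrow> ennreal"
  assumes "\<And>e::real. 0 < e \<Longrightarrow> eventually (\<lambda>x. f x \<le> ennreal e) F"
  shows "(f \<longlongrightarrow> 0) F"
proof (rule order_tendstoI)
  fix a :: ennreal assume "0 < a"
  then obtain e :: real where e: "0 < e" "ennreal e < a"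
  proof -
    from dense[OF \<open>0 < a\<close>] obtain y where y: "0 < y" "y < a" by blast
    then have "y < top" using le_less_trans[OF _ less_le_trans[OF y(2) top_greatest], of y] by simp
    then obtain e where "y = ennreal e" "0 \<le> e" by (cases y) auto
    then show thesis using y that[of e] by simp
  qed
  from assms[OF e(1)] show "eventually (\<lambda>x. f x < a) F"
    by eventually_elim (use e in order)
qed simp

text \<open>Riesz-Fischer in terms of the integrals of q-th powers. Along a fast subsequence the
  increments d n have energy at most 4^(- q n), so the sum of 2^(q n) |d n|^q is finite almost
  everywhere; this forces |d n| <= 2^(- n) eventually, and the subsequence converges
  pointwise.\<close>

lemma Lq_complete:
  fixes u :: "nat \<Rightarrow> 'a \<Rightarrow> 'b::{banach, second_countable_topology}"
  assumes q: "0 < q" and [measurable]: "\<And>k. u k \<in> borel_measurable M"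
    and Cauchy: "\<And>e::real. 0 < e \<Longrightarrow> \<exists>N. \<forall>j\<ge>N. \<forall>k\<ge>N. (\<integral>\<^sup>+x. ennreal (norm (u j x - u k x) powr q) \<partial>M) \<le> ennreal e"
  obtains h where "h \<in> borel_measurable M" "(\<lambda>k. \<integral>\<^sup>+x. ennreal (norm (u k x - h x) powr q) \<partial>M) \<longlonglongrightarrow> 0"
proof -
  define c where "c = 4 powr (- q)"
  have c: "0 < c" by (simp add: c_def)
  define P where "P = (\<lambda>n N. \<forall>j\<ge>N. \<forall>k\<ge>N. (\<integral>\<^sup>+x. ennreal (norm (u j x - u k x) powr q) \<partial>M) \<le> ennreal (c ^ n))"
  have ex: "\<exists>N. P n N" for n using Cauchy[of "c ^ n"] c by (auto simp: P_def)
  define s where "s = (\<lambda>n. SOME N. P n N)"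
  have s: "P n (s n)" for n unfolding s_def by (rule someI_ex[OF ex])
  \<comment> \<open>Partial sums make the indices monotone and at least as large as both
    \<open>s n\<close> and n.\<close>
  define r where "r = (\<lambda>n. \<Sum>i\<le>n. s i + 1)"
  have r_ge: "s n \<le> r n" for n unfolding r_def using member_le_sum[of n "{..n}" "\<lambda>i. s i + 1"] by simp
  have r_Suc: "r n \<le> r (Suc n)" for n by (simp add: r_def)
  have r_n: "n \<le> r n" for n by (induction n) (auto simp: r_def)
  define d where "d = (\<lambda>n x. u (r (Suc n)) x - u (r n) x)"
  have [measurable]: "d n \<in> borel_measurable M" for n unfolding d_def by measurable
  have d_le: "(\<integral>\<^sup>+x. ennreal (norm (d n x) powr q) \<partial>M) \<le> ennreal (c ^ n)" for n
    using s[of n] r_ge[of n] r_Suc[of n] by (auto simp: P_def d_def)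
  define b where "b = 2 powr q"
  have b: "0 < b" "b * c < 1"
  proof -
    have "b * c = 2 powr q / 4 powr q" by (simp add: b_def c_def powr_minus_divide)
    also have "\<dots> = (2 / 4) powr q" by (simp only: powr_divide)
    also have "\<dots> < 1 powr q" using q by (intro powr_less_mono2) auto
    finally show "b * c < 1" by simp
  qed (simp add: b_def)
  have "(\<integral>\<^sup>+x. (\<Sum>n. ennreal (b ^ n * norm (d n x) powr q)) \<partial>M) \<le> (\<Sum>n. ennreal ((b * c) ^ n))"
  proof -
    have "(\<integral>\<^sup>+x. (\<Sum>n. ennreal (b ^ n * norm (d n x) powr q)) \<partial>M) = (\<Sum>n. \<integral>\<^sup>+x. ennreal (b ^ n * norm (d n x) powr q) \<partial>M)"
      by (intro nn_integral_suminf) measurable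
    also have "\<dots> \<le> (\<Sum>n. ennreal ((b * c) ^ n))"
    proof (intro suminf_le allI)
      fix n
      have "(\<integral>\<^sup>+x. ennreal (b ^ n * norm (d n x) powr q) \<partial>M) = ennreal (b ^ n) * (\<integral>\<^sup>+x. ennreal (norm (d n x) powr q) \<partial>M)"
        using b by (subst nn_integral_cmult[symmetric]) (auto simp: ennreal_mult)
      also have "\<dots> \<le> ennreal (b ^ n) * ennreal (c ^ n)" by (intro mult_left_mono d_le) simp
      also have "\<dots> = ennreal ((b * c) ^ n)" using b c by (simp add: ennreal_mult[symmetric] power_mult_distrib)
      finally show "(\<integral>\<^sup>+x. ennreal (b ^ n * norm (d n x) powr q) \<partial>M) \<le> ennreal ((b * c) ^ n)" .
    qed auto
    finally show ?thesis .
  qed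
  also have "(\<Sum>n. ennreal ((b * c) ^ n)) < \<infinity>"
  proof -
    have "(\<Sum>n. ennreal ((b * c) ^ n)) = ennreal (\<Sum>n. (b * c) ^ n)"
      using b c by (intro suminf_ennreal2 summable_geometric) auto
    then show ?thesis by simp
  qed
  finally have "AE x in M. (\<Sum>n. ennreal (b ^ n * norm (d n x) powr q)) \<noteq> \<infinity>"
    by (intro nn_integral_PInf_AE) auto
  then have conv: "AE x in M. convergent (\<lambda>n. u (r n) x)"
  proof eventually_elim
    fix x assume fin: "(\<Sum>n. ennreal (b ^ n * norm (d n x) powr q)) \<noteq> \<infinity>"
    have "summable (\<lambda>n. b ^ n * norm (d n x) powr q)"
      using fin b by (intro summable_suminf_not_top) auto
    then have "(\<lambda>n. b ^ n * norm (d n x) powr q) \<longlonglongrightarrow> 0" by (rule summable_LIMSEQ_zero)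
    then have "eventually (\<lambda>n. b ^ n * norm (d n x) powr q < 1) sequentially"
      by (rule order_tendstoD) simp
    then have "eventually (\<lambda>n. norm (d n x) \<le> (1/2) ^ n) sequentially"
    proof eventually_elim
      fix n assume *: "b ^ n * norm (d n x) powr q < 1"
      have "b ^ n = (2 ^ n) powr q"
        by (simp add: b_def powr_power powr_realpow[symmetric] powr_powr mult.commute)
      then have "(2 ^ n * norm (d n x)) powr q < 1 powr q" using * by (simp add: powr_mult)
      then have "2 ^ n * norm (d n x) < 1"
        using powr_mono2[of q 1 "2 ^ n * norm (d n x)"] q by (cases "2 ^ n * norm (d n x) < 1") auto
      then show "norm (d n x) \<le> (1/2) ^ n" by (simp add: power_divide field_simps)
    qed
    then have "summable (\<lambda>n. d n x)"
      by (rule summable_comparison_test_ev) (simp add: summable_geometric)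
    then have "convergent (\<lambda>n. \<Sum>i<n. d i x)" by (simp add: summable_iff_convergent)
    moreover have "(\<Sum>i<n. d i x) = u (r n) x - u (r 0) x" for n
      unfolding d_def by (rule sum_lessThan_telescope)
    ultimately have "convergent (\<lambda>n. u (r n) x - u (r 0) x)" by simp
    then show "convergent (\<lambda>n. u (r n) x)"
      using convergent_diff_const_right_iff by blast
  qed
  define h where "h = (\<lambda>x. lim (\<lambda>n. u (r n) x))"
  have [measurable]: "h \<in> borel_measurable M" unfolding h_def by measurable
  have lim: "AE x in M. (\<lambda>n. u (r n) x) \<longlonglongrightarrow> h x"
    using conv by eventually_elim (simp add: h_def convergent_LIMSEQ_iff)
  have "(\<lambda>k. \<integral>\<^sup>+x. ennreal (norm (u k x - h x) powr q) \<partial>M) \<longlonglongrightarrow> 0"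
  proof (rule tendsto_0_ennrealI)
    fix e :: real assume "0 < e"
    \<comment> \<open>Fatou along the subsequence carries the Cauchy estimate over to h; the shift
      by N makes every index of the subsequence at least N.\<close>
    from Cauchy[OF this] obtain N where N: "\<And>j k. N \<le> j \<Longrightarrow> N \<le> k \<Longrightarrow> (\<integral>\<^sup>+x. ennreal (norm (u j x - u k x) powr q) \<partial>M) \<le> ennreal e"
      by blast
    have "(\<integral>\<^sup>+x. ennreal (norm (u k x - h x) powr q) \<partial>M) \<le> ennreal e" if k: "N \<le> k" for k
    proof (rule nn_integral_le_of_tendsto)
      show "AE x in M. (\<lambda>n. ennreal (norm (u k x - u (r (n + N)) x) powr q)) \<longlonglongrightarrow> ennreal (norm (u k x - h x) powr q)"
        using lim
      proof eventually_elim
        fix x assume "(\<lambda>n. u (r n) x) \<longlonglongrightarrow> h x"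
        then have "(\<lambda>n. u (r (n + N)) x) \<longlonglongrightarrow> h x" by (rule LIMSEQ_ignore_initial_segment)
        then show "(\<lambda>n. ennreal (norm (u k x - u (r (n + N)) x) powr q)) \<longlonglongrightarrow> ennreal (norm (u k x - h x) powr q)"
          using q by (intro tendsto_ennrealI tendsto_powr' tendsto_intros) auto
      qed
      show "(\<integral>\<^sup>+x. ennreal (norm (u k x - u (r (n + N)) x) powr q) \<partial>M) \<le> ennreal e" for n
        using r_n[of "n + N"] k by (intro N) auto
    qed measurable
    then show "eventually (\<lambda>k. (\<integral>\<^sup>+x. ennreal (norm (u k x - h x) powr q) \<partial>M) \<le> ennreal e) sequentially"
      unfolding eventually_sequentially by blast
  qed
  then show thesis by (intro that[of h]) auto
qed

section \<open>The complex structure of a slice\<close>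

lemma clcoeff_gen_mult:
  "clcoeff (gen i * x) C = blade_sign {i} (sym_diff {i} C) * clcoeff x (sym_diff {i} C)"
proof -
  have "clcoeff (gen i * x) C = (\<Sum>A\<in>UNIV. if A = {i} then blade_sign {i} (sym_diff {i} C) * clcoeff x (sym_diff {i} C) else 0)"
    unfolding clcoeff_mult by (intro sum.cong refl) auto
  then show ?thesis by simp
qed

text \<open>A generator permutes the blades up to sign. Reindexing by the symmetric difference with
  {i} moves it to the other factor, and the signs then differ by \<open>blade_sign {i} {i}\<close>,
  which is -1.\<close>

lemma inner_gen_mult: "inner (gen i * x) y = - inner x (gen i * y)"
proof -
  have s: "blade_sign {i} (sym_diff {i} (sym_diff {i} C)) = - blade_sign {i} (sym_diff {i} C)" for C :: "'a set"
  proof -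
    have "blade_sign {i} {i} = -1" by (simp add: blade_sign_def)
    then show ?thesis using blade_sign_sym_diff_right[of "{i}" "{i}" "sym_diff {i} C"] by simp
  qed
  have ss: "sym_diff {i} (sym_diff {i} C) = C" for C :: "'a set" by auto
  have "inner (gen i * x) y = (\<Sum>C\<in>UNIV. blade_sign {i} (sym_diff {i} C) * clcoeff x (sym_diff {i} C) * clcoeff y C)"
    by (simp add: inner_clifford_def clcoeff_gen_mult)
  also have "\<dots> = (\<Sum>C\<in>UNIV. blade_sign {i} (sym_diff {i} (sym_diff {i} C)) * clcoeff x (sym_diff {i} (sym_diff {i} C)) * clcoeff y (sym_diff {i} C))"
    by (rule sum_sym_diff_reindex[symmetric])
  also have "\<dots> = - inner x (gen i * y)"
    unfolding s unfolding ss by (simp add: inner_clifford_def clcoeff_gen_mult sum_negf[symmetric] mult_ac)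
  finally show ?thesis .
qed

text \<open>Doubling J * J and exchanging the summation indices produces the anticommutators of the
  generators, of which only the diagonal survives.\<close>

lemma imag_sphere_square:
  assumes "J \<in> imag_sphere"
  shows "J * J = -1"
proof -
  obtain x :: "'a \<Rightarrow> real" where J: "J = (\<Sum>i\<in>UNIV. x i *\<^sub>R gen i)" and x: "(\<Sum>i\<in>UNIV. (x i)\<^sup>2) = 1"
    using assms unfolding imag_sphere_def by blast
  have JJ: "J * J = (\<Sum>i\<in>UNIV. \<Sum>j\<in>UNIV. (x i * x j) *\<^sub>R (gen i * gen j))"
    unfolding J sum_product by (simp add: mult_ac)
  have "J * J + J * J = (\<Sum>i\<in>UNIV. \<Sum>j\<in>UNIV. (x i * x j) *\<^sub>R (gen i * gen j)) + (\<Sum>i\<in>UNIV. \<Sum>j\<in>UNIV. (x j * x i) *\<^sub>R (gen j * gen i))"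
    unfolding JJ by (subst (2) sum.swap) (rule refl)
  also have "\<dots> = (\<Sum>i\<in>UNIV. \<Sum>j\<in>UNIV. (x i * x j) *\<^sub>R (gen i * gen j + gen j * gen i))"
    by (simp add: sum.distrib[symmetric] scaleR_add_right mult.commute)
  also have "\<dots> = (\<Sum>i\<in>UNIV. (x i * x i) *\<^sub>R (-2))"
    unfolding gen_anticommute by (simp add: if_distrib[of "(*\<^sub>R) _"] cong: if_cong)
  also have "\<dots> = (\<Sum>i\<in>UNIV. (x i)\<^sup>2) *\<^sub>R (-2)" by (simp only: scaleR_sum_left power2_eq_square)
  finally have "J * J + J * J = - 2" by (simp add: x)
  then have "2 *\<^sub>R (J * J) = 2 *\<^sub>R (- 1)" by (simp add: scaleR_2)
  then show ?thesis by (simp only: scaleR_cancel_left) simp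
qed

lemma inner_imag_sphere_mult:
  assumes "J \<in> imag_sphere"
  shows "inner (J * x) y = - inner x (J * y)"
proof -
  obtain c :: "'a \<Rightarrow> real" where J: "J = (\<Sum>i\<in>UNIV. c i *\<^sub>R gen i)"
    using assms unfolding imag_sphere_def by blast
  show ?thesis
    unfolding J by (simp add: sum_distrib_right inner_sum_left inner_sum_right inner_gen_mult sum_negf)
qed

text \<open>The embedding of the complex numbers as the plane L_J, with \<i> sent to J; it is
  multiplicative for J in the sphere because J * J = -1.\<close>

definition of_slice :: "'n::{finite,linorder} clifford \<Rightarrow> complex \<Rightarrow> 'n clifford" where
  "of_slice J z = slice_pt J (Re z) (Im z)"

lemma of_slice_add: "of_slice J (z + w) = of_slice J z + of_slice J w"
  by (simp add: of_slice_def slice_pt_def algebra_simps)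

lemma of_slice_scaleR: "of_slice J (r *\<^sub>R z) = r *\<^sub>R of_slice J z"
  by (simp add: of_slice_def slice_pt_def algebra_simps of_real_def)

lemma bounded_linear_of_slice: "bounded_linear (of_slice J)"
  by (rule linear_conv_bounded_linear[THEN iffD1]) (intro linearI of_slice_add of_slice_scaleR)

lemma of_slice_1 [simp]: "of_slice J 1 = 1"
  by (simp add: of_slice_def slice_pt_def)

lemma of_slice_mult:
  assumes "J \<in> imag_sphere"
  shows "of_slice J (z * w) = of_slice J z * of_slice J w"
  by (simp add: of_slice_def slice_pt_def of_real_def algebra_simps imag_sphere_square[OF assms])

lemma of_slice_power: "J \<in> imag_sphere \<Longrightarrow> of_slice J (z ^ k) = of_slice J z ^ k"
  by (induction k) (simp_all add: of_slice_mult)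

text \<open>A continuous linear multiplicative map carries the complex exponential series over term
  by term; the convergence of \<open>clifford_exp\<close> on the slice comes with it.\<close>

lemma clifford_exp_of_slice:
  assumes "J \<in> imag_sphere"
  shows "clifford_exp (of_slice J z) = of_slice J (exp z)"
proof -
  have "(\<lambda>k. of_slice J (z ^ k /\<^sub>R fact k)) sums of_slice J (exp z)"
    by (rule bounded_linear.sums[OF bounded_linear_of_slice exp_converges])
  then show ?thesis
    unfolding clifford_exp_def of_slice_power[OF assms, symmetric] of_slice_scaleR by (rule sums_unique[symmetric])
qed

text \<open>The Clifford norm is not multiplicative in general. For left factors in L_J it is: J
  acts as a skew-adjoint map with square -1, so J * a is orthogonal to a and has the same
  norm.\<close>

lemma norm_of_slice_mult:
  assumes "J \<in> imag_sphere"
  shows "norm (of_slice J z * a) = cmod z * norm a"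
proof -
  have 0: "inner a (J * a) = 0"
    using inner_imag_sphere_mult[OF assms, of a a] by (simp add: inner_commute)
  have 1: "inner (J * a) (J * a) = inner a a"
    using inner_imag_sphere_mult[OF assms, of a "J * a"] imag_sphere_square[OF assms]
    by (simp add: mult.assoc[symmetric])
  have "of_slice J z * a = Re z *\<^sub>R a + Im z *\<^sub>R (J * a)"
    by (simp add: of_slice_def slice_pt_def of_real_def algebra_simps)
  then have "(norm (of_slice J z * a))\<^sup>2 = (Re z)\<^sup>2 * inner a a + (Im z)\<^sup>2 * inner a a"
    unfolding power2_norm_eq_inner
    by (simp add: inner_add_left inner_add_right 0 1 inner_commute[of "J * a" a] power2_eq_square)
  also have "\<dots> = (cmod z * norm a)\<^sup>2"
    by (simp add: power_mult_distrib cmod_power2 power2_norm_eq_inner algebra_simps)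
  finally show ?thesis by (simp add: power2_eq_iff_nonneg)
qed

definition slice_coord :: "'n::{finite,linorder} clifford \<Rightarrow> 'n clifford \<Rightarrow> 'n clifford \<Rightarrow> complex" where
  "slice_coord J b a = Complex (inner a b) (inner a (J * b))"

text \<open>Skew-adjointness and J * J = -1 make the coordinate of J * a equal to \<i> times that of
  a; the factor stays on the left because only left multiplication enters the complex
  structure.\<close>

lemma slice_coord_of_slice_mult:
  assumes "J \<in> imag_sphere"
  shows "slice_coord J b (of_slice J z * a) = z * slice_coord J b a"
proof -
  have "of_slice J z * a = Re z *\<^sub>R a + Im z *\<^sub>R (J * a)"
    by (simp add: of_slice_def slice_pt_def of_real_def algebra_simps)
  moreover have "inner (J * a) (J * b) = inner a b"
    using inner_imag_sphere_mult[OF assms, of a "J * b"] imag_sphere_square[OF assms]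
    by (simp add: mult.assoc[symmetric])
  ultimately show ?thesis
    by (simp add: slice_coord_def complex_eq_iff inner_add_left inner_imag_sphere_mult[OF assms])
qed

lemma bounded_linear_slice_coord: "bounded_linear (slice_coord J b)"
  by (rule linear_conv_bounded_linear[THEN iffD1], intro linearI)
     (simp_all add: slice_coord_def complex_eq_iff inner_add_left)

lemma norm_blade [simp]: "norm (blade A :: 'n::finite clifford) = 1"
proof -
  have "(blade A :: 'n clifford) \<in> Basis" by (simp add: Basis_clifford_def)
  then show ?thesis by (rule norm_Basis)
qed

lemma cmod_slice_coord_le:
  assumes "J \<in> imag_sphere"
  shows "cmod (slice_coord J (blade A) a) \<le> 2 * norm a"
proof -
  have "norm (J * blade A) = 1"
    using norm_of_slice_mult[OF assms, of \<i> "blade A"] by (simp add: of_slice_def slice_pt_def)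
  then have "\<bar>inner a (J * blade A)\<bar> \<le> norm a" "\<bar>inner a (blade A)\<bar> \<le> norm a"
    using Cauchy_Schwarz_ineq2[of a "J * blade A"] Cauchy_Schwarz_ineq2[of a "blade A"] by simp_all
  moreover have "cmod (slice_coord J (blade A) a) \<le> \<bar>inner a (blade A)\<bar> + \<bar>inner a (J * blade A)\<bar>"
    using cmod_le[of "slice_coord J (blade A) a"] by (simp add: slice_coord_def)
  ultimately show ?thesis by linarith
qed

text \<open>The real parts are the ordinary coefficients, so the functionals of all blades together
  determine a. They are twice as many as a complex basis would give, but no basis adapted to J has
  to be chosen.\<close>

lemma norm_le_sum_slice_coord: "norm a \<le> (\<Sum>A\<in>UNIV. cmod (slice_coord J (blade A) a))"
proof -
  have "norm a \<le> (\<Sum>b\<in>Basis. \<bar>inner a b\<bar>)" by (rule norm_le_l1)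
  also have "\<dots> = (\<Sum>A\<in>UNIV. \<bar>inner a (blade A)\<bar>)"
    unfolding Basis_clifford_def
    by (subst sum.reindex) (auto simp: inj_on_def clifford_eq_iff split: if_splits)
  also have "\<dots> \<le> (\<Sum>A\<in>UNIV. cmod (slice_coord J (blade A) a))"
    using abs_Re_le_cmod[of "slice_coord J _ a"] by (intro sum_mono) (simp add: slice_coord_def)
  finally show ?thesis .
qed

lemma slice_coord_eqI:
  assumes "\<And>A. slice_coord J (blade A) a = slice_coord J (blade A) b"
  shows "a = b"
proof -
  interpret bounded_linear "slice_coord J c" for c by (rule bounded_linear_slice_coord)
  have "norm (a - b) \<le> 0" using norm_le_sum_slice_coord[of "a - b" J] assms by (simp add: diff)
  then show ?thesis by simp
qed

section \<open>The Clifford Fourier transform\<close>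

text \<open>The definitions integrate over \<open>lebesgue\<close>, while Fubini and the scalar
  theory work over \<open>lborel\<close>; Borel representatives, found coordinate by coordinate,
  mediate between the two.\<close>

lemma lebesgue_ex_borel:
  fixes f :: "real \<Rightarrow> 'b::euclidean_space"
  assumes f: "f \<in> borel_measurable lebesgue"
  obtains f' where "f' \<in> borel_measurable borel" "AE x in lebesgue. f x = f' x"
proof -
  have "\<exists>g. g \<in> borel_measurable lborel \<and> (AE x in lborel. inner (f x) b = g x)" for b
    using completion_ex_borel_measurable_real[of "\<lambda>x. inner (f x) b" lborel] f by auto
  then obtain g where g: "\<And>b. g b \<in> borel_measurable lborel" "\<And>b. AE x in lborel. inner (f x) b = g b x"
    by metis
  have [measurable]: "g b \<in> borel_measurable borel" for b using g(1)[of b] by simp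
  show thesis
  proof (rule that)
    show "(\<lambda>x. \<Sum>b\<in>Basis. g b x *\<^sub>R b) \<in> borel_measurable borel" by measurable
    have "AE x in lborel. \<forall>b\<in>Basis. inner (f x) b = g b x"
      by (intro AE_finite_allI finite_Basis g)
    then have "AE x in lborel. f x = (\<Sum>b\<in>Basis. g b x *\<^sub>R b)"
    proof eventually_elim
      fix x assume "\<forall>b\<in>Basis. inner (f x) b = g b x"
      then have "(\<Sum>b\<in>Basis. g b x *\<^sub>R b) = (\<Sum>b\<in>Basis. inner (f x) b *\<^sub>R b)" by (intro sum.cong) auto
      then show "f x = (\<Sum>b\<in>Basis. g b x *\<^sub>R b)" by (simp add: euclidean_representation)
    qed
    then show "AE x in lebesgue. f x = (\<Sum>b\<in>Basis. g b x *\<^sub>R b)" by (rule AE_completion)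
  qed
qed

lemma of_slice_mult_eq: "of_slice J z * a = Re z *\<^sub>R a + Im z *\<^sub>R (J * a)"
  by (simp add: of_slice_def slice_pt_def of_real_def algebra_simps)

lemma bounded_linear_clifford_mult: "bounded_linear (\<lambda>a :: 'n::{finite,linorder} clifford. J * a)"
  by (rule linear_conv_bounded_linear[THEN iffD1]) (intro linearI; simp add: distrib_left)

lemma measurable_of_slice_mult [measurable (raw)]:
  fixes g :: "'a \<Rightarrow> 'n::{finite,linorder} clifford"
  assumes [measurable]: "f \<in> borel_measurable M" "g \<in> borel_measurable M"
  shows "(\<lambda>x. of_slice J (f x) * g x) \<in> borel_measurable M"
proof -
  have [measurable]: "(\<lambda>a :: 'n clifford. J * a) \<in> borel_measurable borel"
    by (intro borel_measurable_continuous_onI linear_continuous_on bounded_linear_clifford_mult)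
  show ?thesis unfolding of_slice_mult_eq by measurable
qed

lemma integrable_of_slice_mult:
  fixes g :: "'a \<Rightarrow> 'n::{finite,linorder} clifford"
  assumes J: "J \<in> imag_sphere" and [measurable]: "f \<in> borel_measurable M" and f: "\<And>x. cmod (f x) \<le> 1"
    and g: "integrable M g"
  shows "integrable M (\<lambda>x. of_slice J (f x) * g x)"
proof (rule Bochner_Integration.integrable_bound[OF g])
  have [measurable]: "g \<in> borel_measurable M" using g by simp
  show "(\<lambda>x. of_slice J (f x) * g x) \<in> borel_measurable M" by measurable
  show "AE x in M. norm (of_slice J (f x) * g x) \<le> norm (g x)"
    using f by (auto simp: norm_of_slice_mult[OF J] intro!: mult_left_le_one_le AE_I2)
qed

lemma clifford_exp_imaginary:
  assumes "J \<in> imag_sphere"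
  shows "clifford_exp (- (r *\<^sub>R J)) = of_slice J (cis (- r))"
proof -
  have "- (r *\<^sub>R J) = of_slice J (\<i> * of_real (- r))"
    by (simp add: of_slice_def slice_pt_def)
  then show ?thesis by (simp only: clifford_exp_of_slice[OF assms] cis_conv_exp)
qed

lemma fourier_L1_eq:
  assumes J: "J \<in> imag_sphere" and [measurable]: "g \<in> borel_measurable borel"
  shows "fourier_L1 J g w = (1 / sqrt (2 * pi)) *\<^sub>R (LBINT v. of_slice J (cis (- (v * w))) * g v)"
  unfolding fourier_L1_def clifford_exp_imaginary[OF J] by (subst integral_completion) measurable

lemma fourier_L1_cong_AE:
  assumes J: "J \<in> imag_sphere" and [measurable]: "f \<in> borel_measurable lebesgue" "g \<in> borel_measurable lebesgue"
    and ae: "AE v in lebesgue. f v = g v"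
  shows "fourier_L1 J f = fourier_L1 J g"
proof (rule ext)
  fix w
  have [measurable]: "(\<lambda>v. cis (-(v * w))) \<in> borel_measurable lebesgue"
    by (intro measurable_completion) measurable
  have "(LINT v|lebesgue. of_slice J (cis (-(v * w))) * f v) = (LINT v|lebesgue. of_slice J (cis (-(v * w))) * g v)"
  proof (rule integral_cong_AE)
    show "AE v in lebesgue. of_slice J (cis (-(v * w))) * f v = of_slice J (cis (-(v * w))) * g v"
      using ae by eventually_elim simp
  qed measurable
  then show "fourier_L1 J f w = fourier_L1 J g w"
    by (simp add: fourier_L1_def clifford_exp_imaginary[OF J])
qed

lemma measurable_fourier_L1:
  assumes J: "J \<in> imag_sphere" and [measurable]: "g \<in> borel_measurable borel"
  shows "fourier_L1 J g \<in> borel_measurable borel"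
  unfolding fourier_L1_eq[OF assms, abs_def] by measurable

lemma slice_coord_fourier_L1:
  assumes J: "J \<in> imag_sphere" and g: "integrable lborel g"
  shows "slice_coord J b (fourier_L1 J g w) = of_real (1 / sqrt (2 * pi)) * (LBINT v. cis (-(v * w)) * slice_coord J b (g v))"
proof -
  interpret b: bounded_linear "slice_coord J b" by (rule bounded_linear_slice_coord)
  have [measurable]: "g \<in> borel_measurable borel" using g by simp
  have "integrable lborel (\<lambda>v. of_slice J (cis (-(v * w))) * g v)"
    by (rule integrable_of_slice_mult[OF J _ _ g]) auto
  from integral_bounded_linear[OF bounded_linear_slice_coord[of J b] this]
  have "slice_coord J b (fourier_L1 J g w) = (1 / sqrt (2 * pi)) *\<^sub>R (LBINT v. cis (-(v * w)) * slice_coord J b (g v))"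
    by (simp add: fourier_L1_eq[OF J] b.scaleR slice_coord_of_slice_mult[OF J])
  then show ?thesis by (simp only: scaleR_conv_of_real)
qed

text \<open>The factor 1 / sqrt (2 pi) is dropped; this gives the constant A = 1 of the
  interpolation.\<close>

lemma norm_fourier_L1_le:
  assumes J: "J \<in> imag_sphere" and g: "integrable lborel g"
  shows "norm (fourier_L1 J g w) \<le> (LBINT v. norm (g v))"
proof -
  have [measurable]: "g \<in> borel_measurable borel" using g by simp
  have "norm (LBINT v. of_slice J (cis (-(v * w))) * g v) \<le> (LBINT v. norm (g v))"
    using integral_norm_bound[of lborel "\<lambda>v. of_slice J (cis (-(v * w))) * g v"] by (simp add: norm_of_slice_mult[OF J])
  moreover have "1 / sqrt (2 * pi) \<le> 1"
  proof -
    have "1 \<le> 2 * pi" using pi_gt3 by linarith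
    then have "1 \<le> sqrt (2 * pi)" by (simp only: real_sqrt_ge_1_iff)
    then show ?thesis by simp
  qed
  ultimately show ?thesis
    using mult_mono[of "1 / sqrt (2 * pi)" 1 "norm (LBINT v. of_slice J (cis (-(v * w))) * g v)" "LBINT v. norm (g v)"]
    by (simp add: fourier_L1_eq[OF J])
qed

lemma fourier_L1_add:
  assumes J: "J \<in> imag_sphere" and f: "integrable lborel f" and g: "integrable lborel g"
  shows "fourier_L1 J (\<lambda>v. f v + g v) w = fourier_L1 J f w + fourier_L1 J g w"
proof -
  have [measurable]: "f \<in> borel_measurable borel" "g \<in> borel_measurable borel" using f g by simp_all
  have "integrable lborel (\<lambda>v. of_slice J (cis (-(v * w))) * h v)" if "integrable lborel h" for h
    by (rule integrable_of_slice_mult[OF J _ _ that]) auto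
  then show ?thesis using f g
    by (simp add: fourier_L1_eq[OF J] distrib_left scaleR_add_right)
qed

lemma fourier_L1_scaleR:
  assumes J: "J \<in> imag_sphere" and [measurable]: "f \<in> borel_measurable borel"
  shows "fourier_L1 J (\<lambda>v. c *\<^sub>R f v) w = c *\<^sub>R fourier_L1 J f w"
  by (simp add: fourier_L1_eq[OF J])

lemma norm_square_le_slice_coord: "(norm a)\<^sup>2 \<le> (\<Sum>A\<in>UNIV. (cmod (slice_coord J (blade A) a))\<^sup>2)"
proof -
  have "(norm a)\<^sup>2 = (\<Sum>b\<in>Basis. (inner a b)\<^sup>2)"
    unfolding power2_norm_eq_inner euclidean_inner[of a a] by (simp add: power2_eq_square)
  also have "\<dots> = (\<Sum>A\<in>UNIV. (inner a (blade A))\<^sup>2)"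
    unfolding Basis_clifford_def
    by (subst sum.reindex) (auto simp: inj_on_def clifford_eq_iff split: if_splits)
  also have "\<dots> \<le> (\<Sum>A\<in>UNIV. (cmod (slice_coord J (blade A) a))\<^sup>2)"
    by (intro sum_mono) (simp add: slice_coord_def cmod_power2)
  finally show ?thesis .
qed

lemma measurable_slice_coord [measurable]: "slice_coord J b \<in> borel_measurable borel"
  by (intro borel_measurable_continuous_onI linear_continuous_on bounded_linear_slice_coord)

text \<open>The scalar inequality in each coordinate, where the squared normalisation cancels 2 pi.
  The 4 is the square of the constant in \<open>cmod_slice_coord_le\<close>, and the cardinality
  counts the blades.\<close>

lemma fourier_L1_Plancherel:
  fixes f :: "real \<Rightarrow> 'n::{finite,linorder} clifford"
  assumes J: "J \<in> imag_sphere" and f: "integrable lborel f"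
  shows "(\<integral>\<^sup>+w. ennreal ((norm (fourier_L1 J f w))\<^sup>2) \<partial>lborel) \<le>
    ennreal (4 * real (CARD('n set))) * (\<integral>\<^sup>+v. ennreal ((norm (f v))\<^sup>2) \<partial>lborel)"
proof -
  have [measurable]: "f \<in> borel_measurable borel" using f by simp
  have [measurable]: "fourier_L1 J f \<in> borel_measurable borel" by (rule measurable_fourier_L1[OF J]) simp
  define h where "h = (\<lambda>A w. slice_coord J (blade A) (fourier_L1 J f w))"
  have [measurable]: "h A \<in> borel_measurable borel" for A unfolding h_def by measurable
  have "(\<integral>\<^sup>+w. ennreal ((norm (fourier_L1 J f w))\<^sup>2) \<partial>lborel) \<le> (\<integral>\<^sup>+w. (\<Sum>A\<in>UNIV. ennreal ((cmod (h A w))\<^sup>2)) \<partial>lborel)"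
    by (intro nn_integral_mono) (simp add: h_def sum_ennreal, intro ennreal_leI norm_square_le_slice_coord)
  also have "\<dots> = (\<Sum>A\<in>UNIV. \<integral>\<^sup>+w. ennreal ((cmod (h A w))\<^sup>2) \<partial>lborel)"
    by (intro nn_integral_sum) measurable
  also have "\<dots> \<le> (\<Sum>A\<in>(UNIV :: 'n set set). ennreal 4 * (\<integral>\<^sup>+v. ennreal ((norm (f v))\<^sup>2) \<partial>lborel))"
  proof (rule sum_mono)
    fix A :: "'n set"
    let ?c = "\<lambda>v. slice_coord J (blade A) (f v)"
    have int: "integrable lborel ?c"
      using integrable_bounded_linear[OF bounded_linear_slice_coord f] .
    have "(\<integral>\<^sup>+w. ennreal ((cmod (h A w))\<^sup>2) \<partial>lborel) = (\<integral>\<^sup>+w. ennreal (1 / (2 * pi)) * ennreal ((cmod (LBINT v. cis (-(v * w)) * ?c v))\<^sup>2) \<partial>lborel)"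
      unfolding h_def slice_coord_fourier_L1[OF J f]
      by (intro nn_integral_cong) (simp add: norm_mult power_mult_distrib ennreal_mult[symmetric] power_divide norm_divide)
    also have "\<dots> = ennreal (1 / (2 * pi)) * (\<integral>\<^sup>+w. ennreal ((cmod (LBINT v. cis (-(v * w)) * ?c v))\<^sup>2) \<partial>lborel)"
      by (rule nn_integral_cmult) measurable
    also have "\<dots> \<le> ennreal (1 / (2 * pi)) * (ennreal (2 * pi) * (\<integral>\<^sup>+v. ennreal ((cmod (?c v))\<^sup>2) \<partial>lborel))"
      by (intro mult_left_mono Plancherel_inequality int) simp
    also have "\<dots> = (\<integral>\<^sup>+v. ennreal ((cmod (?c v))\<^sup>2) \<partial>lborel)"
      by (simp add: mult.assoc[symmetric] ennreal_mult[symmetric])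
    also have "\<dots> \<le> (\<integral>\<^sup>+v. ennreal 4 * ennreal ((norm (f v))\<^sup>2) \<partial>lborel)"
    proof (rule nn_integral_mono)
      fix v
      have "(cmod (?c v))\<^sup>2 \<le> (2 * norm (f v))\<^sup>2" by (intro power_mono cmod_slice_coord_le J) simp
      also have "\<dots> = 4 * (norm (f v))\<^sup>2" by (simp add: power_mult_distrib)
      finally show "ennreal ((cmod (?c v))\<^sup>2) \<le> ennreal 4 * ennreal ((norm (f v))\<^sup>2)"
        by (subst ennreal_mult[symmetric]) (auto intro: ennreal_leI)
    qed
    also have "\<dots> = ennreal 4 * (\<integral>\<^sup>+v. ennreal ((norm (f v))\<^sup>2) \<partial>lborel)"
      by (rule nn_integral_cmult) measurable
    finally show "(\<integral>\<^sup>+w. ennreal ((cmod (h A w))\<^sup>2) \<partial>lborel) \<le> ennreal 4 * (\<integral>\<^sup>+v. ennreal ((norm (f v))\<^sup>2) \<partial>lborel)" .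
  qed
  also have "\<dots> = of_nat (CARD('n set)) * (ennreal 4 * (\<integral>\<^sup>+v. ennreal ((norm (f v))\<^sup>2) \<partial>lborel))"
    by simp
  also have "\<dots> = ennreal (4 * real (CARD('n set))) * (\<integral>\<^sup>+v. ennreal ((norm (f v))\<^sup>2) \<partial>lborel)"
    by (simp add: ennreal_of_nat_eq_real_of_nat ennreal_mult mult_ac del: card_Pow)
  finally show ?thesis .
qed

text \<open>Plancherel for p = 2, interpolation for p < 2, in both cases for energy at most 1 and
  then rescaled by \<eta>. Bounding through a positive \<eta> instead of the norm of f avoids roots
  of extended reals and a separate case f = 0.\<close>

lemma Hausdorff_Young_borel:
  assumes J: "(J :: 'n::{finite,linorder} clifford) \<in> imag_sphere" and p: "1 < p" "p \<le> 2"
  obtains C where "0 \<le> C" "\<And>(f :: real \<Rightarrow> 'n clifford) \<eta>. integrable lborel f \<Longrightarrow> 0 < \<eta> \<Longrightarrow>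
      (\<integral>\<^sup>+v. ennreal (norm (f v) powr p) \<partial>lborel) \<le> ennreal (\<eta> powr p) \<Longrightarrow>
      (\<integral>\<^sup>+w. ennreal (norm (fourier_L1 J f w) powr (p / (p - 1))) \<partial>lborel) \<le> ennreal (C * \<eta> powr (p / (p - 1)))"
proof -
  define q where "q = p / (p - 1)"
  define B where "B = 4 * real (CARD('n set))"
  have meas: "fourier_L1 J f \<in> borel_measurable borel" if "integrable lborel f" for f :: "real \<Rightarrow> 'n clifford"
    using that by (intro measurable_fourier_L1[OF J]) simp
  have "\<exists>C\<ge>0. \<forall>f :: real \<Rightarrow> 'n clifford. integrable lborel f \<longrightarrow> (\<integral>\<^sup>+v. ennreal (norm (f v) powr p) \<partial>lborel) \<le> 1 \<longrightarrow>
      (\<integral>\<^sup>+w. ennreal (norm (fourier_L1 J f w) powr q) \<partial>lborel) \<le> ennreal C"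
  proof (cases "p = 2")
    case True
    then have q: "q = 2" by (simp add: q_def)
    show ?thesis
    proof (intro exI[of _ B] conjI allI impI)
      fix f :: "real \<Rightarrow> 'n clifford" assume f: "integrable lborel f" "(\<integral>\<^sup>+v. ennreal (norm (f v) powr p) \<partial>lborel) \<le> 1"
      have "(\<integral>\<^sup>+w. ennreal (norm (fourier_L1 J f w) powr q) \<partial>lborel) \<le> ennreal B * (\<integral>\<^sup>+v. ennreal (norm (f v) powr p) \<partial>lborel)"
        using fourier_L1_Plancherel[OF J f(1)] unfolding q True B_def by (simp add: powr_numeral)
      also have "\<dots> \<le> ennreal B * 1" by (intro mult_left_mono f) simp
      finally show "(\<integral>\<^sup>+w. ennreal (norm (fourier_L1 J f w) powr q) \<partial>lborel) \<le> ennreal B" by simp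
    qed (simp add: B_def)
  next
    case False
    then have p2: "p < 2" using p by simp
    show ?thesis
    proof (intro exI[of _ "4 * B * (2 * 1) powr (q - 2)"] conjI allI impI)
      fix f :: "real \<Rightarrow> 'n clifford" assume f: "integrable lborel f" "(\<integral>\<^sup>+v. ennreal (norm (f v) powr p) \<partial>lborel) \<le> 1"
      show "(\<integral>\<^sup>+w. ennreal (norm (fourier_L1 J f w) powr q) \<partial>lborel) \<le> ennreal (4 * B * (2 * 1) powr (q - 2))"
      proof (rule real_interpolation[where T = "fourier_L1 J", OF p(1) p2 q_def _ _ _ _ _ _ f])
        show "(\<integral>\<^sup>+w. ennreal ((norm (fourier_L1 J f w))\<^sup>2) \<partial>lborel) \<le> ennreal B * (\<integral>\<^sup>+t. ennreal ((norm (f t))\<^sup>2) \<partial>lborel)"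
          if "integrable lborel f" for f :: "real \<Rightarrow> 'n clifford"
          unfolding B_def by (rule fourier_L1_Plancherel[OF J that])
      qed (auto simp: B_def fourier_L1_add[OF J] norm_fourier_L1_le[OF J] meas)
    qed (simp add: B_def)
  qed
  then obtain C where C: "0 \<le> C" "\<And>f :: real \<Rightarrow> 'n clifford. integrable lborel f \<Longrightarrow> (\<integral>\<^sup>+v. ennreal (norm (f v) powr p) \<partial>lborel) \<le> 1 \<Longrightarrow>
      (\<integral>\<^sup>+w. ennreal (norm (fourier_L1 J f w) powr q) \<partial>lborel) \<le> ennreal C" by blast
  show thesis
  proof (rule that[OF C(1)])
    fix f :: "real \<Rightarrow> 'n clifford" and \<eta> :: real
    assume f: "integrable lborel f" and \<eta>: "0 < \<eta>" and le: "(\<integral>\<^sup>+v. ennreal (norm (f v) powr p) \<partial>lborel) \<le> ennreal (\<eta> powr p)"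
    have [measurable]: "f \<in> borel_measurable borel" using f by simp
    have [measurable]: "fourier_L1 J f \<in> borel_measurable borel" by (rule meas[OF f])
    have scale: "(\<integral>\<^sup>+v. ennreal (norm ((1 / \<eta>) *\<^sub>R h v) powr r) \<partial>lborel) = ennreal (1 / \<eta> powr r) * (\<integral>\<^sup>+v. ennreal (norm (h v) powr r) \<partial>lborel)"
      if [measurable]: "h \<in> borel_measurable borel" for h :: "real \<Rightarrow> 'n clifford" and r
      using \<eta> by (subst nn_integral_cmult[symmetric]) (auto simp: powr_divide ennreal_mult[symmetric] powr_mult)
    have "(\<integral>\<^sup>+v. ennreal (norm ((1 / \<eta>) *\<^sub>R f v) powr p) \<partial>lborel) \<le> ennreal (1 / \<eta> powr p) * ennreal (\<eta> powr p)"
      unfolding scale[OF \<open>f \<in> borel_measurable borel\<close>] by (intro mult_left_mono le) simp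
    also have "\<dots> = 1" using \<eta> by (simp add: ennreal_mult[symmetric])
    finally have "(\<integral>\<^sup>+w. ennreal (norm (fourier_L1 J (\<lambda>v. (1 / \<eta>) *\<^sub>R f v) w) powr q) \<partial>lborel) \<le> ennreal C"
      using f by (intro C(2)) auto
    then have "ennreal (1 / \<eta> powr q) * (\<integral>\<^sup>+w. ennreal (norm (fourier_L1 J f w) powr q) \<partial>lborel) \<le> ennreal C"
      by (simp only: fourier_L1_scaleR[OF J \<open>f \<in> borel_measurable borel\<close>] scale[OF \<open>fourier_L1 J f \<in> borel_measurable borel\<close>])
    then have "ennreal (\<eta> powr q) * (ennreal (1 / \<eta> powr q) * (\<integral>\<^sup>+w. ennreal (norm (fourier_L1 J f w) powr q) \<partial>lborel)) \<le> ennreal (\<eta> powr q) * ennreal C"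
      by (intro mult_left_mono) auto
    moreover have "ennreal (\<eta> powr q) * (ennreal (1 / \<eta> powr q) * X) = X" for X
      using \<eta> by (simp add: mult.assoc[symmetric] ennreal_mult[symmetric])
    ultimately show "(\<integral>\<^sup>+w. ennreal (norm (fourier_L1 J f w) powr (p / (p - 1))) \<partial>lborel) \<le> ennreal (C * \<eta> powr (p / (p - 1)))"
      unfolding q_def[symmetric] using C(1) by (simp add: ennreal_mult[symmetric] mult.commute)
  qed
qed

section \<open>The Fourier transform on L^p, extended from L^1 \<inter> L^p\<close>

definition Lp_energy :: "real \<Rightarrow> (real \<Rightarrow> 'n::finite clifford) \<Rightarrow> ennreal" where
  "Lp_energy p f = (\<integral>\<^sup>+v. ennreal (norm (f v) powr p) \<partial>lebesgue)"

lemma Lp_fun_iff: "f \<in> Lp_fun p \<longleftrightarrow> f \<in> borel_measurable lebesgue \<and> Lp_energy p f < \<infinity>"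
  unfolding Lp_fun_def Lp_energy_def by (auto simp: integrable_iff_bounded)

lemma Lp_tendsto_iff: "Lp_tendsto p G g \<longleftrightarrow> (\<lambda>k. Lp_energy p (\<lambda>v. G k v - g v)) \<longlonglongrightarrow> 0"
  by (simp add: Lp_tendsto_def Lp_energy_def)

lemma Lp_energy_minus_commute: "Lp_energy p (\<lambda>v. f v - g v) = Lp_energy p (\<lambda>v. g v - f v)"
  by (simp add: Lp_energy_def norm_minus_commute)

lemma Lp_energy_add_le:
  assumes "0 \<le> p" "f \<in> borel_measurable lebesgue" "g \<in> borel_measurable lebesgue"
  shows "Lp_energy p (\<lambda>v. f v + g v) \<le> ennreal (2 powr p) * (Lp_energy p f + Lp_energy p g)"
  unfolding Lp_energy_def by (rule nn_integral_powr_norm_add_le[OF assms])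

text \<open>Powers of norms are compared without taking roots; the resulting factor 2^p is harmless
  in limits.\<close>

lemma Lp_energy_triangle:
  assumes "0 \<le> p" "f \<in> borel_measurable lebesgue" "g \<in> borel_measurable lebesgue" "h \<in> borel_measurable lebesgue"
  shows "Lp_energy p (\<lambda>v. f v - h v) \<le> ennreal (2 powr p) * (Lp_energy p (\<lambda>v. f v - g v) + Lp_energy p (\<lambda>v. g v - h v))"
  using Lp_energy_add_le[OF assms(1), of "\<lambda>v. f v - g v" "\<lambda>v. g v - h v"] assms by simp

lemma Lp_fun_diff:
  assumes "0 \<le> p" "f \<in> Lp_fun p" "g \<in> Lp_fun p"
  shows "(\<lambda>v. f v - g v) \<in> Lp_fun p"
proof -
  have "Lp_energy p (\<lambda>v. f v + - g v) \<le> ennreal (2 powr p) * (Lp_energy p f + Lp_energy p (\<lambda>v. - g v))"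
    using assms by (intro Lp_energy_add_le) (auto simp: Lp_fun_iff)
  moreover have "Lp_energy p (\<lambda>v. - g v) = Lp_energy p g" by (simp add: Lp_energy_def)
  ultimately show ?thesis
    using assms by (auto simp: Lp_fun_iff ennreal_mult_less_top intro: le_less_trans)
qed

lemma Lp_fun_1_integrable: "f \<in> Lp_fun 1 \<Longrightarrow> integrable lebesgue f"
  by (auto simp: Lp_fun_iff Lp_energy_def integrable_iff_bounded)

lemma measurable_ennreal_norm_powr:
  fixes f :: "'a \<Rightarrow> 'b::{banach, second_countable_topology}"
  assumes [measurable]: "f \<in> borel_measurable M"
  shows "(\<lambda>v. ennreal (norm (f v) powr p)) \<in> borel_measurable M"
  by measurable

lemma le_one_plus_powr:
  fixes a :: real
  assumes "0 \<le> a" "1 \<le> p"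
  shows "a \<le> 1 + a powr p"
  using powr_mono[of 1 p a] assms by (cases "1 \<le> a") (auto simp: add_increasing2)

text \<open>On a bounded interval |g| <= 1 + |g|^p is integrable, and the truncations converge by
  domination. They show that L^1 \<inter> L^p is dense and provide one explicit sequence from which
  the transform is built.\<close>

lemma Lp_fun_truncate:
  assumes p: "1 \<le> p" and g: "g \<in> Lp_fun p"
  shows "(\<lambda>v. indicator {- real k..real k} v *\<^sub>R g v) \<in> Lp_fun 1 \<inter> Lp_fun p"
    and "Lp_tendsto p (\<lambda>k v. indicator {- real k..real k} v *\<^sub>R g v) g"
proof -
  have gm: "g \<in> borel_measurable lebesgue" and fin: "Lp_energy p g < \<infinity>" using g by (auto simp: Lp_fun_iff)
  have meas: "(\<lambda>v. indicator {- real k..real k} v *\<^sub>R g v) \<in> borel_measurable lebesgue" for k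
    by (intro borel_measurable_scaleR gm borel_measurable_indicator) simp
  have "Lp_energy 1 (\<lambda>v. indicator {- real k..real k} v *\<^sub>R g v) \<le>
      (\<integral>\<^sup>+v. indicator {- real k..real k} v + ennreal (norm (g v) powr p) \<partial>lebesgue)"
    unfolding Lp_energy_def
  proof (rule nn_integral_mono)
    fix v
    have "ennreal (norm (g v)) \<le> 1 + ennreal (norm (g v) powr p)"
      using ennreal_leI[OF le_one_plus_powr[OF norm_ge_zero p]] by simp
    then show "ennreal (norm (indicator {- real k..real k} v *\<^sub>R g v) powr 1) \<le> indicator {- real k..real k} v + ennreal (norm (g v) powr p)"
      by (auto simp: indicator_def)
  qed
  also have "\<dots> = ennreal (2 * real k) + Lp_energy p g"
    unfolding Lp_energy_def
    by (subst nn_integral_add, intro borel_measurable_indicator, simp, rule measurable_ennreal_norm_powr[OF gm]) simp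
  also have "\<dots> < \<infinity>" using fin by simp
  finally have 1: "Lp_energy 1 (\<lambda>v. indicator {- real k..real k} v *\<^sub>R g v) < \<infinity>" .
  have "Lp_energy p (\<lambda>v. indicator {- real k..real k} v *\<^sub>R g v) \<le> Lp_energy p g"
    unfolding Lp_energy_def by (intro nn_integral_mono) (auto simp: indicator_def)
  then have 2: "Lp_energy p (\<lambda>v. indicator {- real k..real k} v *\<^sub>R g v) < \<infinity>" using fin by (rule le_less_trans)
  show "(\<lambda>v. indicator {- real k..real k} v *\<^sub>R g v) \<in> Lp_fun 1 \<inter> Lp_fun p"
    using 1 2 meas by (simp add: Lp_fun_iff)
  have "(\<lambda>k. \<integral>\<^sup>+v. ennreal (norm (indicator {- real k..real k} v *\<^sub>R g v - g v) powr p) \<partial>lebesgue) \<longlonglongrightarrow> (\<integral>\<^sup>+v. 0 \<partial>(lebesgue :: real measure))"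
  proof (rule nn_integral_dominated_convergence[where w = "\<lambda>v. ennreal (norm (g v) powr p)"])
    show "AE v in lebesgue. ennreal (norm (indicator {- real k..real k} v *\<^sub>R g v - g v) powr p) \<le> ennreal (norm (g v) powr p)" for k
      by (intro AE_I2) (auto simp: indicator_def)
    show "(\<integral>\<^sup>+v. ennreal (norm (g v) powr p) \<partial>lebesgue) < \<infinity>" using fin by (simp add: Lp_energy_def)
    show "AE v in lebesgue. (\<lambda>k. ennreal (norm (indicator {- real k..real k} v *\<^sub>R g v - g v) powr p)) \<longlonglongrightarrow> 0"
    proof (intro AE_I2 tendsto_eventually)
      fix v :: real
      have "eventually (\<lambda>k. \<bar>v\<bar> \<le> real k) sequentially"
        using filterlim_real_sequentially by (auto simp: filterlim_at_top)
      then show "eventually (\<lambda>k. ennreal (norm (indicator {- real k..real k} v *\<^sub>R g v - g v) powr p) = 0) sequentially"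
        by eventually_elim (auto simp: indicator_def abs_le_iff)
    qed
  qed (intro measurable_ennreal_norm_powr borel_measurable_diff meas gm borel_measurable_const)+
  then show "Lp_tendsto p (\<lambda>k v. indicator {- real k..real k} v *\<^sub>R g v) g"
    by (simp add: Lp_tendsto_def)
qed

lemma measurable_lebesgue_fourier_L1:
  assumes J: "(J :: 'n::{finite,linorder} clifford) \<in> imag_sphere" and f: "f \<in> borel_measurable lebesgue"
  shows "fourier_L1 J f \<in> borel_measurable borel"
proof -
  obtain f' where f': "f' \<in> borel_measurable borel" "AE v in lebesgue. f v = f' v"
    by (rule lebesgue_ex_borel[OF f])
  have "fourier_L1 J f = fourier_L1 J f'"
    using f' f by (intro fourier_L1_cong_AE[OF J]) (auto intro: measurable_completion)
  then show ?thesis using measurable_fourier_L1[OF J f'(1)] by simp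
qed

lemma fourier_L1_diff:
  assumes J: "(J :: 'n::{finite,linorder} clifford) \<in> imag_sphere" and f: "f \<in> Lp_fun 1" and g: "g \<in> Lp_fun 1"
  shows "fourier_L1 J (\<lambda>v. f v - g v) w = fourier_L1 J f w - fourier_L1 J g w"
proof -
  have [measurable]: "(\<lambda>v. cis (-(v * w))) \<in> borel_measurable lebesgue"
    by (intro measurable_completion) measurable
  have "integrable lebesgue (\<lambda>v. of_slice J (cis (-(v * w))) * h v)" if "h \<in> Lp_fun 1" for h
    by (rule integrable_of_slice_mult[OF J _ _ Lp_fun_1_integrable[OF that]]) auto
  then show ?thesis using f g
    by (simp add: fourier_L1_def clifford_exp_imaginary[OF J] right_diff_distrib scaleR_diff_right)
qed

lemma Hausdorff_Young:
  assumes J: "(J :: 'n::{finite,linorder} clifford) \<in> imag_sphere" and p: "1 < p" "p \<le> 2"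
  obtains C where "0 \<le> C" "\<And>(f :: real \<Rightarrow> 'n clifford) \<eta>. f \<in> Lp_fun 1 \<inter> Lp_fun p \<Longrightarrow> 0 < \<eta> \<Longrightarrow> Lp_energy p f \<le> ennreal (\<eta> powr p) \<Longrightarrow>
      Lp_energy (p / (p - 1)) (fourier_L1 J f) \<le> ennreal (C * \<eta> powr (p / (p - 1)))"
proof -
  obtain C where C: "0 \<le> C" "\<And>(f :: real \<Rightarrow> 'n clifford) \<eta>. integrable lborel f \<Longrightarrow> 0 < \<eta> \<Longrightarrow>
      (\<integral>\<^sup>+v. ennreal (norm (f v) powr p) \<partial>lborel) \<le> ennreal (\<eta> powr p) \<Longrightarrow>
      (\<integral>\<^sup>+w. ennreal (norm (fourier_L1 J f w) powr (p / (p - 1))) \<partial>lborel) \<le> ennreal (C * \<eta> powr (p / (p - 1)))"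
    using Hausdorff_Young_borel[OF J p] by metis
  show thesis
  proof (rule that[OF C(1)])
    fix f :: "real \<Rightarrow> 'n clifford" and \<eta> :: real assume f: "f \<in> Lp_fun 1 \<inter> Lp_fun p" and \<eta>: "0 < \<eta>" and le: "Lp_energy p f \<le> ennreal (\<eta> powr p)"
    have meas: "f \<in> borel_measurable lebesgue" using f by (simp add: Lp_fun_iff)
    obtain f' where f': "f' \<in> borel_measurable borel" "AE v in lebesgue. f v = f' v"
      by (rule lebesgue_ex_borel[OF meas])
    have eq: "fourier_L1 J f = fourier_L1 J f'"
      using f' meas by (intro fourier_L1_cong_AE[OF J]) (auto intro: measurable_completion)
    have "integrable lebesgue f'"
      using f' f by (intro integrable_cong_AE_imp[OF Lp_fun_1_integrable[of f]]) (auto intro: measurable_completion)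
    then have int: "integrable lborel f'" using f' by (simp add: integrable_completion)
    have "(\<integral>\<^sup>+v. ennreal (norm (f' v) powr p) \<partial>lborel) = (\<integral>\<^sup>+v. ennreal (norm (f' v) powr p) \<partial>lebesgue)"
      by (rule nn_integral_completion[symmetric])
    also have "\<dots> = Lp_energy p f"
      unfolding Lp_energy_def by (intro nn_integral_cong_AE) (use f'(2) in eventually_elim, simp)
    finally have "(\<integral>\<^sup>+v. ennreal (norm (f' v) powr p) \<partial>lborel) = Lp_energy p f" .
    then show "Lp_energy (p / (p - 1)) (fourier_L1 J f) \<le> ennreal (C * \<eta> powr (p / (p - 1)))"
      using C(2)[OF int \<eta>] le by (simp add: eq Lp_energy_def nn_integral_completion)
  qed
qed

lemma fourier_L1_Lp_fun:
  assumes J: "(J :: 'n::{finite,linorder} clifford) \<in> imag_sphere" and p: "1 < p" "p \<le> 2" and f: "f \<in> Lp_fun 1 \<inter> Lp_fun p"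
  shows "fourier_L1 J f \<in> Lp_fun (p / (p - 1))"
proof -
  obtain C where C: "0 \<le> C" "\<And>(f :: real \<Rightarrow> 'n clifford) \<eta>. f \<in> Lp_fun 1 \<inter> Lp_fun p \<Longrightarrow> 0 < \<eta> \<Longrightarrow> Lp_energy p f \<le> ennreal (\<eta> powr p) \<Longrightarrow>
      Lp_energy (p / (p - 1)) (fourier_L1 J f) \<le> ennreal (C * \<eta> powr (p / (p - 1)))"
    using Hausdorff_Young[OF J p] by metis
  obtain r where r: "Lp_energy p f = ennreal r" "0 \<le> r"
    using f by (cases "Lp_energy p f") (auto simp: Lp_fun_iff)
  \<comment> \<open>The summand 1 keeps \<eta> positive when f has energy 0.\<close>
  define \<eta> where "\<eta> = (r + 1) powr (1 / p)"
  have "Lp_energy p f \<le> ennreal (\<eta> powr p)"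
    using r p by (auto simp: \<eta>_def powr_powr intro!: ennreal_leI)
  then have "Lp_energy (p / (p - 1)) (fourier_L1 J f) < \<infinity>"
    using C(2)[OF f, of \<eta>] r by (auto simp: \<eta>_def intro: le_less_trans)
  moreover have "fourier_L1 J f \<in> borel_measurable lebesgue"
    using f by (intro measurable_completion) (simp add: measurable_lebesgue_fourier_L1[OF J] Lp_fun_iff)
  ultimately show ?thesis by (simp add: Lp_fun_iff)
qed

lemma fourier_L1_continuous:
  assumes J: "(J :: 'n::{finite,linorder} clifford) \<in> imag_sphere" and p: "1 < p" "p \<le> 2" and e: "0 < e"
  obtains d where "0 < d" "\<And>f :: real \<Rightarrow> 'n clifford. f \<in> Lp_fun 1 \<inter> Lp_fun p \<Longrightarrow> Lp_energy p f \<le> ennreal d \<Longrightarrow>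
      Lp_energy (p / (p - 1)) (fourier_L1 J f) \<le> ennreal e"
proof -
  obtain C where C: "0 \<le> C" "\<And>(f :: real \<Rightarrow> 'n clifford) \<eta>. f \<in> Lp_fun 1 \<inter> Lp_fun p \<Longrightarrow> 0 < \<eta> \<Longrightarrow> Lp_energy p f \<le> ennreal (\<eta> powr p) \<Longrightarrow>
      Lp_energy (p / (p - 1)) (fourier_L1 J f) \<le> ennreal (C * \<eta> powr (p / (p - 1)))"
    using Hausdorff_Young[OF J p] by metis
  \<comment> \<open>Chosen so that (C + 1) \<eta>^q = e for the conjugate exponent q; C + 1 instead
    of C allows C = 0.\<close>
  define \<eta> where "\<eta> = (e / (C + 1)) powr ((p - 1) / p)"
  have \<eta>: "0 < \<eta>" using e C(1) by (simp add: \<eta>_def)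
  have "\<eta> powr (p / (p - 1)) = e / (C + 1)"
    using p e C(1) by (simp add: \<eta>_def powr_powr)
  then have "(C + 1) * \<eta> powr (p / (p - 1)) = e" using C(1) by simp
  then have "C * \<eta> powr (p / (p - 1)) \<le> e"
    using powr_ge_zero[of \<eta> "p / (p - 1)"] unfolding distrib_right by linarith
  show thesis
  proof (rule that[of "\<eta> powr p"])
    fix f :: "real \<Rightarrow> 'n clifford" assume "f \<in> Lp_fun 1 \<inter> Lp_fun p" "Lp_energy p f \<le> ennreal (\<eta> powr p)"
    from C(2)[OF this(1) \<eta> this(2)] show "Lp_energy (p / (p - 1)) (fourier_L1 J f) \<le> ennreal e"
      using ennreal_leI[OF \<open>C * \<eta> powr (p / (p - 1)) \<le> e\<close>] by (rule order_trans)
  qed (use \<eta> in simp)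
qed

lemma tendsto_ennreal_cmult_add_0:
  fixes a b :: "'a \<Rightarrow> ennreal"
  assumes "(a \<longlongrightarrow> 0) F" "(b \<longlongrightarrow> 0) F"
  shows "((\<lambda>x. ennreal c * (a x + b x)) \<longlongrightarrow> 0) F"
proof -
  have "((\<lambda>x. ennreal c * (a x + b x)) \<longlongrightarrow> ennreal c * (0 + 0)) F"
    using assms by (intro ennreal_tendsto_cmult tendsto_add) auto
  then show ?thesis by simp
qed

lemma tendsto_0_ennreal_le:
  fixes a b :: "'a \<Rightarrow> ennreal"
  assumes "(b \<longlongrightarrow> 0) F" "\<And>x. a x \<le> b x"
  shows "(a \<longlongrightarrow> 0) F"
  by (rule tendsto_sandwich[OF _ _ tendsto_const assms(1)]) (auto intro: assms(2) always_eventually)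

lemma Lp_tendsto_diff_0:
  assumes p: "0 \<le> p" and "Lp_tendsto p G g" "Lp_tendsto p H g"
    and "g \<in> borel_measurable lebesgue" "\<And>k. G k \<in> borel_measurable lebesgue" "\<And>k. H k \<in> borel_measurable lebesgue"
  shows "(\<lambda>k. Lp_energy p (\<lambda>v. G k v - H k v)) \<longlonglongrightarrow> 0"
proof (rule tendsto_0_ennreal_le)
  show "(\<lambda>k. ennreal (2 powr p) * (Lp_energy p (\<lambda>v. G k v - g v) + Lp_energy p (\<lambda>v. g v - H k v))) \<longlonglongrightarrow> 0"
    using assms(2,3) by (intro tendsto_ennreal_cmult_add_0) (simp_all add: Lp_tendsto_iff Lp_energy_minus_commute[of p g])
  show "Lp_energy p (\<lambda>v. G k v - H k v) \<le> ennreal (2 powr p) * (Lp_energy p (\<lambda>v. G k v - g v) + Lp_energy p (\<lambda>v. g v - H k v))" for k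
    by (rule Lp_energy_triangle) (use assms in auto)
qed

text \<open>By linearity and continuity the transforms of the truncations form a Cauchy sequence,
  whose limit is h. Any other admissible sequence differs from the truncations by a null sequence in
  L^p, so its transforms have the same limit. Thus the choice in \<open>fourier\<close> does select
  a function with the stated property.\<close>

lemma fourier_extension:
  assumes J: "(J :: 'n::{finite,linorder} clifford) \<in> imag_sphere" and p: "1 < p" "p \<le> 2" and g: "g \<in> Lp_fun p"
  shows "\<exists>h. h \<in> Lp_fun (p / (p - 1)) \<and>
        (\<forall>G. (\<forall>k. G k \<in> Lp_fun 1 \<inter> Lp_fun p) \<and> Lp_tendsto p G g \<longrightarrow>
             Lp_tendsto (p / (p - 1)) (\<lambda>k. fourier_L1 J (G k)) h)"
proof -
  define q where "q = p / (p - 1)"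
  have q: "0 < q" using p by (simp add: q_def)
  have gm: "g \<in> borel_measurable lebesgue" using g by (simp add: Lp_fun_iff)
  define G where "G = (\<lambda>k v. indicator {- real k..real k} v *\<^sub>R g v)"
  have G: "G k \<in> Lp_fun 1 \<inter> Lp_fun p" for k
    unfolding G_def by (rule Lp_fun_truncate(1)[OF _ g]) (use p in simp)
  have Gg: "Lp_tendsto p G g"
    unfolding G_def by (rule Lp_fun_truncate(2)[OF _ g]) (use p in simp)
  have Gm: "G k \<in> borel_measurable lebesgue" for k using G[of k] by (simp add: Lp_fun_iff)
  have TG: "fourier_L1 J (G k) \<in> borel_measurable lebesgue" for k
    using fourier_L1_Lp_fun[OF J p G[of k]] by (simp add: Lp_fun_iff)
  have D: "(\<lambda>v. f1 v - f2 v) \<in> Lp_fun 1 \<inter> Lp_fun p" if "f1 \<in> Lp_fun 1 \<inter> Lp_fun p" "f2 \<in> Lp_fun 1 \<inter> Lp_fun p" for f1 f2 :: "real \<Rightarrow> 'n clifford"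
    using that p by (auto intro: Lp_fun_diff)
  have T_diff: "(\<lambda>w. fourier_L1 J f1 w - fourier_L1 J f2 w) = fourier_L1 J (\<lambda>v. f1 v - f2 v)"
    if "f1 \<in> Lp_fun 1 \<inter> Lp_fun p" "f2 \<in> Lp_fun 1 \<inter> Lp_fun p" for f1 f2
    using that by (intro ext) (simp add: fourier_L1_diff[OF J])
  have Cauchy: "\<exists>N. \<forall>j\<ge>N. \<forall>k\<ge>N. (\<integral>\<^sup>+w. ennreal (norm (fourier_L1 J (G j) w - fourier_L1 J (G k) w) powr q) \<partial>lebesgue) \<le> ennreal e"
    if e: "0 < e" for e :: real
  proof -
    obtain d where d: "0 < d" "\<And>f :: real \<Rightarrow> 'n clifford. f \<in> Lp_fun 1 \<inter> Lp_fun p \<Longrightarrow> Lp_energy p f \<le> ennreal d \<Longrightarrow> Lp_energy q (fourier_L1 J f) \<le> ennreal e"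
      unfolding q_def using fourier_L1_continuous[OF J p e] by metis
    \<comment> \<open>Two errors below c, multiplied by the factor 2^p of the triangle inequality,
      add up to d.\<close>
    define c where "c = d / (2 * 2 powr p)"
    have c: "0 < c" using d by (simp add: c_def)
    have "eventually (\<lambda>k. Lp_energy p (\<lambda>v. G k v - g v) < ennreal c) sequentially"
      using Gg c unfolding Lp_tendsto_iff by (intro order_tendstoD(2)) auto
    then obtain N where N: "\<And>k. N \<le> k \<Longrightarrow> Lp_energy p (\<lambda>v. G k v - g v) < ennreal c"
      unfolding eventually_sequentially by blast
    have "Lp_energy q (\<lambda>w. fourier_L1 J (G j) w - fourier_L1 J (G k) w) \<le> ennreal e" if "N \<le> j" "N \<le> k" for j k
      unfolding T_diff[OF G G]
    proof (rule d(2)[OF D[OF G G]])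
      have "Lp_energy p (\<lambda>v. G j v - G k v) \<le> ennreal (2 powr p) * (Lp_energy p (\<lambda>v. G j v - g v) + Lp_energy p (\<lambda>v. g v - G k v))"
        using p by (intro Lp_energy_triangle Gm gm) auto
      also have "\<dots> \<le> ennreal (2 powr p) * (ennreal c + ennreal c)"
        using N[OF that(1)] N[OF that(2)] by (intro mult_left_mono add_mono) (auto simp: Lp_energy_minus_commute[of p g])
      also have "\<dots> = ennreal (2 powr p * (c + c))"
        using c by (simp only: ennreal_mult ennreal_plus less_imp_le powr_ge_zero add_nonneg_nonneg)
      also have "2 powr p * (c + c) = d" by (simp add: c_def)
      finally show "Lp_energy p (\<lambda>v. G j v - G k v) \<le> ennreal d" .
    qed
    then show ?thesis unfolding Lp_energy_def by blast
  qed
  obtain h where hm: "h \<in> borel_measurable lebesgue" and h: "(\<lambda>k. \<integral>\<^sup>+w. ennreal (norm (fourier_L1 J (G k) w - h w) powr q) \<partial>lebesgue) \<longlonglongrightarrow> 0"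
    by (rule Lq_complete[OF q TG Cauchy])
  have hG: "Lp_tendsto q (\<lambda>k. fourier_L1 J (G k)) h" using h by (simp add: Lp_tendsto_def)
  have "h \<in> Lp_fun q"
  proof -
    have "eventually (\<lambda>k. Lp_energy q (\<lambda>w. fourier_L1 J (G k) w - h w) < 1) sequentially"
      using hG unfolding Lp_tendsto_iff by (intro order_tendstoD(2)) auto
    then obtain k where k: "Lp_energy q (\<lambda>w. fourier_L1 J (G k) w - h w) < 1"
      unfolding eventually_sequentially by blast
    have "(\<lambda>w. fourier_L1 J (G k) w - h w) \<in> Lp_fun q"
      using k TG hm by (auto simp: Lp_fun_iff intro: less_trans)
    from Lp_fun_diff[OF less_imp_le[OF q] fourier_L1_Lp_fun[OF J p G[of k], folded q_def] this] show ?thesis by simp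
  qed
  moreover have "Lp_tendsto q (\<lambda>k. fourier_L1 J (G' k)) h" if G': "\<And>k. G' k \<in> Lp_fun 1 \<inter> Lp_fun p" and G'g: "Lp_tendsto p G' g" for G'
  proof -
    have G'm: "G' k \<in> borel_measurable lebesgue" for k using G'[of k] by (simp add: Lp_fun_iff)
    have TG': "fourier_L1 J (G' k) \<in> borel_measurable lebesgue" for k
      using fourier_L1_Lp_fun[OF J p G'[of k]] by (simp add: Lp_fun_iff)
    have lim: "(\<lambda>k. Lp_energy p (\<lambda>v. G' k v - G k v)) \<longlonglongrightarrow> 0"
      using p by (intro Lp_tendsto_diff_0[OF _ G'g Gg] gm G'm Gm) simp
    have "(\<lambda>k. Lp_energy q (\<lambda>w. fourier_L1 J (G' k) w - fourier_L1 J (G k) w)) \<longlonglongrightarrow> 0"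
    proof (rule tendsto_0_ennrealI)
      fix e :: real assume e: "0 < e"
      obtain d where d: "0 < d" "\<And>f :: real \<Rightarrow> 'n clifford. f \<in> Lp_fun 1 \<inter> Lp_fun p \<Longrightarrow> Lp_energy p f \<le> ennreal d \<Longrightarrow> Lp_energy q (fourier_L1 J f) \<le> ennreal e"
        unfolding q_def using fourier_L1_continuous[OF J p e] by metis
      have "eventually (\<lambda>k. Lp_energy p (\<lambda>v. G' k v - G k v) < ennreal d) sequentially"
        using lim d(1) by (intro order_tendstoD(2)) auto
      then show "eventually (\<lambda>k. Lp_energy q (\<lambda>w. fourier_L1 J (G' k) w - fourier_L1 J (G k) w) \<le> ennreal e) sequentially"
        by eventually_elim (simp only: T_diff[OF G' G], intro d(2) D G' G less_imp_le)
    qed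
    moreover have "(\<lambda>k. Lp_energy q (\<lambda>w. fourier_L1 J (G k) w - h w)) \<longlonglongrightarrow> 0"
      using hG by (simp add: Lp_tendsto_iff)
    ultimately have "(\<lambda>k. ennreal (2 powr q) * (Lp_energy q (\<lambda>w. fourier_L1 J (G' k) w - fourier_L1 J (G k) w) + Lp_energy q (\<lambda>w. fourier_L1 J (G k) w - h w))) \<longlonglongrightarrow> 0"
      by (rule tendsto_ennreal_cmult_add_0)
    then show ?thesis unfolding Lp_tendsto_iff
      by (rule tendsto_0_ennreal_le) (intro Lp_energy_triangle TG TG' hm, use q in simp)
  qed
  ultimately show ?thesis unfolding q_def by blast
qed

lemma
  assumes J: "(J :: 'n::{finite,linorder} clifford) \<in> imag_sphere" and p: "1 < p" "p \<le> 2" and g: "g \<in> Lp_fun p"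
  shows fourier_Lp_fun: "fourier p J g \<in> Lp_fun (p / (p - 1))"
    and Lp_tendsto_fourier: "(\<And>k. G k \<in> Lp_fun 1 \<inter> Lp_fun p) \<Longrightarrow> Lp_tendsto p G g \<Longrightarrow>
             Lp_tendsto (p / (p - 1)) (\<lambda>k. fourier_L1 J (G k)) (fourier p J g)"
proof -
  have "fourier p J g = (SOME h. h \<in> Lp_fun (p / (p - 1)) \<and>
        (\<forall>G. (\<forall>k. G k \<in> Lp_fun 1 \<inter> Lp_fun p) \<and> Lp_tendsto p G g \<longrightarrow>
             Lp_tendsto (p / (p - 1)) (\<lambda>k. fourier_L1 J (G k)) h))"
    using p by (simp add: fourier_def)
  with someI_ex[OF fourier_extension[OF assms]]
  show "fourier p J g \<in> Lp_fun (p / (p - 1))"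
    "(\<And>k. G k \<in> Lp_fun 1 \<inter> Lp_fun p) \<Longrightarrow> Lp_tendsto p G g \<Longrightarrow>
             Lp_tendsto (p / (p - 1)) (\<lambda>k. fourier_L1 J (G k)) (fourier p J g)"
    by simp_all
qed

section \<open>Slice monogenic functions in Hardy spaces\<close>

lemma slice_pt_eq: "slice_pt J u v = of_slice J (Complex u v)"
  by (simp add: of_slice_def)

lemma norm_of_slice:
  assumes "(J :: 'n::{finite,linorder} clifford) \<in> imag_sphere"
  shows "norm (of_slice J z) = cmod z"
proof -
  have "norm (1 :: 'n clifford) = 1" by (simp add: one_clifford_def)
  then show ?thesis using norm_of_slice_mult[OF assms, of z 1] by simp
qed

lemma of_slice_half_space: "J \<in> imag_sphere \<Longrightarrow> 0 < Re z \<Longrightarrow> of_slice J z \<in> half_space"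
  unfolding half_space_def of_slice_def by blast

text \<open>The normal ray lies in every cone, so aperture 1 suffices; its points differ from the
  vertex because \<open>of_slice J\<close> is isometric.\<close>

lemma has_nt_limit_radial:
  assumes J: "J \<in> imag_sphere" and L: "has_nt_limit f J v L"
  shows "(\<lambda>n. f (of_slice J (Complex (1 / Suc n) v))) \<longlonglongrightarrow> L"
proof -
  interpret o: bounded_linear "of_slice J" by (rule bounded_linear_of_slice)
  let ?S = "{slice_pt J s t | s t. s > 0 \<and> \<bar>t - v\<bar> < 1 * s}"
  let ?X = "\<lambda>n. of_slice J (Complex (1 / Suc n) v)"
  have lim: "(f \<longlongrightarrow> L) (at (slice_pt J 0 v) within ?S)"
    using L unfolding has_nt_limit_def by (rule allE[of _ 1]) simp
  have inS: "?X n \<in> ?S - {slice_pt J 0 v}" for n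
  proof -
    have "?X n \<in> ?S"
      unfolding slice_pt_eq by (rule CollectI, rule exI[of _ "1 / Suc n"], rule exI[of _ v]) simp
    moreover have "?X n \<noteq> slice_pt J 0 v"
    proof
      assume "?X n = slice_pt J 0 v"
      then have "norm (of_slice J (Complex (1 / Suc n) v - Complex 0 v)) = 0"
        by (simp add: slice_pt_eq o.diff)
      then have "Complex (1 / Suc n) v - Complex 0 v = 0" by (simp only: norm_of_slice[OF J] norm_eq_zero)
      then show False by (simp add: complex_eq_iff)
    qed
    ultimately show "?X n \<in> ?S - {slice_pt J 0 v}" by simp
  qed
  have "?X \<longlonglongrightarrow> slice_pt J 0 v"
  proof -
    have "(\<lambda>n. of_slice J (of_real (1 / Suc n) + \<i> * of_real v)) \<longlonglongrightarrow> of_slice J (of_real 0 + \<i> * of_real v)"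
      by (intro o.tendsto tendsto_intros LIMSEQ_Suc[OF lim_1_over_n, where ?'a1 = real])
    then show ?thesis by (simp add: slice_pt_eq Complex_eq)
  qed
  from lim[unfolded tendsto_at_iff_sequentially, rule_format, of ?X, OF inS this]
  show ?thesis by (simp add: o_def)
qed

text \<open>Two non-tangential limits agree along the normal ray, so the definite description in
  \<open>nt_limit\<close> denotes the limit whenever one exists.\<close>

lemma nt_limit_radial:
  assumes J: "J \<in> imag_sphere" and ex: "\<exists>L. has_nt_limit f J v L"
  shows "(\<lambda>n. f (of_slice J (Complex (1 / Suc n) v))) \<longlonglongrightarrow> nt_limit f J v"
proof -
  obtain L where L: "has_nt_limit f J v L" using ex by blast
  have "nt_limit f J v = L"
    unfolding nt_limit_def
    by (rule the_equality[where P = "has_nt_limit f J v" and a = L, OF L]) (rule LIMSEQ_unique[OF has_nt_limit_radial[OF J] has_nt_limit_radial[OF J L]])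
  then show ?thesis using has_nt_limit_radial[OF J L] by simp
qed

text \<open>This plays the part of the splitting lemma. The monogenic equation makes the derivative
  D of the slice restriction satisfy D \<i> = J * D 1, so D w is D 1 multiplied on the left by w in
  L_J; a slice coordinate turns that into multiplication by a complex number.\<close>

lemma slice_monogenic_coord_holomorphic:
  assumes J: "J \<in> imag_sphere" and f: "f \<in> slice_monogenic half_space"
  shows "(\<lambda>z. slice_coord J b (f (of_slice J z))) holomorphic_on {z. 0 < Re z}"
    and "continuous_on {z. 0 < Re z} (\<lambda>z. f (of_slice J z))"
proof -
  interpret b: bounded_linear "slice_coord J b" by (rule bounded_linear_slice_coord)
  have opn: "open {z. 0 < Re z}" by (rule open_halfspace_Re_gt)
  have D: "\<exists>D. ((\<lambda>z. f (of_slice J z)) has_derivative D) (at z) \<and> (\<forall>w. D w = of_slice J w * D 1)" if z: "0 < Re z" for z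
  proof -
    have "f differentiable (at (of_slice J z) within half_space)"
      using f of_slice_half_space[OF J z] by (simp add: slice_monogenic_def differentiable_on_def)
    then obtain f' where f': "(f has_derivative f') (at (of_slice J z) within half_space)"
      unfolding differentiable_def by blast
    \<comment> \<open>f is differentiable only relative to the half-space of paravectors. The slice
      embeds the half-plane into it, and as the half-plane is open in the complex plane, the
      restriction is differentiable without qualification.\<close>
    have sub: "of_slice J ` {z. 0 < Re z} \<subseteq> half_space" using of_slice_half_space[OF J] by blast
    have "((\<lambda>z. f (of_slice J z)) has_derivative (\<lambda>w. f' (of_slice J w))) (at z within {z. 0 < Re z})"
      using diff_chain_within[OF bounded_linear_imp_has_derivative[OF bounded_linear_of_slice] has_derivative_subset[OF f' sub]]
      by (simp add: o_def)
    then have der: "((\<lambda>z. f (of_slice J z)) has_derivative (\<lambda>w. f' (of_slice J w))) (at z)"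
      using at_within_open[of z, OF _ opn] z by simp
    define D where "D = (\<lambda>w. f' (of_slice J w))"
    have der: "((\<lambda>z. f (of_slice J z)) has_derivative D) (at z)" using der by (simp add: D_def)
    interpret D: bounded_linear D by (rule has_derivative_bounded_linear[OF der])
    have zC: "z = Complex (Re z) (Im z)" by simp
    have "((\<lambda>s. Complex s (Im z)) has_derivative (\<lambda>h. h *\<^sub>R 1)) (at (Re z))"
      unfolding Complex_eq by (auto intro!: derivative_eq_intros simp: scaleR_conv_of_real)
    from diff_chain_at[OF this, of "\<lambda>z. f (of_slice J z)" D] der
    have 1: "((\<lambda>s. f (slice_pt J s (Im z))) has_vector_derivative D 1) (at (Re z))"
      by (simp add: has_vector_derivative_def slice_pt_eq o_def D.scaleR)
    have "((\<lambda>t. Complex (Re z) t) has_derivative (\<lambda>h. h *\<^sub>R \<i>)) (at (Im z))"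
      unfolding Complex_eq by (auto intro!: derivative_eq_intros simp: scaleR_conv_of_real mult.commute)
    from diff_chain_at[OF this, of "\<lambda>z. f (of_slice J z)" D] der
    have 2: "((\<lambda>t. f (slice_pt J (Re z) t)) has_vector_derivative D \<i>) (at (Im z))"
      by (simp add: has_vector_derivative_def slice_pt_eq o_def D.scaleR)
    have "slice_pt J (Re z) (Im z) \<in> half_space"
      using of_slice_half_space[OF J z] by (simp add: slice_pt_eq)
    then have "(1/2) *\<^sub>R (vector_derivative (\<lambda>s. f (slice_pt J s (Im z))) (at (Re z))
                 + J * vector_derivative (\<lambda>t. f (slice_pt J (Re z) t)) (at (Im z))) = 0"
      using f J unfolding slice_monogenic_def by blast
    then have CR: "D 1 + J * D \<i> = 0"
      unfolding vector_derivative_at[OF 1] vector_derivative_at[OF 2] by simp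
    have Di: "D \<i> = J * D 1"
    proof -
      have "J * (D 1 + J * D \<i>) = 0" using CR by simp
      then have "J * D 1 - D \<i> = 0"
        by (simp add: distrib_left mult.assoc[symmetric] imag_sphere_square[OF J])
      then show ?thesis by simp
    qed
    have "D w = of_slice J w * D 1" for w
    proof -
      have "w = Re w *\<^sub>R 1 + Im w *\<^sub>R \<i>" by (simp add: complex_eq_iff)
      then have "D w = Re w *\<^sub>R D 1 + Im w *\<^sub>R D \<i>" by (metis D.add D.scaleR)
      then show ?thesis by (simp add: of_slice_mult_eq Di)
    qed
    then show ?thesis using der by blast
  qed
  have "((\<lambda>z. slice_coord J b (f (of_slice J z))) has_field_derivative slice_coord J b (D 1)) (at z)"
    if "((\<lambda>z. f (of_slice J z)) has_derivative D) (at z)" "\<forall>w. D w = of_slice J w * D 1" for D z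
  proof -
    have "((\<lambda>z. slice_coord J b (f (of_slice J z))) has_derivative (\<lambda>w. slice_coord J b (D w))) (at z)"
      by (rule b.has_derivative[OF that(1)])
    moreover have "(\<lambda>w. slice_coord J b (D w)) = (*) (slice_coord J b (D 1))"
      by (rule ext, subst that(2)[rule_format]) (simp only: slice_coord_of_slice_mult[OF J] mult.commute)
    ultimately show ?thesis by (simp add: has_field_derivative_def)
  qed
  then show "(\<lambda>z. slice_coord J b (f (of_slice J z))) holomorphic_on {z. 0 < Re z}"
    unfolding holomorphic_on_open[OF opn] using D by blast
  show "continuous_on {z. 0 < Re z} (\<lambda>z. f (of_slice J z))"
    using D by (intro continuous_at_imp_continuous_on) (blast intro: has_derivative_continuous)
qed

text \<open>
  The weight \<open>r\<close> brings \<open>f\<close> into \<open>H\<^sup>1\<close> of the slice; it is \<open>1\<close> for \<open>p = 1\<close>.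
\<close>

locale slice_hardy =
  fixes J :: "'n::{finite,linorder} clifford" and f :: "'n clifford \<Rightarrow> 'n clifford" and g :: "real \<Rightarrow> 'n clifford"
    and r :: "complex \<Rightarrow> complex" and r0 :: "real \<Rightarrow> complex" and M :: real
  assumes J: "J \<in> imag_sphere" and f: "f \<in> slice_monogenic half_space"
    and g [measurable]: "g \<in> borel_measurable borel"
    and lim: "AE v in lborel. (\<lambda>n. f (of_slice J (Complex (1 / Suc n) v))) \<longlonglongrightarrow> g v"
    and r_hol: "r holomorphic_on {z. 0 < Re z}"
    and r0 [measurable]: "r0 \<in> borel_measurable borel"
    and r_lim: "\<And>v. (\<lambda>n. r (Complex (1 / Suc n) v)) \<longlonglongrightarrow> r0 v"
    and M: "0 \<le> M"
    and bdd: "\<And>u. 0 < u \<Longrightarrow> (\<integral>\<^sup>+v. ennreal (cmod (r (Complex u v)) * norm (f (of_slice J (Complex u v)))) \<partial>lborel) \<le> ennreal M"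
begin

definition G :: "real \<Rightarrow> 'n clifford" where
  "G v = of_slice J (r0 v) * g v"

lemma G_measurable [measurable]: "G \<in> borel_measurable borel"
  unfolding G_def[abs_def] by measurable

text \<open>The weight can be applied before or after taking coordinates, since these are linear
  over L_J. The 2 in the constant is that of \<open>cmod_slice_coord_le\<close>.\<close>

lemma hardy1: "half_plane_hardy1 (\<lambda>z. r z * slice_coord J (blade A) (f (of_slice J z)))
    (\<lambda>v. slice_coord J (blade A) (G v)) (2 * M)"
proof
  show "(\<lambda>z. r z * slice_coord J (blade A) (f (of_slice J z))) holomorphic_on {z. 0 < Re z}"
    by (intro holomorphic_intros r_hol slice_monogenic_coord_holomorphic J f)
  show "0 \<le> 2 * M" using M by simp
  show "(\<lambda>v. slice_coord J (blade A) (G v)) \<in> borel_measurable borel" by measurable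
  show "AE v in lborel. (\<lambda>n. r (Complex (1 / Suc n) v) * slice_coord J (blade A) (f (of_slice J (Complex (1 / Suc n) v))))
      \<longlonglongrightarrow> slice_coord J (blade A) (G v)"
    using lim
    by eventually_elim
       (simp only: G_def slice_coord_of_slice_mult[OF J],
        intro tendsto_mult r_lim bounded_linear.tendsto[OF bounded_linear_slice_coord])
  fix u :: real assume u: "0 < u"
  have cont: "continuous_on UNIV (\<lambda>v. F (Complex u v))" if "continuous_on {z. 0 < Re z} F"
    for F :: "complex \<Rightarrow> 'b::{banach, second_countable_topology}"
    unfolding Complex_eq by (rule continuous_on_compose2[OF that]) (use u in \<open>auto intro!: continuous_intros\<close>)
  have [measurable]: "(\<lambda>v. r (Complex u v)) \<in> borel_measurable borel"
    by (intro borel_measurable_continuous_onI cont holomorphic_on_imp_continuous_on r_hol)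
  have [measurable]: "(\<lambda>v. f (of_slice J (Complex u v))) \<in> borel_measurable borel"
    by (intro borel_measurable_continuous_onI cont[of "\<lambda>z. f (of_slice J z)"] slice_monogenic_coord_holomorphic J f)
  have "(\<integral>\<^sup>+v. ennreal (cmod (r (Complex u v) * slice_coord J (blade A) (f (of_slice J (Complex u v))))) \<partial>lborel)
      \<le> (\<integral>\<^sup>+v. ennreal 2 * ennreal (cmod (r (Complex u v)) * norm (f (of_slice J (Complex u v)))) \<partial>lborel)"
  proof (rule nn_integral_mono)
    fix v
    have "cmod (r (Complex u v) * slice_coord J (blade A) (f (of_slice J (Complex u v)))) \<le>
        cmod (r (Complex u v)) * (2 * norm (f (of_slice J (Complex u v))))"
      unfolding norm_mult by (intro mult_left_mono cmod_slice_coord_le J) simp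
    then have "ennreal (cmod (r (Complex u v) * slice_coord J (blade A) (f (of_slice J (Complex u v))))) \<le>
        ennreal (2 * (cmod (r (Complex u v)) * norm (f (of_slice J (Complex u v)))))"
      by (intro ennreal_leI) simp
    then show "ennreal (cmod (r (Complex u v) * slice_coord J (blade A) (f (of_slice J (Complex u v))))) \<le>
        ennreal 2 * ennreal (cmod (r (Complex u v)) * norm (f (of_slice J (Complex u v))))"
      by (subst ennreal_mult[symmetric]) auto
  qed
  also have "\<dots> = ennreal 2 * (\<integral>\<^sup>+v. ennreal (cmod (r (Complex u v)) * norm (f (of_slice J (Complex u v)))) \<partial>lborel)"
    by (rule nn_integral_cmult) measurable
  also have "\<dots> \<le> ennreal 2 * ennreal M" by (intro mult_left_mono bdd u) simp
  also have "\<dots> = ennreal (2 * M)" using M by (simp add: ennreal_mult)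
  finally show "(\<integral>\<^sup>+v. ennreal (cmod (r (Complex u v) * slice_coord J (blade A) (f (of_slice J (Complex u v))))) \<partial>lborel) \<le> ennreal (2 * M)" .
qed

lemma integrable_G: "integrable lborel G"
proof (rule Bochner_Integration.integrable_bound)
  show "integrable lborel (\<lambda>v. \<Sum>A\<in>UNIV. cmod (slice_coord J (blade A) (G v)))"
    by (intro Bochner_Integration.integrable_sum integrable_norm half_plane_hardy1.integrable_g[OF hardy1])
  show "AE v in lborel. norm (G v) \<le> norm (\<Sum>A\<in>UNIV. cmod (slice_coord J (blade A) (G v)))"
    unfolding real_norm_def by (intro AE_I2 order_trans[OF norm_le_sum_slice_coord abs_ge_self])
qed simp

lemma fourier_G_vanishes:
  assumes w: "0 < w"
  shows "fourier_L1 J G w = 0"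
proof (rule slice_coord_eqI[where J = J])
  fix A
  interpret b: bounded_linear "slice_coord J (blade A)" by (rule bounded_linear_slice_coord)
  show "slice_coord J (blade A) (fourier_L1 J G w) = slice_coord J (blade A) 0"
    unfolding slice_coord_fourier_L1[OF J integrable_G] half_plane_hardy1.fourier_vanishes[OF hardy1 w]
    by (simp add: b.zero)
qed

lemma fourier_G_measurable [measurable]: "fourier_L1 J G \<in> borel_measurable borel"
  by (rule measurable_fourier_L1[OF J]) simp

lemma
  assumes z: "0 < Re z"
  shows integrable_fourier_G: "integrable lborel (\<lambda>w. indicator {..0} w *\<^sub>R (of_slice J (exp (of_real w * z)) * fourier_L1 J G w))"
    and fourier_G_representation: "of_slice J (r z) * f (of_slice J z) =
      (1 / sqrt (2 * pi)) *\<^sub>R (LBINT w. indicator {..0} w *\<^sub>R (of_slice J (exp (of_real w * z)) * fourier_L1 J G w))"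
proof -
  let ?I = "\<lambda>w. indicator {..0} w *\<^sub>R (of_slice J (exp (of_real w * z)) * fourier_L1 J G w)"
  have [measurable]: "?I \<in> borel_measurable borel" by measurable
  show int: "integrable lborel ?I"
  proof (rule Bochner_Integration.integrable_bound)
    show "integrable lborel (\<lambda>w. exp (-(Re z * \<bar>w\<bar>)) * (LBINT v. norm (G v)))"
      using integrable_exp_abs[OF z] by simp
    have "norm (?I w) \<le> exp (-(Re z * \<bar>w\<bar>)) * (LBINT v. norm (G v))" for w
      using norm_fourier_L1_le[OF J integrable_G, of w]
      by (auto simp: indicator_def norm_of_slice_mult[OF J] mult.commute)
    then show "AE w in lborel. norm (?I w) \<le> norm (exp (-(Re z * \<bar>w\<bar>)) * (LBINT v. norm (G v)))"
      by (intro AE_I2) (auto intro: order_trans)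
  qed simp
  show "of_slice J (r z) * f (of_slice J z) = (1 / sqrt (2 * pi)) *\<^sub>R (LBINT w. ?I w)"
  proof (rule slice_coord_eqI[where J = J])
    fix A
    interpret b: bounded_linear "slice_coord J (blade A)" by (rule bounded_linear_slice_coord)
    \<comment> \<open>One factor 1 / sqrt (2 pi) belongs to the transform and one to its inversion;
      together they cancel the 2 pi of the scalar representation.\<close>
    define c where "c = complex_of_real (1 / sqrt (2 * pi))"
    have c: "c * c * (2 * of_real pi) = 1"
    proof -
      have "1 / sqrt (2 * pi) * (1 / sqrt (2 * pi)) = 1 / (2 * pi)" by simp
      then have "c * c = of_real (1 / (2 * pi))" unfolding c_def of_real_mult[symmetric] by (simp only:)
      then show ?thesis by simp
    qed
    let ?h = "\<lambda>w. LBINT v. cis (-(v * w)) * slice_coord J (blade A) (G v)"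
    have "slice_coord J (blade A) ((1 / sqrt (2 * pi)) *\<^sub>R (LBINT w. ?I w)) = c * (LBINT w. slice_coord J (blade A) (?I w))"
    proof -
      have sc: "s *\<^sub>R x = of_real s * x" for s and x :: complex by (rule scaleR_conv_of_real)
      show ?thesis
        unfolding integral_bounded_linear[OF bounded_linear_slice_coord int] by (simp only: b.scaleR sc c_def)
    qed
    also have "(\<lambda>w. slice_coord J (blade A) (?I w)) = (\<lambda>w. c * (indicator {..0} w *\<^sub>R (exp (of_real w * z) * ?h w)))"
      by (rule ext) (simp add: b.scaleR slice_coord_of_slice_mult[OF J] slice_coord_fourier_L1[OF J integrable_G] c_def)
    also have "c * (LBINT w. c * (indicator {..0} w *\<^sub>R (exp (of_real w * z) * ?h w))) =
        c * c * (LBINT w. indicator {..0} w *\<^sub>R (exp (of_real w * z) * ?h w))"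
      by (simp only: integral_mult_right_zero mult.assoc)
    also have "\<dots> = c * c * (2 * of_real pi) * (r z * slice_coord J (blade A) (f (of_slice J z)))"
      unfolding half_plane_hardy1.fourier_representation[OF hardy1 z, symmetric] by (simp add: mult.assoc)
    also have "\<dots> = slice_coord J (blade A) (of_slice J (r z) * f (of_slice J z))"
      unfolding c by (simp add: slice_coord_of_slice_mult[OF J])
    finally show "slice_coord J (blade A) (of_slice J (r z) * f (of_slice J z)) =
      slice_coord J (blade A) ((1 / sqrt (2 * pi)) *\<^sub>R (LBINT w. ?I w))" by simp
  qed
qed

end

text \<open>As a pointwise limit of continuous functions along the normal ray, g is Borel, and it
  agrees with \<open>nt_limit\<close> almost everywhere. M comes from the slice Hardy condition,
  membership in L^p from the condition on the boundary values.\<close>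

lemma hardy_slice_boundary:
  fixes f :: "'n::{finite,linorder} clifford \<Rightarrow> 'n clifford"
  assumes f: "f \<in> hardy_slice p" and J: "J \<in> imag_sphere"
  obtains g M where "g \<in> borel_measurable borel" "AE v in lebesgue. nt_limit f J v = g v"
    "AE v in lborel. (\<lambda>n. f (of_slice J (Complex (1 / Suc n) v))) \<longlonglongrightarrow> g v"
    "0 \<le> M" "\<And>u. 0 < u \<Longrightarrow> (\<integral>\<^sup>+v. ennreal (norm (f (of_slice J (Complex u v))) powr p) \<partial>lborel) \<le> ennreal M"
    "nt_limit f J \<in> Lp_fun p"
proof -
  have sm: "f \<in> slice_monogenic half_space" and cl: "classical_hardy_on_slice p J f"
    and ex: "AE v in lebesgue. \<exists>L. has_nt_limit f J v L"
    and fin: "(SUP I\<in>imag_sphere. \<integral>\<^sup>+ v. ennreal (norm (nt_limit f I v) powr p) \<partial>lebesgue) < \<infinity>"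
    using f J by (auto simp: hardy_slice_def)
  define g where "g = (\<lambda>v. lim (\<lambda>n. f (of_slice J (Complex (1 / Suc n) v))))"
  have "(\<lambda>v. f (of_slice J (Complex (1 / Suc n) v))) \<in> borel_measurable borel" for n
  proof (intro borel_measurable_continuous_onI)
    show "continuous_on UNIV (\<lambda>v. f (of_slice J (Complex (1 / Suc n) v)))"
      unfolding Complex_eq
      by (rule continuous_on_compose2[OF slice_monogenic_coord_holomorphic(2)[OF J sm]]) (auto intro!: continuous_intros)
  qed
  then have g: "g \<in> borel_measurable borel" unfolding g_def by (intro borel_measurable_lim_metric)
  have lim: "AE v in lebesgue. (\<lambda>n. f (of_slice J (Complex (1 / Suc n) v))) \<longlonglongrightarrow> nt_limit f J v"
    using ex by eventually_elim (rule nt_limit_radial[OF J])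
  then have eq: "AE v in lebesgue. nt_limit f J v = g v"
    by eventually_elim (simp add: g_def limI)
  have "AE v in lebesgue. (\<lambda>n. f (of_slice J (Complex (1 / Suc n) v))) \<longlonglongrightarrow> g v"
    using lim eq by eventually_elim simp
  then have lim': "AE v in lborel. (\<lambda>n. f (of_slice J (Complex (1 / Suc n) v))) \<longlonglongrightarrow> g v"
    by (simp only: AE_completion_iff)
  define M where "M = enn2real (SUP u\<in>{0<..}. \<integral>\<^sup>+ v. ennreal (norm (f (slice_pt J u v)) powr p) \<partial>lebesgue)"
  have Mfin: "ennreal M = (SUP u\<in>{0<..}. \<integral>\<^sup>+ v. ennreal (norm (f (slice_pt J u v)) powr p) \<partial>lebesgue)"
    using cl unfolding M_def classical_hardy_on_slice_def by simp
  have bdd: "(\<integral>\<^sup>+v. ennreal (norm (f (of_slice J (Complex u v))) powr p) \<partial>lborel) \<le> ennreal M" if "0 < u" for u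
  proof -
    have "(\<integral>\<^sup>+v. ennreal (norm (f (of_slice J (Complex u v))) powr p) \<partial>lborel) = (\<integral>\<^sup>+ v. ennreal (norm (f (slice_pt J u v)) powr p) \<partial>lebesgue)"
      by (simp add: nn_integral_completion slice_pt_eq)
    also have "\<dots> \<le> ennreal M" unfolding Mfin using that by (intro SUP_upper) simp
    finally show ?thesis .
  qed
  have "Lp_energy p (nt_limit f J) \<le> (SUP I\<in>imag_sphere. \<integral>\<^sup>+ v. ennreal (norm (nt_limit f I v) powr p) \<partial>lebesgue)"
    unfolding Lp_energy_def using J by (intro SUP_upper)
  then have "Lp_energy p (nt_limit f J) < \<infinity>" using fin by (rule le_less_trans)
  moreover have "nt_limit f J \<in> borel_measurable lebesgue"
    by (rule borel_measurable_AE[OF measurable_completion[of g]]) (use g eq in \<open>auto simp: eq_commute\<close>)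
  ultimately have "nt_limit f J \<in> Lp_fun p" by (simp add: Lp_fun_iff)
  from that[OF g eq lim' _ bdd this] show thesis by (simp add: M_def)
qed

lemma ess_support_subset_nonpos:
  assumes "AE w in lebesgue. 0 < w \<longrightarrow> h w = 0"
  shows "ess_support h \<subseteq> {..0}"
proof
  fix x assume x: "x \<in> ess_support h"
  have "x \<notin> {0<..}"
  proof
    assume "x \<in> {0<..}"
    moreover have "open {0::real<..}" "AE w in lebesgue. w \<in> {0::real<..} \<longrightarrow> h w = 0"
      using assms by simp_all
    ultimately show False using x unfolding ess_support_def by blast
  qed
  then show "x \<in> {..0}" by simp
qed

lemma set_integral_lebesgue_borel:
  fixes F :: "real \<Rightarrow> 'b::{banach, second_countable_topology}"
  assumes "(\<lambda>w. indicator A w *\<^sub>R F w) \<in> borel_measurable borel"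
  shows "set_integrable lebesgue A F \<longleftrightarrow> integrable lborel (\<lambda>w. indicator A w *\<^sub>R F w)"
    and "(LINT w:A|lebesgue. F w) = (LBINT w. indicator A w *\<^sub>R F w)"
  unfolding set_integrable_def set_lebesgue_integral_def
  using assms by (simp_all add: integrable_completion integral_completion)

lemma clifford_exp_slice_pt:
  assumes "J \<in> imag_sphere"
  shows "clifford_exp (w *\<^sub>R slice_pt J u v) = of_slice J (exp (of_real w * Complex u v))"
proof -
  have "w *\<^sub>R slice_pt J u v = of_slice J (of_real w * Complex u v)"
    by (simp only: slice_pt_eq of_slice_scaleR[symmetric] scaleR_conv_of_real[of w "Complex u v"])
  then show ?thesis by (simp only: clifford_exp_of_slice[OF assms])
qed

section \<open>The representation theorem for p = 1 and for 1 < p <= 2\<close>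

lemma hardy_slice_1_representation:
  fixes f :: "'n::{finite,linorder} clifford \<Rightarrow> 'n clifford"
  assumes f: "f \<in> hardy_slice 1" and J: "J \<in> imag_sphere"
  shows "ess_support (fourier 1 J (nt_limit f J)) \<subseteq> {..0}"
    and "0 < u \<Longrightarrow> set_integrable lebesgue {..0}
        (\<lambda>w. clifford_exp (w *\<^sub>R slice_pt J u v) * fourier 1 J (nt_limit f J) w) \<and>
      f (slice_pt J u v) = (1 / sqrt (2 * pi)) *\<^sub>R
        (LINT w:{..0}|lebesgue. clifford_exp (w *\<^sub>R slice_pt J u v) * fourier 1 J (nt_limit f J) w)"
proof -
  obtain g M where g: "g \<in> borel_measurable borel" "AE v in lebesgue. nt_limit f J v = g v"
    "AE v in lborel. (\<lambda>n. f (of_slice J (Complex (1 / Suc n) v))) \<longlonglongrightarrow> g v"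
    and M: "0 \<le> M" "\<And>u. 0 < u \<Longrightarrow> (\<integral>\<^sup>+v. ennreal (norm (f (of_slice J (Complex u v))) powr 1) \<partial>lborel) \<le> ennreal M"
    and nt: "nt_limit f J \<in> Lp_fun 1"
    using hardy_slice_boundary[OF f J] by blast
  note boundary = g(2)
  interpret slice_hardy J f g "\<lambda>_. 1" "\<lambda>_. 1" M
    by standard (use J f g M in \<open>auto simp: hardy_slice_def\<close>)
  have "G = g" by (rule ext) (simp add: G_def)
  have T: "fourier 1 J (nt_limit f J) = fourier_L1 J G"
    unfolding fourier_def \<open>G = g\<close>
    using g(1) nt by (simp, intro fourier_L1_cong_AE[OF J _ _ boundary]) (auto simp: Lp_fun_iff intro: measurable_completion)
  show "ess_support (fourier 1 J (nt_limit f J)) \<subseteq> {..0}"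
    unfolding T by (rule ess_support_subset_nonpos) (simp add: fourier_G_vanishes)
  assume u: "0 < u"
  have *: "(\<lambda>w. indicator {..0} w *\<^sub>R (of_slice J (exp (of_real w * Complex u v)) * fourier_L1 J G w)) \<in> borel_measurable borel"
    by measurable
  show "set_integrable lebesgue {..0}
        (\<lambda>w. clifford_exp (w *\<^sub>R slice_pt J u v) * fourier 1 J (nt_limit f J) w) \<and>
      f (slice_pt J u v) = (1 / sqrt (2 * pi)) *\<^sub>R
        (LINT w:{..0}|lebesgue. clifford_exp (w *\<^sub>R slice_pt J u v) * fourier 1 J (nt_limit f J) w)"
    unfolding T clifford_exp_slice_pt[OF J] set_integral_lebesgue_borel[OF *]
    using integrable_fourier_G[of "Complex u v"] fourier_G_representation[of "Complex u v"] u
    by (simp add: slice_pt_eq)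
qed

text \<open>The weighted boundary functions G k lie in L^1 \<inter> L^p and tend to the boundary
  function in L^p, so their transforms T k tend to \<open>fourier\<close> in L^q by its defining
  property. Both the vanishing for w > 0 and integration against exp (z w) over w <= 0 are
  compatible with this convergence.\<close>

lemma hardy_slice_representation:
  fixes f :: "'n::{finite,linorder} clifford \<Rightarrow> 'n clifford"
  assumes p: "1 < p" "p \<le> 2" and f: "f \<in> hardy_slice p" and J: "J \<in> imag_sphere"
  shows "ess_support (fourier p J (nt_limit f J)) \<subseteq> {..0}"
    and "0 < u \<Longrightarrow> set_integrable lebesgue {..0}
        (\<lambda>w. clifford_exp (w *\<^sub>R slice_pt J u v) * fourier p J (nt_limit f J) w) \<and>
      f (slice_pt J u v) = (1 / sqrt (2 * pi)) *\<^sub>R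
        (LINT w:{..0}|lebesgue. clifford_exp (w *\<^sub>R slice_pt J u v) * fourier p J (nt_limit f J) w)"
proof -
  define q where "q = p / (p - 1)"
  have q: "1 < q" using p by (simp add: q_def field_simps)
  obtain g M where g: "g \<in> borel_measurable borel" "AE v in lebesgue. nt_limit f J v = g v"
    "AE v in lborel. (\<lambda>n. f (of_slice J (Complex (1 / Suc n) v))) \<longlonglongrightarrow> g v"
    and M: "0 \<le> M" "\<And>u. 0 < u \<Longrightarrow> (\<integral>\<^sup>+v. ennreal (norm (f (of_slice J (Complex u v))) powr p) \<partial>lborel) \<le> ennreal M"
    and nt: "nt_limit f J \<in> Lp_fun p"
    using hardy_slice_boundary[OF f J] by blast
  have [measurable]: "g \<in> borel_measurable borel" by (rule g(1))
  have sm: "f \<in> slice_monogenic half_space" using f by (simp add: hardy_slice_def)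
  define K where "K = (\<lambda>k::nat. real (Suc k))"
  have K: "0 < K k" for k by (simp add: K_def)
  \<comment> \<open>The square makes the weight decay like 1 / v^2: its modulus is bounded by pi K
    times the Poisson kernel at height K, whose integral is known. It is also at most 1 on the
    closed half-plane and tends to 1 pointwise as K grows.\<close>
  define r where "r = (\<lambda>k z. 1 / (1 + z / of_real (K k))\<^sup>2 :: complex)"
  define r0 where "r0 = (\<lambda>k v. r k (\<i> * of_real v))"
  have nz: "1 + z / of_real (K k) \<noteq> 0" if "0 \<le> Re z" for k z
  proof -
    have "1 \<le> Re (1 + z / of_real (K k))" using that K[of k] by simp
    then show ?thesis by (metis not_one_le_zero zero_complex.sel(1))
  qed
  have r_le: "cmod (r k (Complex u v)) \<le> pi * K k * poisson_kernel (K k) v" if "0 \<le> u" for k u v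
  proof -
    have "1 + (v / K k)\<^sup>2 \<le> (cmod (1 + Complex u v / of_real (K k)))\<^sup>2"
    proof -
      have "1 \<le> (1 + u / K k)\<^sup>2" using that K[of k] by (intro one_le_power) simp
      then show ?thesis by (simp add: cmod_power2)
    qed
    then have "cmod (r k (Complex u v)) \<le> 1 / (1 + (v / K k)\<^sup>2)"
      unfolding r_def norm_divide norm_power norm_one
      by (intro frac_le) (auto intro: add_pos_nonneg)
    also have "\<dots> = pi * K k * poisson_kernel (K k) v"
    proof -
      have "1 + (v / K k)\<^sup>2 = ((K k)\<^sup>2 + v\<^sup>2) / (K k)\<^sup>2"
        using K[of k] by (simp add: power_divide add_divide_distrib)
      then show ?thesis by (simp add: poisson_kernel_def power2_eq_square)
    qed
    finally show ?thesis .
  qed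
  have r_le1: "cmod (r k (Complex u v)) \<le> 1" if "0 \<le> u" for k u v
  proof -
    have "1 \<le> Re (1 + Complex u v / of_real (K k))" using that K[of k] by simp
    also have "\<dots> \<le> cmod (1 + Complex u v / of_real (K k))" by (rule complex_Re_le_cmod)
    finally have "1 \<le> (cmod (1 + Complex u v / of_real (K k)))\<^sup>2" by (rule one_le_power)
    then have "1 / (cmod (1 + Complex u v / of_real (K k)))\<^sup>2 \<le> 1 / 1" by (intro frac_le) auto
    then show ?thesis unfolding r_def norm_divide norm_power norm_one by (simp only: div_by_1)
  qed
  have r0_le1: "cmod (r0 k v) \<le> 1" for k v using r_le1[of 0 k v] by (simp add: r0_def Complex_eq)
  have r_tendsto: "(\<lambda>k. r k z) \<longlonglongrightarrow> 1" for z
  proof -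
    have "(\<lambda>k. 1 / (1 + z * of_real (1 / K k))\<^sup>2) \<longlonglongrightarrow> 1 / (1 + z * of_real 0)\<^sup>2"
      unfolding K_def by (intro tendsto_intros LIMSEQ_Suc[OF lim_1_over_n, where ?'a1 = real]) simp
    then show ?thesis by (simp add: r_def)
  qed
  have [measurable]: "r0 k \<in> borel_measurable borel" for k
    unfolding r0_def r_def by measurable
  have sh: "slice_hardy J f g (r k) (r0 k) (pi * K k + M)" for k
  proof
    show "r k holomorphic_on {z. 0 < Re z}"
      unfolding r_def by (intro holomorphic_intros) (use nz K in \<open>auto simp: less_imp_le\<close>)
    show "(\<lambda>n. r k (Complex (1 / Suc n) v)) \<longlonglongrightarrow> r0 k v" for v
    proof -
      have "(\<lambda>n. r k (of_real (1 / Suc n) + \<i> * of_real v)) \<longlonglongrightarrow> r k (of_real 0 + \<i> * of_real v)"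
        unfolding r_def using nz[of "\<i> * of_real v" k] K[of k]
        by (intro tendsto_intros LIMSEQ_Suc[OF lim_1_over_n, where ?'a1 = real]) auto
      then show ?thesis by (simp add: r0_def Complex_eq)
    qed
    show "0 \<le> pi * K k + M" using K[of k] M(1) by (intro add_nonneg_nonneg) auto
    fix u :: real assume u: "0 < u"
    have "(\<integral>\<^sup>+v. ennreal (cmod (r k (Complex u v)) * norm (f (of_slice J (Complex u v)))) \<partial>lborel) \<le>
        (\<integral>\<^sup>+v. ennreal (pi * K k) * ennreal (poisson_kernel (K k) v) + ennreal (norm (f (of_slice J (Complex u v))) powr p) \<partial>lborel)"
    proof (rule nn_integral_mono)
      fix v
      define a b where "a = cmod (r k (Complex u v))" and "b = norm (f (of_slice J (Complex u v)))"
      \<comment> \<open>The weight a is integrable in its own right and at most 1, so the first term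
        costs pi K and the second M.\<close>
      have "a * b \<le> a * (1 + b powr p)"
        using p by (intro mult_left_mono le_one_plus_powr) (auto simp: a_def b_def)
      also have "\<dots> = a + a * b powr p" by (simp add: distrib_left)
      also have "\<dots> \<le> pi * K k * poisson_kernel (K k) v + 1 * b powr p"
        using r_le[of u k v] r_le1[of u k v] u by (intro add_mono mult_right_mono) (auto simp: a_def)
      finally have "ennreal (a * b) \<le> ennreal (pi * K k * poisson_kernel (K k) v + b powr p)"
        by (intro ennreal_leI) simp
      then show "ennreal (cmod (r k (Complex u v)) * norm (f (of_slice J (Complex u v)))) \<le>
          ennreal (pi * K k) * ennreal (poisson_kernel (K k) v) + ennreal (norm (f (of_slice J (Complex u v))) powr p)"
        using K[of k] by (simp add: a_def b_def ennreal_mult poisson_kernel_nonneg less_imp_le)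
    qed
    also have "\<dots> = ennreal (pi * K k) * (\<integral>\<^sup>+v. ennreal (poisson_kernel (K k) v) \<partial>lborel) +
        (\<integral>\<^sup>+v. ennreal (norm (f (of_slice J (Complex u v))) powr p) \<partial>lborel)"
    proof (subst nn_integral_add)
      have "continuous_on UNIV (\<lambda>v. f (of_slice J (Complex u v)))"
        unfolding Complex_eq
        by (rule continuous_on_compose2[OF slice_monogenic_coord_holomorphic(2)[OF J sm]]) (use u in \<open>auto intro!: continuous_intros\<close>)
      then have [measurable]: "(\<lambda>v. f (of_slice J (Complex u v))) \<in> borel_measurable borel" by (rule borel_measurable_continuous_onI)
      show "(\<lambda>v. ennreal (norm (f (of_slice J (Complex u v))) powr p)) \<in> borel_measurable lborel" by measurable
    qed (simp_all add: nn_integral_cmult)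
    also have "(\<integral>\<^sup>+v. ennreal (poisson_kernel (K k) v) \<partial>lborel) = 1"
      using has_bochner_integral_poisson_kernel[OF K[of k], of 0] K[of k]
      by (simp add: nn_integral_eq_integral has_bochner_integral_iff poisson_kernel_nonneg less_imp_le)
    also have "ennreal (pi * K k) * 1 + (\<integral>\<^sup>+v. ennreal (norm (f (of_slice J (Complex u v))) powr p) \<partial>lborel) \<le> ennreal (pi * K k) + ennreal M"
      using M(2)[OF u] by (simp add: add_left_mono)
    also have "\<dots> = ennreal (pi * K k + M)"
      using K[of k] M(1) by (intro ennreal_plus[symmetric]) auto
    finally show "(\<integral>\<^sup>+v. ennreal (cmod (r k (Complex u v)) * norm (f (of_slice J (Complex u v)))) \<partial>lborel) \<le> ennreal (pi * K k + M)" .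
  qed (use J sm g in auto)
  define G where "G = (\<lambda>k. slice_hardy.G J g (r0 k))"
  have G_eq: "G k v = of_slice J (r0 k v) * g v" for k v
    by (simp add: G_def slice_hardy.G_def[OF sh])
  have Gm: "G k \<in> borel_measurable borel" for k unfolding G_def by (rule slice_hardy.G_measurable[OF sh])
  have int_G: "integrable lborel (G k)" for k unfolding G_def by (rule slice_hardy.integrable_G[OF sh])
  have g_energy: "Lp_energy p g = Lp_energy p (nt_limit f J)"
    unfolding Lp_energy_def by (intro nn_integral_cong_AE) (use g(2) in eventually_elim, simp)
  have g_fin: "Lp_energy p g < \<infinity>" using nt by (simp add: g_energy Lp_fun_iff)
  have G_Lp: "G k \<in> Lp_fun 1 \<inter> Lp_fun p" for k
  proof -
    have "Lp_energy p (G k) \<le> Lp_energy p g"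
      unfolding Lp_energy_def G_eq
      using p r0_le1 by (intro nn_integral_mono ennreal_leI powr_mono2) (auto simp: norm_of_slice_mult[OF J] intro!: mult_left_le_one_le)
    then have "Lp_energy p (G k) < \<infinity>" using g_fin by (rule le_less_trans)
    moreover have "Lp_energy 1 (G k) < \<infinity>"
      using int_G[of k] by (simp add: Lp_energy_def nn_integral_completion integrable_iff_bounded)
    ultimately show ?thesis using measurable_completion[of "G k" lborel borel] Gm[of k] by (simp add: Lp_fun_iff)
  qed
  have G_tendsto: "Lp_tendsto p G (nt_limit f J)"
  proof -
    have "(\<lambda>k. \<integral>\<^sup>+v. ennreal (norm (G k v - g v) powr p) \<partial>lborel) \<longlonglongrightarrow> (\<integral>\<^sup>+v. 0 \<partial>(lborel :: real measure))"
    proof (rule nn_integral_dominated_convergence[where w = "\<lambda>v. ennreal (2 powr p) * ennreal (norm (g v) powr p)"])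
      show "(\<lambda>v. ennreal (norm (G k v - g v) powr p)) \<in> borel_measurable lborel" for k
        using Gm[of k] by measurable
      show "AE v in lborel. ennreal (norm (G k v - g v) powr p) \<le> ennreal (2 powr p) * ennreal (norm (g v) powr p)" for k
      proof (rule AE_I2)
        fix v
        have "norm (G k v) \<le> norm (g v)"
          using r0_le1[of k v] by (simp add: G_eq norm_of_slice_mult[OF J] mult_left_le_one_le)
        then have "norm (G k v - g v) \<le> 2 * norm (g v)" using norm_triangle_ineq4[of "G k v" "g v"] by linarith
        then have "norm (G k v - g v) powr p \<le> (2 * norm (g v)) powr p" using p by (intro powr_mono2) auto
        then have "norm (G k v - g v) powr p \<le> 2 powr p * norm (g v) powr p" by (simp add: powr_mult)
        then show "ennreal (norm (G k v - g v) powr p) \<le> ennreal (2 powr p) * ennreal (norm (g v) powr p)"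
          by (subst ennreal_mult[symmetric]) (auto intro: ennreal_leI)
      qed
      have "(\<integral>\<^sup>+v. ennreal (norm (g v) powr p) \<partial>lborel) < \<infinity>"
        using g_fin by (simp add: Lp_energy_def nn_integral_completion)
      then show "(\<integral>\<^sup>+v. ennreal (2 powr p) * ennreal (norm (g v) powr p) \<partial>lborel) < \<infinity>"
        by (simp add: nn_integral_cmult ennreal_mult_less_top)
      show "AE v in lborel. (\<lambda>k. ennreal (norm (G k v - g v) powr p)) \<longlonglongrightarrow> 0"
      proof (rule AE_I2)
        fix v
        interpret o: bounded_linear "of_slice J" by (rule bounded_linear_of_slice)
        have "G k v - g v = of_slice J (r0 k v - 1) * g v" for k
          by (simp add: G_eq o.diff left_diff_distrib)
        then have "norm (G k v - g v) = cmod (r0 k v - 1) * norm (g v)" for k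
          by (simp add: norm_of_slice_mult[OF J])
        moreover have "(\<lambda>k. cmod (r0 k v - 1) * norm (g v)) \<longlonglongrightarrow> cmod (1 - 1) * norm (g v)"
          unfolding r0_def by (intro tendsto_intros r_tendsto)
        ultimately have "(\<lambda>k. norm (G k v - g v)) \<longlonglongrightarrow> 0" by simp
        then have "(\<lambda>k. norm (G k v - g v) powr p) \<longlonglongrightarrow> 0 powr p"
          using p by (intro tendsto_powr' tendsto_const) auto
        then have "(\<lambda>k. ennreal (norm (G k v - g v) powr p)) \<longlonglongrightarrow> ennreal 0"
          using p by (intro tendsto_ennrealI) simp
        then show "(\<lambda>k. ennreal (norm (G k v - g v) powr p)) \<longlonglongrightarrow> 0" by simp
      qed
    qed measurable
    moreover have "(\<integral>\<^sup>+v. ennreal (norm (G k v - g v) powr p) \<partial>lborel) = (\<integral>\<^sup>+v. ennreal (norm (G k v - nt_limit f J v) powr p) \<partial>lebesgue)" for k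
    proof -
      have "(\<integral>\<^sup>+v. ennreal (norm (G k v - g v) powr p) \<partial>lborel) = (\<integral>\<^sup>+v. ennreal (norm (G k v - g v) powr p) \<partial>lebesgue)"
        by (rule nn_integral_completion[symmetric])
      also have "\<dots> = (\<integral>\<^sup>+v. ennreal (norm (G k v - nt_limit f J v) powr p) \<partial>lebesgue)"
        by (intro nn_integral_cong_AE) (use g(2) in eventually_elim, simp)
      finally show ?thesis .
    qed
    ultimately show ?thesis by (simp add: Lp_tendsto_def)
  qed
  define h where "h = fourier p J (nt_limit f J)"
  have h: "h \<in> borel_measurable lebesgue" "Lp_energy q h < \<infinity>"
    using fourier_Lp_fun[OF J p nt] by (simp_all add: h_def q_def Lp_fun_iff)
  define T where "T = (\<lambda>k. fourier_L1 J (G k))"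
  have Tm: "T k \<in> borel_measurable borel" for k unfolding T_def by (rule measurable_fourier_L1[OF J Gm])
  have Tm': "T k \<in> borel_measurable lebesgue" for k
    by (rule measurable_completion) (simp add: Tm)
  have T_tendsto: "(\<lambda>k. Lp_energy q (\<lambda>w. T k w - h w)) \<longlonglongrightarrow> 0"
    using Lp_tendsto_fourier[OF J p nt G_Lp G_tendsto] by (simp add: Lp_tendsto_iff T_def h_def q_def)
  have T0: "T k w = 0" if "0 < w" for k w
    unfolding T_def G_def by (rule slice_hardy.fourier_G_vanishes[OF sh that])
  have ind: "(indicator A :: real \<Rightarrow> real) \<in> borel_measurable lebesgue" if "A \<in> sets borel" for A
    using that by (intro borel_measurable_indicator) simp
  \<comment> \<open>For w > 0 every T k vanishes, so the energy of h there is at most that of T k -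
    h, which tends to 0.\<close>
  have "AE w in lebesgue. norm (indicator {0<..} w *\<^sub>R h w) powr q = 0"
  proof -
    have m: "(\<lambda>w. ennreal (norm (indicator {0<..} w *\<^sub>R h w) powr q)) \<in> borel_measurable lebesgue"
      by (intro measurable_ennreal_norm_powr borel_measurable_scaleR ind h) simp
    have "(\<integral>\<^sup>+w. ennreal (norm (indicator {0<..} w *\<^sub>R h w) powr q) \<partial>lebesgue) \<le> Lp_energy q (\<lambda>w. T k w - h w)" for k
      unfolding Lp_energy_def by (intro nn_integral_mono) (auto simp: indicator_def T0)
    then have "(\<integral>\<^sup>+w. ennreal (norm (indicator {0<..} w *\<^sub>R h w) powr q) \<partial>lebesgue) \<le> 0"
      by (intro LIMSEQ_le_const[OF T_tendsto]) auto
    then have "(\<integral>\<^sup>+w. ennreal (norm (indicator {0<..} w *\<^sub>R h w) powr q) \<partial>lebesgue) = 0" by simp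
    then have "AE w in lebesgue. ennreal (norm (indicator {0<..} w *\<^sub>R h w) powr q) = 0"
      using nn_integral_0_iff_AE[OF m] by simp
    then show ?thesis by eventually_elim simp
  qed
  then have "AE w in lebesgue. 0 < w \<longrightarrow> h w = 0"
    by eventually_elim (auto simp: indicator_def)
  then show "ess_support (fourier p J (nt_limit f J)) \<subseteq> {..0}"
    unfolding h_def by (rule ess_support_subset_nonpos)
  assume u: "0 < u"
  define z where "z = Complex u v"
  have z: "0 < Re z" using u by (simp add: z_def)
  \<comment> \<open>On w <= 0 the exponential has modulus exp (- u |w|), which is
    integrable.\<close>
  define E where "E = (\<lambda>h w. indicator {..0} w *\<^sub>R (of_slice J (exp (of_real w * z)) * h w) :: 'n clifford)"
  have E_norm: "norm (E h w) \<le> exp (-(u * \<bar>w\<bar>)) * norm (h w)" for h w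
    by (auto simp: E_def indicator_def norm_of_slice_mult[OF J] z_def mult.commute)
  have E_diff: "E h1 w - E h2 w = E (\<lambda>w. h1 w - h2 w) w" for h1 h2 w
    by (simp add: E_def indicator_def right_diff_distrib)
  have ex: "(\<lambda>w. exp (of_real w * z)) \<in> borel_measurable lebesgue"
    by (rule measurable_completion) measurable
  have Em: "E h \<in> borel_measurable lebesgue" if "h \<in> borel_measurable lebesgue" for h
    unfolding E_def by (intro borel_measurable_scaleR ind measurable_of_slice_mult ex that) simp
  have int_exp: "integrable lebesgue (\<lambda>w. exp (-(u * \<bar>w\<bar>)))"
    using integrable_exp_abs[OF u] by (subst integrable_completion) auto
  have exp_fin: "(\<integral>\<^sup>+w. ennreal (exp (-(u * \<bar>w\<bar>))) \<partial>lebesgue) = ennreal (LINT w|lebesgue. exp (-(u * \<bar>w\<bar>)))"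
    by (rule nn_integral_eq_integral[OF int_exp]) simp
  define I where "I = (LINT w|lebesgue. exp (-(u * \<bar>w\<bar>)))"
  have I: "0 \<le> I" unfolding I_def by (intro integral_nonneg_AE) simp
  \<comment> \<open>A substitute for Hoelder's inequality: a value of |h| is either at most d or at
    most d^(1 - q) |h|^q. The first part is made small by d alone, the second by the energy once d
    is fixed.\<close>
  have bound: "(\<integral>\<^sup>+w. ennreal (norm (E h w)) \<partial>lebesgue) \<le> ennreal (d * I) + ennreal (d powr (1 - q)) * Lp_energy q h"
    if d: "0 < d" and hm: "h \<in> borel_measurable lebesgue" for d h
  proof -
    have ma: "(\<lambda>w. ennreal (exp (-(u * \<bar>w\<bar>)))) \<in> borel_measurable lebesgue"
      by (rule measurable_completion) measurable
    have mb: "(\<lambda>w. ennreal (norm (h w) powr q)) \<in> borel_measurable lebesgue"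
      by (rule measurable_ennreal_norm_powr[OF hm])
    have "(\<integral>\<^sup>+w. ennreal (norm (E h w)) \<partial>lebesgue) \<le> (\<integral>\<^sup>+w. ennreal d * ennreal (exp (-(u * \<bar>w\<bar>))) + ennreal (d powr (1 - q)) * ennreal (norm (h w) powr q) \<partial>lebesgue)"
    proof (rule nn_integral_mono)
      fix w
      define a where "a = norm (h w)"
      have a: "a \<le> d + d powr (1 - q) * a powr q"
      proof (cases "a \<le> d")
        case True
        then show ?thesis by (simp add: add_increasing2)
      next
        case False
        then have "d powr (q - 1) \<le> a powr (q - 1)" using d q by (intro powr_mono2) auto
        then have "a * 1 \<le> a * (d powr (1 - q) * a powr (q - 1))"
          using d False by (intro mult_left_mono) (auto simp: powr_diff field_simps)
        also have "\<dots> = d powr (1 - q) * a powr q" using d False by (simp add: powr_diff)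
        finally show ?thesis using d by simp
      qed
      have "norm (E h w) \<le> exp (-(u * \<bar>w\<bar>)) * (d + d powr (1 - q) * a powr q)"
        unfolding a_def by (rule order_trans, rule E_norm, rule mult_left_mono[OF a[unfolded a_def] exp_ge_zero])
      also have "\<dots> \<le> d * exp (-(u * \<bar>w\<bar>)) + 1 * (d powr (1 - q) * a powr q)"
        unfolding distrib_left using u by (intro add_mono mult_right_mono) auto
      finally have "ennreal (norm (E h w)) \<le> ennreal (d * exp (-(u * \<bar>w\<bar>)) + d powr (1 - q) * a powr q)"
        by (intro ennreal_leI) simp
      then show "ennreal (norm (E h w)) \<le> ennreal d * ennreal (exp (-(u * \<bar>w\<bar>))) + ennreal (d powr (1 - q)) * ennreal (norm (h w) powr q)"
        using d by (simp add: a_def ennreal_mult)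
    qed
    also have "\<dots> = ennreal d * ennreal I + ennreal (d powr (1 - q)) * Lp_energy q h"
      unfolding Lp_energy_def I_def exp_fin[symmetric]
      by (subst nn_integral_add, intro borel_measurable_times_ennreal borel_measurable_const ma, intro borel_measurable_times_ennreal borel_measurable_const mb)
         (simp add: nn_integral_cmult ma mb)
    finally show ?thesis using d I by (simp add: ennreal_mult)
  qed
  have int_E: "integrable lebesgue (E h)"
  proof (intro integrableI_bounded Em h)
    have "ennreal (1 * I) + ennreal (1 powr (1 - q)) * Lp_energy q h < \<infinity>" using h(2) by simp
    with bound[of 1 h] h(1) show "(\<integral>\<^sup>+w. ennreal (norm (E h w)) \<partial>lebesgue) < \<infinity>" by (auto intro: le_less_trans)
  qed
  have ET: "E (T k) \<in> borel_measurable borel" for k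
    unfolding E_def using Tm[of k] by measurable
  have int_ET: "integrable lborel (E (T k))" for k
    unfolding E_def T_def G_def by (rule slice_hardy.integrable_fourier_G[OF sh z])
  have rep: "of_slice J (r k z) * f (of_slice J z) = (1 / sqrt (2 * pi)) *\<^sub>R (LINT w|lebesgue. E (T k) w)" for k
  proof -
    have "(LINT w|lebesgue. E (T k) w) = (LBINT w. E (T k) w)"
      by (rule integral_completion) (simp add: ET)
    then show ?thesis
      unfolding E_def T_def G_def using slice_hardy.fourier_G_representation[OF sh z] by (simp only:)
  qed
  have "(\<lambda>k. LINT w|lebesgue. E (T k) w) \<longlonglongrightarrow> (LINT w|lebesgue. E h w)"
  proof (rule tendsto_L1_int[OF _ int_E])
    show "integrable lebesgue (E (T k))" for k using int_ET[of k] ET[of k] by (subst integrable_completion) auto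
    show "(\<lambda>k. \<integral>\<^sup>+w. ennreal (norm (E (T k) w - E h w)) \<partial>lebesgue) \<longlonglongrightarrow> 0"
      unfolding E_diff
    proof (rule tendsto_0_ennrealI)
      fix e :: real assume e: "0 < e"
      \<comment> \<open>This leaves e / 2 for the energy term; I + 1 keeps the denominator
        positive.\<close>
      define d where "d = e / (2 * (I + 1))"
      have d: "0 < d" using e I by (simp add: d_def)
      have dI: "d * I \<le> e / 2" using e I by (simp add: d_def field_simps)
      have "(\<lambda>k. ennreal (d powr (1 - q)) * Lp_energy q (\<lambda>w. T k w - h w)) \<longlonglongrightarrow> ennreal (d powr (1 - q)) * 0"
        by (intro ennreal_tendsto_cmult T_tendsto) simp
      then have "eventually (\<lambda>k. ennreal (d powr (1 - q)) * Lp_energy q (\<lambda>w. T k w - h w) < ennreal (e / 2)) sequentially"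
        using e by (intro order_tendstoD(2)) auto
      then show "eventually (\<lambda>k. (\<integral>\<^sup>+w. ennreal (norm (E (\<lambda>w. T k w - h w) w)) \<partial>lebesgue) \<le> ennreal e) sequentially"
      proof eventually_elim
        fix k assume k: "ennreal (d powr (1 - q)) * Lp_energy q (\<lambda>w. T k w - h w) < ennreal (e / 2)"
        have "(\<integral>\<^sup>+w. ennreal (norm (E (\<lambda>w. T k w - h w) w)) \<partial>lebesgue) \<le> ennreal (d * I) + ennreal (d powr (1 - q)) * Lp_energy q (\<lambda>w. T k w - h w)"
          by (intro bound d borel_measurable_diff Tm' h)
        also have "\<dots> \<le> ennreal (e / 2) + ennreal (e / 2)"
          using k dI by (intro add_mono ennreal_leI) auto
        also have "\<dots> = ennreal e" using e by (subst ennreal_plus[symmetric]) auto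
        finally show "(\<integral>\<^sup>+w. ennreal (norm (E (\<lambda>w. T k w - h w) w)) \<partial>lebesgue) \<le> ennreal e" .
      qed
    qed
  qed
  then have 1: "(\<lambda>k. (1 / sqrt (2 * pi)) *\<^sub>R (LINT w|lebesgue. E (T k) w)) \<longlonglongrightarrow> (1 / sqrt (2 * pi)) *\<^sub>R (LINT w|lebesgue. E h w)"
    by (intro tendsto_intros)
  \<comment> \<open>At the fixed point z the weight tends to 1; in real components the product with
    a Clifford number is a limit of scalar multiples.\<close>
  have "(\<lambda>k. Re (r k z) *\<^sub>R f (of_slice J z) + Im (r k z) *\<^sub>R (J * f (of_slice J z))) \<longlonglongrightarrow>
      Re 1 *\<^sub>R f (of_slice J z) + Im 1 *\<^sub>R (J * f (of_slice J z))"
    by (intro tendsto_intros r_tendsto)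
  then have "(\<lambda>k. of_slice J (r k z) * f (of_slice J z)) \<longlonglongrightarrow> f (of_slice J z)"
    by (simp add: of_slice_mult_eq)
  with 1 have "f (of_slice J z) = (1 / sqrt (2 * pi)) *\<^sub>R (LINT w|lebesgue. E h w)"
    unfolding rep[symmetric] using LIMSEQ_unique by blast
  with int_E show "set_integrable lebesgue {..0}
        (\<lambda>w. clifford_exp (w *\<^sub>R slice_pt J u v) * fourier p J (nt_limit f J) w) \<and>
      f (slice_pt J u v) = (1 / sqrt (2 * pi)) *\<^sub>R
        (LINT w:{..0}|lebesgue. clifford_exp (w *\<^sub>R slice_pt J u v) * fourier p J (nt_limit f J) w)"
    unfolding clifford_exp_slice_pt[OF J] unfolding set_integrable_def set_lebesgue_integral_def h_def[symmetric] slice_pt_eq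
      E_def z_def by simp
qed

theorem theorem3p3:
  fixes f :: "'n::{finite,linorder} clifford \<Rightarrow> 'n clifford" and p :: real
  assumes "1 \<le> p" and "p \<le> 2"
    and "f \<in> hardy_slice p"
  shows "\<forall>J\<in>imag_sphere.
    ess_support (fourier p J (nt_limit f J)) \<subseteq> {..0} \<and>
    (\<forall>u>0. \<forall>v.
      set_integrable lebesgue {..0}
        (\<lambda>w. clifford_exp (w *\<^sub>R slice_pt J u v) * fourier p J (nt_limit f J) w) \<and>
      f (slice_pt J u v) =
        (1 / sqrt (2 * pi)) *\<^sub>R
        (LINT w:{..0}|lebesgue. clifford_exp (w *\<^sub>R slice_pt J u v) * fourier p J (nt_limit f J) w))"
proof (cases "p = 1")
  \<comment> \<open>For p = 1 the conjugate exponent p / (p - 1) is not a real number and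
    \<open>fourier\<close> is the integral itself.\<close>
  case True
  then show ?thesis
    using hardy_slice_1_representation assms(3) by blast
next
  case False
  then have "1 < p" using assms(1) by simp
  then show ?thesis
    using hardy_slice_representation assms(2,3) by blast
qed

end
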